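(* Let $k\geqslant1$. The isomorphism classes of irreducible (complex) representations of the monoid $\mathcal{U}_k$ of uniform block permutations are indexed by (i.e. are in bijection with) the set $$I_k=\Big\{(\lambda^{(1)},\lambda^{(2)},\dots,\lambda^{(k)}):\ \lambda^{(i)}\text{ are partitions such that }\sum_{i=1}^k i\,|\lambda^{(i)}|=k\Big\}.$$
   Context: $[k]=\{1,\dots,k\}$, $[\overline{k}]=\{\overline1,\dots,\overline k\}$. $\mathcal{U}_k$ is the set of set partitions $d$ of $[k]\cup[\overline k]$ such that $|B\cap[k]|=|B\cap[\overline k]|$ for every block $B$ of $d$. Product $dd'$: draw $d$ and $d'$ as two-row diagrams (top row $[k]$, bottom row $[\overline k]$, blocks = connected components), stack $d$ on top of $d'$ identifying bottom vertex $\overline i$ of $d$ with top vertex $i$ of $d'$, take connected components, delete the middle vertices. This makes $\mathcal{U}_k$ a finite monoid with identity $\{\{i,\overline i\}:i\in[k]\}$. Partitions may be empty (the unique partition of $0$), and $|\lambda|$ is the sum of the parts of $\lambda$. An irreducible representation of $\mathcal{U}_k$ is a simple $\mathbb{C}\mathcal{U}_k$-module. *)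

theory Defs
  imports Complex_Main "HOL-Library.Disjoint_Sets" "HOL-Library.Multiset" "HOL-Algebra.Module"
begin

section \<open>Uniform block permutations\<close>

text \<open>The vertex \<open>Up i\<close> is the element \<open>i\<close> of the top row \<open>[k]\<close>, and \<open>Down i\<close> is the
  barred element of the bottom row.\<close>

datatype vertex = Up nat | Down nat

type_synonym diagram = "vertex set set"

definition vertices :: "nat \<Rightarrow> vertex set" where
  "vertices k = Up ` {1..k} \<union> Down ` {1..k}"

definition uniform_block_perms :: "nat \<Rightarrow> diagram set" where
  "uniform_block_perms k =
     {d. partition_on (vertices k) d \<and>
         (\<forall>B\<in>d. card (B \<inter> Up ` {1..k}) = card (B \<inter> Down ` {1..k}))}"

text \<open>When \<open>d\<close> is stacked on top of \<open>d'\<close>, the bottom row of \<open>d\<close> and the top row of \<open>d'\<close>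
  become the same row of middle vertices.\<close>

datatype stack_vertex = Top nat | Mid nat | Bot nat

fun upper :: "vertex \<Rightarrow> stack_vertex" where
  "upper (Up i) = Top i"
| "upper (Down i) = Mid i"

fun lower :: "vertex \<Rightarrow> stack_vertex" where
  "lower (Up i) = Mid i"
| "lower (Down i) = Bot i"

fun outer :: "vertex \<Rightarrow> stack_vertex" where
  "outer (Up i) = Top i"
| "outer (Down i) = Bot i"

definition stack :: "diagram \<Rightarrow> diagram \<Rightarrow> stack_vertex set set" where
  "stack d d' = (`) upper ` d \<union> (`) lower ` d'"

definition connected_in_stack :: "diagram \<Rightarrow> diagram \<Rightarrow> (stack_vertex \<times> stack_vertex) set" where
  "connected_in_stack d d' = (\<Union>B\<in>stack d d'. B \<times> B)\<^sup>+"

text \<open>Taking preimages under \<^const>\<open>outer\<close> deletes the middle vertices from each component;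
  a component consisting of middle vertices only is dropped.\<close>

definition compose_diagrams :: "diagram \<Rightarrow> diagram \<Rightarrow> diagram" where
  "compose_diagrams d d' =
     (\<lambda>C. outer -` C) ` (\<Union>(stack d d') // connected_in_stack d d') - {{}}"

definition ubp_monoid :: "nat \<Rightarrow> diagram monoid" where
  "ubp_monoid k =
     \<lparr>carrier = uniform_block_perms k,
      mult = compose_diagrams,
      one = (\<lambda>i. {Up i, Down i}) ` {1..k}\<rparr>"


section \<open>Modules over the complex algebra of a finite monoid\<close>

text \<open>The formal combination \<open>\<Sum>x. f x \<cdot> x\<close> of elements of a finite monoid is represented by its
  coefficient function \<open>f\<close>, which is set to \<open>0\<close> outside the carrier.\<close>

definition monoid_algebra :: "('a, 'm) monoid_scheme \<Rightarrow> ('a \<Rightarrow> complex) ring" where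
  "monoid_algebra G =
     \<lparr>carrier = {f. \<forall>x. x \<notin> carrier G \<longrightarrow> f x = 0},
      mult = (\<lambda>f g z. \<Sum>(x, y) \<in> {(x, y) \<in> carrier G \<times> carrier G. x \<otimes>\<^bsub>G\<^esub> y = z}. f x * g y),
      one = (\<lambda>z. if z = \<one>\<^bsub>G\<^esub> then 1 else 0),
      zero = (\<lambda>z. 0),
      add = (\<lambda>f g z. f z + g z)\<rparr>"

text \<open>The axioms are those of \<^locale>\<open>module\<close>, which however requires the ring of scalars to be
  commutative. The fields \<^const>\<open>mult\<close> and \<^const>\<open>one\<close> of the record \<open>M\<close> play no role.\<close>

locale left_module = R?: ring R + M?: abelian_group M
  for R (structure) and M (structure) +
  assumes smult_closed:
      "\<lbrakk>a \<in> carrier R; x \<in> carrier M\<rbrakk> \<Longrightarrow> a \<odot>\<^bsub>M\<^esub> x \<in> carrier M"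
    and smult_l_distr:
      "\<lbrakk>a \<in> carrier R; b \<in> carrier R; x \<in> carrier M\<rbrakk> \<Longrightarrow>
       (a \<oplus> b) \<odot>\<^bsub>M\<^esub> x = a \<odot>\<^bsub>M\<^esub> x \<oplus>\<^bsub>M\<^esub> b \<odot>\<^bsub>M\<^esub> x"
    and smult_r_distr:
      "\<lbrakk>a \<in> carrier R; x \<in> carrier M; y \<in> carrier M\<rbrakk> \<Longrightarrow>
       a \<odot>\<^bsub>M\<^esub> (x \<oplus>\<^bsub>M\<^esub> y) = a \<odot>\<^bsub>M\<^esub> x \<oplus>\<^bsub>M\<^esub> a \<odot>\<^bsub>M\<^esub> y"
    and smult_assoc1:
      "\<lbrakk>a \<in> carrier R; b \<in> carrier R; x \<in> carrier M\<rbrakk> \<Longrightarrow>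
       (a \<otimes> b) \<odot>\<^bsub>M\<^esub> x = a \<odot>\<^bsub>M\<^esub> (b \<odot>\<^bsub>M\<^esub> x)"
    and smult_one:
      "x \<in> carrier M \<Longrightarrow> \<one> \<odot>\<^bsub>M\<^esub> x = x"

definition simple_module :: "('r, 'p) ring_scheme \<Rightarrow> ('r, 'v) module \<Rightarrow> bool" where
  "simple_module R M \<longleftrightarrow>
     left_module R M \<and> carrier M \<noteq> {\<zero>\<^bsub>M\<^esub>} \<and>
     (\<forall>H. submodule H R M \<longrightarrow> H = {\<zero>\<^bsub>M\<^esub>} \<or> H = carrier M)"

definition module_iso ::
    "('r, 'p) ring_scheme \<Rightarrow> ('r, 'v) module \<Rightarrow> ('r, 'w) module \<Rightarrow> bool" where
  "module_iso R M N \<longleftrightarrow>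
     (\<exists>f. f \<in> iso (add_monoid M) (add_monoid N) \<and>
          (\<forall>a\<in>carrier R. \<forall>x\<in>carrier M. f (a \<odot>\<^bsub>M\<^esub> x) = a \<odot>\<^bsub>N\<^esub> f x))"


section \<open>Irreducible representations and their indexing set\<close>

text \<open>A HOL set of isomorphism classes needs a fixed type for the elements of the modules. The type
  \<^typ>\<open>nat \<Rightarrow> complex\<close> contains a copy of every finite-dimensional complex vector space, hence
  of every simple module over a finite-dimensional algebra. That no class is lost by this choice is
  part of the theorem: its second conjunct concerns simple modules on an arbitrary type.\<close>

type_synonym rep = "(diagram \<Rightarrow> complex, nat \<Rightarrow> complex) module"

definition irreps :: "nat \<Rightarrow> rep set" where
  "irreps k = {M. simple_module (monoid_algebra (ubp_monoid k)) M}"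

definition irrep_classes :: "nat \<Rightarrow> rep set set" where
  "irrep_classes k =
     irreps k // {(M, N) \<in> irreps k \<times> irreps k. module_iso (monoid_algebra (ubp_monoid k)) M N}"

text \<open>An integer partition is the multiset of its (positive) parts.\<close>

definition int_partitions :: "nat multiset set" where
  "int_partitions = {p. 0 \<notin># p}"

definition index_set :: "nat \<Rightarrow> (nat \<Rightarrow> nat multiset) set" where
  "index_set k = {p \<in> {1..k} \<rightarrow>\<^sub>E int_partitions. (\<Sum>i=1..k. i * \<Sum>\<^sub># (p i)) = k}"

end

theory Submission
  imports Defs "HOL-Library.Function_Algebras"
    "HOL-Computational_Algebra.Fundamental_Theorem_Algebra" "HOL-Combinatorics.Orbits"
begin

text \<open>A diagram is determined by the relation between subsets of the top row and subsets of the bottom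
  row whose union is a union of blocks. Stacking becomes composition of relations, and uniformity
  makes these relations injective partial functions, closed under converse. Hence \<open>U\<^sub>k\<close> is an inverse
  monoid, and by Moebius inversion its algebra is isomorphic to the algebra of a groupoid. The latter
  carries a positive definite inner product for which left and right multiplications have adjoints,
  so orthogonal complements of one-sided ideals are one-sided ideals. It follows that the classes of
  simple modules correspond to central idempotents forming a basis of the centre. The indicator functions
  of the conjugacy classes of loops of the groupoid form another basis. A loop is a size-preserving
  permutation of the blocks of a set partition of \<open>[k]\<close>; up to conjugacy it is given by its cycle
  type on the blocks of size \<open>i\<close>, which is the partition \<open>\<lambda>\<^sup>(\<^sup>i\<^sup>)\<close>.\<close>

section \<open>Simple modules\<close>

text \<open>In the groupoid basis products are partial but cancellative, so the adjoint of
  multiplication by an arrow is multiplication by the inverse arrow. The structure theory is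
  confined to what counting needs: instead of a decomposition into matrix algebras, the projection
  of the unit onto the complement of an annihilator yields one central idempotent per class, and
  algebraic closedness enters once, to show that a central element acts on a simple module as a
  scalar. Modules may live on any type, so they are compared through minimal left ideals, which live
  in the algebra itself. The bijection obtained is not explicit: it expresses that two bases of one
  finite-dimensional space are equinumerous. A cycle of length l through blocks of size i uses i l
  points of \<open>[k]\<close>, whence the weights in the condition on the partitions.\<close>

definition scale :: "complex \<Rightarrow> ('a \<Rightarrow> complex) \<Rightarrow> 'a \<Rightarrow> complex" where
  "scale c f = (\<lambda>x. c * f x)"

lemma scale_apply [simp]: "scale c f x = c * f x"
  by (simp add: scale_def)

interpretation cvs: vector_space scale
  by unfold_locales (auto simp: algebra_simps)

context left_module
begin

lemma smult_l_null: "x \<in> carrier M \<Longrightarrow> \<zero> \<odot>\<^bsub>M\<^esub> x = \<zero>\<^bsub>M\<^esub>"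
  using smult_l_distr[of \<zero> \<zero> x] smult_closed[of \<zero> x] M.add.r_cancel_one by auto

lemma smult_r_null: "a \<in> carrier R \<Longrightarrow> a \<odot>\<^bsub>M\<^esub> \<zero>\<^bsub>M\<^esub> = \<zero>\<^bsub>M\<^esub>"
  using smult_r_distr[of a "\<zero>\<^bsub>M\<^esub>" "\<zero>\<^bsub>M\<^esub>"] smult_closed[of a "\<zero>\<^bsub>M\<^esub>"] M.add.r_cancel_one by auto

lemma smult_l_minus:
  assumes "a \<in> carrier R" "x \<in> carrier M"
  shows "(\<ominus> a) \<odot>\<^bsub>M\<^esub> x = \<ominus>\<^bsub>M\<^esub> (a \<odot>\<^bsub>M\<^esub> x)"
proof -
  have "(\<ominus> a) \<odot>\<^bsub>M\<^esub> x \<oplus>\<^bsub>M\<^esub> a \<odot>\<^bsub>M\<^esub> x = \<zero>\<^bsub>M\<^esub>"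
    using smult_l_distr[of "\<ominus> a" a x] assms by (simp add: smult_l_null R.l_neg)
  then show ?thesis
    using assms M.minus_equality smult_closed by (metis R.a_inv_closed)
qed

text \<open>Closure under additive inverses comes for free, since the inverse of x is the product of
  minus one with x.\<close>

lemma submoduleI:
  assumes "H \<subseteq> carrier M" "\<zero>\<^bsub>M\<^esub> \<in> H"
    and "\<And>x y. x \<in> H \<Longrightarrow> y \<in> H \<Longrightarrow> x \<oplus>\<^bsub>M\<^esub> y \<in> H"
    and smult: "\<And>a x. a \<in> carrier R \<Longrightarrow> x \<in> H \<Longrightarrow> a \<odot>\<^bsub>M\<^esub> x \<in> H"
  shows "submodule H R M"
proof (intro submodule.intro subgroup.intro submodule_axioms.intro)
  fix x assume x: "x \<in> H"
  have "(\<ominus> \<one>) \<odot>\<^bsub>M\<^esub> x = \<ominus>\<^bsub>M\<^esub> x"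
    using x assms(1) smult_l_minus[of \<one> x] smult_one by auto
  then show "inv\<^bsub>add_monoid M\<^esub> x \<in> H"
    using smult[of "\<ominus> \<one>" x] x by (simp add: a_inv_def)
qed (use assms in auto)

end

lemma submodule_zero: "submodule H R M \<Longrightarrow> \<zero>\<^bsub>M\<^esub> \<in> H"
  using subgroup.one_closed[OF submodule.axioms(1)] by fastforce

lemma submodule_add: "submodule H R M \<Longrightarrow> x \<in> H \<Longrightarrow> y \<in> H \<Longrightarrow> x \<oplus>\<^bsub>M\<^esub> y \<in> H"
  using subgroup.m_closed[OF submodule.axioms(1)] by fastforce

lemma submodule_subset: "submodule H R M \<Longrightarrow> H \<subseteq> carrier M"
  using subgroup.subset[OF submodule.axioms(1)] by fastforce

lemma submodule_smult: "submodule H R M \<Longrightarrow> a \<in> carrier R \<Longrightarrow> x \<in> H \<Longrightarrow> a \<odot>\<^bsub>M\<^esub> x \<in> H"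
  by (rule submodule.smult_closed)

definition module_hom_on ::
    "('r, 'p) ring_scheme \<Rightarrow> ('r, 'v) module \<Rightarrow> ('r, 'w) module \<Rightarrow> ('v \<Rightarrow> 'w) \<Rightarrow> bool" where
  "module_hom_on R M N f \<longleftrightarrow> f \<in> carrier M \<rightarrow> carrier N \<and>
     (\<forall>x\<in>carrier M. \<forall>y\<in>carrier M. f (x \<oplus>\<^bsub>M\<^esub> y) = f x \<oplus>\<^bsub>N\<^esub> f y) \<and>
     (\<forall>a\<in>carrier R. \<forall>x\<in>carrier M. f (a \<odot>\<^bsub>M\<^esub> x) = a \<odot>\<^bsub>N\<^esub> f x)"

lemma module_iso_iff:
  "module_iso R M N \<longleftrightarrow> (\<exists>f. module_hom_on R M N f \<and> bij_betw f (carrier M) (carrier N))"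
  unfolding module_iso_def module_hom_on_def iso_def hom_def by auto

lemma module_iso_sym:
  assumes "left_module R M" "module_iso R M N"
  shows "module_iso R N M"
proof -
  interpret left_module R M by fact
  obtain f where f: "f \<in> iso (add_monoid M) (add_monoid N)"
    and smult: "\<And>a x. a \<in> carrier R \<Longrightarrow> x \<in> carrier M \<Longrightarrow> f (a \<odot>\<^bsub>M\<^esub> x) = a \<odot>\<^bsub>N\<^esub> f x"
    using assms(2) unfolding module_iso_def by blast
  let ?g = "inv_into (carrier M) f"
  have bij: "bij_betw f (carrier M) (carrier N)"
    using f by (simp add: iso_def)
  have "?g \<in> iso (add_monoid N) (add_monoid M)"
    using M.add.iso_set_sym[OF f] by simp
  moreover have "?g (a \<odot>\<^bsub>N\<^esub> y) = a \<odot>\<^bsub>M\<^esub> ?g y" if a: "a \<in> carrier R" and y: "y \<in> carrier N" for a y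
  proof -
    obtain x where x: "x \<in> carrier M" "y = f x"
      using bij y by (auto simp: bij_betw_def)
    then have "a \<odot>\<^bsub>N\<^esub> y = f (a \<odot>\<^bsub>M\<^esub> x)"
      using smult a by simp
    then show ?thesis
      using x bij smult_closed[OF a x(1)] by (simp add: bij_betw_inv_into_left)
  qed
  ultimately show ?thesis
    unfolding module_iso_def by blast
qed

lemma module_iso_trans:
  assumes "module_iso R L M" "module_iso R M N"
  shows "module_iso R L N"
proof -
  obtain f g where f: "module_hom_on R L M f" "bij_betw f (carrier L) (carrier M)"
    and g: "module_hom_on R M N g" "bij_betw g (carrier M) (carrier N)"
    using assms unfolding module_iso_iff by blast
  have "module_hom_on R L N (g \<circ> f)"
    using f(1) g(1) unfolding module_hom_on_def by (auto simp: Pi_iff)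
  then show ?thesis
    using bij_betw_trans[OF f(2) g(2)] unfolding module_iso_iff by blast
qed

lemma module_hom_zero:
  assumes "left_module R M" "left_module R N" "module_hom_on R M N f"
  shows "f \<zero>\<^bsub>M\<^esub> = \<zero>\<^bsub>N\<^esub>"
proof -
  interpret M: left_module R M by fact
  interpret N: left_module R N by fact
  have "f \<zero>\<^bsub>M\<^esub> = \<zero>\<^bsub>R\<^esub> \<odot>\<^bsub>N\<^esub> f \<zero>\<^bsub>M\<^esub>"
    using assms(3) M.smult_l_null[of "\<zero>\<^bsub>M\<^esub>"] unfolding module_hom_on_def
    by (metis M.M.zero_closed M.R.zero_closed)
  then show ?thesis
    using assms(3) N.smult_l_null[of "f \<zero>\<^bsub>M\<^esub>"] unfolding module_hom_on_def by auto
qed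

text \<open>Schur's lemma: kernel and image are submodules, and one nonzero value forces the kernel
  to be zero and the image to be everything.\<close>

lemma simple_module_hom_iso:
  assumes M: "simple_module R M" and N: "simple_module R N" and f: "module_hom_on R M N f"
    and nz: "x \<in> carrier M" "f x \<noteq> \<zero>\<^bsub>N\<^esub>"
  shows "bij_betw f (carrier M) (carrier N)"
proof -
  interpret M: left_module R M using M by (simp add: simple_module_def)
  interpret N: left_module R N using N by (simp add: simple_module_def)
  have f0: "f \<zero>\<^bsub>M\<^esub> = \<zero>\<^bsub>N\<^esub>"
    using module_hom_zero[OF M.left_module_axioms N.left_module_axioms f] .
  have f_closed: "\<And>x. x \<in> carrier M \<Longrightarrow> f x \<in> carrier N"
    and f_add: "\<And>x y. x \<in> carrier M \<Longrightarrow> y \<in> carrier M \<Longrightarrow> f (x \<oplus>\<^bsub>M\<^esub> y) = f x \<oplus>\<^bsub>N\<^esub> f y"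
    and f_smult: "\<And>a x. a \<in> carrier R \<Longrightarrow> x \<in> carrier M \<Longrightarrow> f (a \<odot>\<^bsub>M\<^esub> x) = a \<odot>\<^bsub>N\<^esub> f x"
    using f by (auto simp: module_hom_on_def)
  have "submodule {x \<in> carrier M. f x = \<zero>\<^bsub>N\<^esub>} R M"
    by (rule M.submoduleI) (auto simp: f0 f_add f_smult N.smult_r_null M.smult_closed)
  then have "{x \<in> carrier M. f x = \<zero>\<^bsub>N\<^esub>} = {\<zero>\<^bsub>M\<^esub>}"
    using M nz unfolding simple_module_def by blast
  then have ker: "x = \<zero>\<^bsub>M\<^esub>" if "x \<in> carrier M" "f x = \<zero>\<^bsub>N\<^esub>" for x
    using that by blast
  have "inj_on f (carrier M)"
  proof (rule inj_onI)
    fix x y assume xy: "x \<in> carrier M" "y \<in> carrier M" "f x = f y"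
    have "f (\<ominus>\<^bsub>M\<^esub> y) = \<ominus>\<^bsub>N\<^esub> f y"
      using f_add[of "\<ominus>\<^bsub>M\<^esub> y" y] xy f0 f_closed N.M.minus_equality
      by (metis M.M.a_inv_closed M.M.l_neg)
    then have "f (x \<oplus>\<^bsub>M\<^esub> \<ominus>\<^bsub>M\<^esub> y) = \<zero>\<^bsub>N\<^esub>"
      using xy f_add f_closed by (simp add: N.M.r_neg)
    then have "x \<oplus>\<^bsub>M\<^esub> \<ominus>\<^bsub>M\<^esub> y = \<zero>\<^bsub>M\<^esub>"
      using ker xy by simp
    then show "x = y"
      using xy by (metis M.M.a_inv_closed M.M.minus_equality M.M.minus_minus)
  qed
  moreover have "submodule (f ` carrier M) R N"
    by (rule N.submoduleI) (auto simp: f_closed f0[symmetric] f_add[symmetric] f_smult[symmetric] M.smult_closed)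
  then have "f ` carrier M = carrier N"
    using N nz unfolding simple_module_def by blast
  ultimately show ?thesis
    by (simp add: bij_betw_def)
qed

text \<open>Transport of structure along a map that is injective on the carrier. It later moves
  minimal left ideals to the type \<open>nat \<Rightarrow> complex\<close>.\<close>

definition image_module :: "('v \<Rightarrow> 'w) \<Rightarrow> ('r, 'v) module \<Rightarrow> ('r, 'w) module" where
  "image_module f M =
     (let g = inv_into (carrier M) f in
      \<lparr>carrier = f ` carrier M, mult = undefined, one = undefined, zero = f \<zero>\<^bsub>M\<^esub>,
       add = (\<lambda>x y. f (g x \<oplus>\<^bsub>M\<^esub> g y)), module.smult = (\<lambda>a x. f (a \<odot>\<^bsub>M\<^esub> g x))\<rparr>)"

lemma image_module_simps:
  assumes "inj_on f (carrier M)"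
  shows "carrier (image_module f M) = f ` carrier M"
    "\<zero>\<^bsub>image_module f M\<^esub> = f \<zero>\<^bsub>M\<^esub>"
    "x \<in> carrier M \<Longrightarrow> y \<in> carrier M \<Longrightarrow> f x \<oplus>\<^bsub>image_module f M\<^esub> f y = f (x \<oplus>\<^bsub>M\<^esub> y)"
    "x \<in> carrier M \<Longrightarrow> a \<odot>\<^bsub>image_module f M\<^esub> f x = f (a \<odot>\<^bsub>M\<^esub> x)"
  using assms by (auto simp: image_module_def Let_def)

lemma left_module_image_module:
  assumes "left_module R M" and inj: "inj_on f (carrier M)"
  shows "left_module R (image_module f M)"
proof -
  interpret left_module R M by fact
  note [simp] = image_module_simps[OF inj] smult_closed
  have "abelian_group (image_module f M)"
  proof (rule abelian_groupI; clarsimp)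
    fix x y z assume "x \<in> carrier M" "y \<in> carrier M" "z \<in> carrier M"
    then show "f (x \<oplus>\<^bsub>M\<^esub> y \<oplus>\<^bsub>M\<^esub> z) = f (x \<oplus>\<^bsub>M\<^esub> (y \<oplus>\<^bsub>M\<^esub> z))"
      by (simp add: M.a_assoc)
  next
    fix x y assume "x \<in> carrier M" "y \<in> carrier M"
    then show "f (x \<oplus>\<^bsub>M\<^esub> y) = f (y \<oplus>\<^bsub>M\<^esub> x)"
      by (simp add: M.a_comm)
  next
    fix x assume "x \<in> carrier M"
    then show "\<exists>y\<in>carrier M. f (y \<oplus>\<^bsub>M\<^esub> x) = f \<zero>\<^bsub>M\<^esub>"
      by (intro bexI[of _ "\<ominus>\<^bsub>M\<^esub> x"]) (auto simp: M.l_neg)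
  qed
  moreover have "left_module_axioms R (image_module f M)"
    by unfold_locales
      (auto simp: smult_l_distr smult_r_distr smult_assoc1 smult_one)
  ultimately show ?thesis
    by (simp add: left_module_def R.ring_axioms)
qed

lemma module_iso_image_module:
  assumes "left_module R M" and inj: "inj_on f (carrier M)"
  shows "module_iso R M (image_module f M)"
  unfolding module_iso_iff module_hom_on_def
  using image_module_simps[OF inj] inj by (intro exI[of _ f]) (auto simp: bij_betw_def)

lemma simple_module_iso:
  assumes M: "simple_module R M" and N: "left_module R N" and iso: "module_iso R M N"
  shows "simple_module R N"
proof -
  interpret M: left_module R M using M by (simp add: simple_module_def)
  interpret N: left_module R N by fact
  obtain f where f: "module_hom_on R M N f" "bij_betw f (carrier M) (carrier N)"
    using iso unfolding module_iso_iff by blast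
  have f_closed: "\<And>x. x \<in> carrier M \<Longrightarrow> f x \<in> carrier N"
    and f_add: "\<And>x y. x \<in> carrier M \<Longrightarrow> y \<in> carrier M \<Longrightarrow> f (x \<oplus>\<^bsub>M\<^esub> y) = f x \<oplus>\<^bsub>N\<^esub> f y"
    and f_smult: "\<And>a x. a \<in> carrier R \<Longrightarrow> x \<in> carrier M \<Longrightarrow> f (a \<odot>\<^bsub>M\<^esub> x) = a \<odot>\<^bsub>N\<^esub> f x"
    using f by (auto simp: module_hom_on_def)
  have f0: "f \<zero>\<^bsub>M\<^esub> = \<zero>\<^bsub>N\<^esub>"
    using module_hom_zero[OF M.left_module_axioms N f(1)] .
  have img: "f ` carrier M = carrier N" and inj: "inj_on f (carrier M)"
    using f(2) by (auto simp: bij_betw_def)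
  have "H = {\<zero>\<^bsub>N\<^esub>} \<or> H = carrier N" if H: "submodule H R N" for H
  proof -
    let ?K = "{x \<in> carrier M. f x \<in> H}"
    have "submodule ?K R M"
      by (rule M.submoduleI)
        (auto simp: f0 f_add f_smult M.smult_closed submodule_zero[OF H] submodule_add[OF H]
          submodule_smult[OF H])
    then have K: "?K = {\<zero>\<^bsub>M\<^esub>} \<or> ?K = carrier M"
      using M by (simp add: simple_module_def)
    have "H \<subseteq> f ` carrier M"
      using img submodule_subset[OF H] by simp
    then have H_eq: "H = f ` ?K"
      by auto
    show ?thesis
      using K
    proof
      assume K: "?K = {\<zero>\<^bsub>M\<^esub>}"
      show ?thesis
        using H_eq unfolding K by (simp add: f0)
    next
      assume K: "?K = carrier M"
      show ?thesis
        using H_eq unfolding K by (simp add: img)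
    qed
  qed
  moreover have "carrier N \<noteq> {\<zero>\<^bsub>N\<^esub>}"
  proof
    assume "carrier N = {\<zero>\<^bsub>N\<^esub>}"
    then have "f x = f \<zero>\<^bsub>M\<^esub>" if "x \<in> carrier M" for x
      using f_closed[OF that] f0 by simp
    then have "carrier M \<subseteq> {\<zero>\<^bsub>M\<^esub>}"
      using inj_onD[OF inj] by blast
    then show False
      using M by (auto simp: simple_module_def)
  qed
  ultimately show ?thesis
    using N by (simp add: simple_module_def)
qed

section \<open>Algebras with adjoints\<close>

lemma sum_fun_apply: "(\<Sum>i\<in>I. f i) x = (\<Sum>i\<in>I. f i x)"
  by (induction I rule: infinite_finite_induct) auto

text \<open>The setting in which ideals have complements without averaging over a group. Adjoints
  are demanded on both sides because annihilators are two-sided ideals and their complements must be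
  two-sided as well.\<close>

locale star_algebra = ring R for R :: "('a \<Rightarrow> complex) ring" (structure) +
  fixes S :: "'a set" and ip :: "('a \<Rightarrow> complex) \<Rightarrow> ('a \<Rightarrow> complex) \<Rightarrow> complex"
  assumes finite_S: "finite S"
    and carrier_eq: "carrier R = {f. \<forall>x. x \<notin> S \<longrightarrow> f x = 0}"
    and zero_eq: "\<zero> = 0"
    and add_eq: "\<And>a b. a \<oplus> b = a + b"
    and scale_mult_left: "\<lbrakk>a \<in> carrier R; b \<in> carrier R\<rbrakk> \<Longrightarrow> scale c a \<otimes> b = scale c (a \<otimes> b)"
    and scale_mult_right: "\<lbrakk>a \<in> carrier R; b \<in> carrier R\<rbrakk> \<Longrightarrow> a \<otimes> scale c b = scale c (a \<otimes> b)"
    and ip_add: "\<And>a b c. ip (a + b) c = ip a c + ip b c"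
    and ip_scale: "\<And>t a b. ip (scale t a) b = t * ip a b"
    and ip_sym: "\<And>a b. ip b a = cnj (ip a b)"
    and ip_definite: "\<lbrakk>a \<in> carrier R; ip a a = 0\<rbrakk> \<Longrightarrow> a = 0"
    and adjoint_left:
      "a \<in> carrier R \<Longrightarrow> \<exists>a'\<in>carrier R. \<forall>b\<in>carrier R. \<forall>c\<in>carrier R. ip (a \<otimes> b) c = ip b (a' \<otimes> c)"
    and adjoint_right:
      "a \<in> carrier R \<Longrightarrow> \<exists>a'\<in>carrier R. \<forall>b\<in>carrier R. \<forall>c\<in>carrier R. ip (b \<otimes> a) c = ip b (c \<otimes> a')"
begin

lemma zero_in: "0 \<in> carrier R"
  and add_in: "a \<in> carrier R \<Longrightarrow> b \<in> carrier R \<Longrightarrow> a + b \<in> carrier R"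
  and diff_in: "a \<in> carrier R \<Longrightarrow> b \<in> carrier R \<Longrightarrow> a - b \<in> carrier R"
  and scale_in: "a \<in> carrier R \<Longrightarrow> scale c a \<in> carrier R"
  by (auto simp: carrier_eq)

lemma subspace_carrier: "cvs.subspace (carrier R)"
  by (auto simp: cvs.subspace_def zero_in add_in scale_in)

lemma mult_add_left:
  "\<lbrakk>a \<in> carrier R; b \<in> carrier R; c \<in> carrier R\<rbrakk> \<Longrightarrow> (a + b) \<otimes> c = a \<otimes> c + b \<otimes> c"
  using l_distr by (simp add: add_eq)

lemma mult_add_right:
  "\<lbrakk>a \<in> carrier R; b \<in> carrier R; c \<in> carrier R\<rbrakk> \<Longrightarrow> c \<otimes> (a + b) = c \<otimes> a + c \<otimes> b"
  using r_distr by (simp add: add_eq)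

lemma scale_minus_one: "scale (- 1) a = - a"
  by (rule ext) simp

lemma mult_diff_left:
  "\<lbrakk>a \<in> carrier R; b \<in> carrier R; c \<in> carrier R\<rbrakk> \<Longrightarrow> (a - b) \<otimes> c = a \<otimes> c - b \<otimes> c"
  using mult_add_left[of a "scale (- 1) b" c] scale_mult_left[of b c "- 1"]
    scale_in[of b "- 1"]
  by (simp add: scale_minus_one)

lemma mult_diff_right:
  "\<lbrakk>a \<in> carrier R; b \<in> carrier R; c \<in> carrier R\<rbrakk> \<Longrightarrow> c \<otimes> (a - b) = c \<otimes> a - c \<otimes> b"
  using mult_add_right[of a "scale (- 1) b" c] scale_mult_right[of c b "- 1"]
    scale_in[of b "- 1"]
  by (simp add: scale_minus_one)

lemma mult_zero: "a \<in> carrier R \<Longrightarrow> 0 \<otimes> a = 0" "a \<in> carrier R \<Longrightarrow> a \<otimes> 0 = 0"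
  using l_null[of a] r_null[of a] by (simp_all add: zero_eq)

lemma sum_in: "(\<And>i. i \<in> I \<Longrightarrow> f i \<in> carrier R) \<Longrightarrow> sum f I \<in> carrier R"
  using cvs.subspace_sum[OF subspace_carrier] .

lemma mult_sum_left:
  assumes "\<And>i. i \<in> I \<Longrightarrow> f i \<in> carrier R" "b \<in> carrier R"
  shows "sum f I \<otimes> b = (\<Sum>i\<in>I. f i \<otimes> b)"
  using assms by (induction I rule: infinite_finite_induct) (auto simp: mult_zero mult_add_left sum_in)

lemma mult_sum_right:
  assumes "\<And>i. i \<in> I \<Longrightarrow> f i \<in> carrier R" "b \<in> carrier R"
  shows "b \<otimes> sum f I = (\<Sum>i\<in>I. b \<otimes> f i)"
  using assms by (induction I rule: infinite_finite_induct) (auto simp: mult_zero mult_add_right sum_in)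

lemma ip_zero: "ip 0 b = 0" "ip b 0 = 0"
proof -
  show *: "ip 0 b = 0" for b
    using ip_add[of 0 0 b] by simp
  show "ip b 0 = 0"
    using ip_sym[of 0 b] * by simp
qed

lemma ip_diff: "ip (a - b) c = ip a c - ip b c"
  using ip_add[of "a - b" b c] by simp

lemma ip_add_right: "ip a (b + c) = ip a b + ip a c"
  by (metis ip_sym ip_add complex_cnj_add complex_cnj_cnj)

lemma ip_scale_right: "ip a (scale t b) = cnj t * ip a b"
  by (metis ip_sym ip_scale complex_cnj_mult complex_cnj_cnj)

lemma ip_zero_on_span:
  assumes "\<And>v. v \<in> B \<Longrightarrow> ip a v = 0" "v \<in> cvs.span B"
  shows "ip a v = 0"
proof -
  have "cvs.span B \<subseteq> {v. ip a v = 0}"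
    using assms(1) by (intro cvs.span_minimal)
      (auto simp: cvs.subspace_def ip_zero ip_add_right ip_scale_right)
  then show ?thesis
    using assms(2) by blast
qed

section \<open>Finite dimension and orthogonal projection\<close>

definition basis :: "('a \<Rightarrow> complex) set" where
  "basis = (\<lambda>s t. if t = s then 1 else 0) ` S"

lemma finite_basis: "finite basis"
  using finite_S by (simp add: basis_def)

lemma carrier_subset_span: "carrier R \<subseteq> cvs.span basis"
proof
  fix f assume f: "f \<in> carrier R"
  have "f = (\<Sum>s\<in>S. scale (f s) (\<lambda>t. if t = s then 1 else 0))"
  proof (rule ext)
    fix t
    have "(\<Sum>s\<in>S. scale (f s) (\<lambda>t. if t = s then 1 else 0)) t = (\<Sum>s\<in>S. if t = s then f s else 0)"
      by (subst sum_fun_apply) (auto intro!: sum.cong)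
    then show "f t = (\<Sum>s\<in>S. scale (f s) (\<lambda>t. if t = s then 1 else 0)) t"
      using f finite_S by (auto simp: sum.delta' carrier_eq)
  qed
  moreover have "\<dots> \<in> cvs.span basis"
    by (intro cvs.span_sum cvs.span_scale cvs.span_base) (auto simp: basis_def)
  ultimately show "f \<in> cvs.span basis"
    by simp
qed

lemma independent_finite: "B \<subseteq> carrier R \<Longrightarrow> cvs.independent B \<Longrightarrow> finite B"
  using cvs.independent_span_bound[OF finite_basis] carrier_subset_span by blast

text \<open>Gram-Schmidt along a finite basis of W, adding one vector at a time; definiteness of the
  form keeps the divisor nonzero.\<close>

lemma projection_exists:
  assumes W: "cvs.subspace W" "W \<subseteq> carrier R" and a: "a \<in> carrier R"
  shows "\<exists>w\<in>W. \<forall>v\<in>W. ip (a - w) v = 0"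
proof -
  have gs: "\<forall>a\<in>carrier R. \<exists>w\<in>cvs.span B. \<forall>b\<in>B. ip (a - w) b = 0"
    if "finite B" "B \<subseteq> carrier R" for B
    using that
  proof (induction B rule: finite_induct)
    case empty
    then show ?case
      using cvs.span_zero by blast
  next
    case (insert b B)
    then obtain w0 where w0: "w0 \<in> cvs.span B" "\<forall>v\<in>B. ip (b - w0) v = 0"
      by blast
    \<comment> \<open>The part of b orthogonal to the span of B. It may vanish; the correction term
      built from it below is then zero.\<close>
    define b' where "b' = b - w0"
    have b': "b' \<in> carrier R"
      using insert.prems w0 cvs.span_minimal[OF _ subspace_carrier, of B] diff_in
      unfolding b'_def by blast
    have mono: "cvs.span B \<subseteq> cvs.span (insert b B)"
      by (rule cvs.span_mono) auto
    have span_b': "b' \<in> cvs.span (insert b B)"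
      unfolding b'_def using w0(1) mono cvs.span_base[of b "insert b B"]
      by (intro cvs.span_diff) auto
    show ?case
    proof
      fix a assume a: "a \<in> carrier R"
      obtain w1 where w1: "w1 \<in> cvs.span B" "\<forall>v\<in>B. ip (a - w1) v = 0"
        using insert a by blast
      define w where "w = w1 + scale (ip (a - w1) b' / ip b' b') b'"
      have span_w: "w \<in> cvs.span (insert b B)"
        unfolding w_def using w1(1) span_b' mono by (intro cvs.span_add cvs.span_scale) auto
      have a_w: "ip (a - w) v = ip (a - w1) v - ip (a - w1) b' / ip b' b' * ip b' v" for v
        by (simp add: w_def ip_diff ip_add ip_scale)
      have ortho_B: "ip (a - w) v = 0" if "v \<in> B" for v
        using w1 w0 that by (simp add: a_w b'_def)
      then have "ip (a - w) v = 0" if "v \<in> cvs.span B" for v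
        using ip_zero_on_span that by blast
      moreover have "ip (a - w) b' = 0"
      proof (cases "b' = 0")
        case False
        then show ?thesis
          using ip_definite[OF b'] by (auto simp: a_w)
      qed (simp add: ip_zero)
      ultimately have "ip (a - w) (b' + w0) = 0"
        using w0(1) by (simp only: ip_add_right add_0)
      then have "ip (a - w) b = 0"
        by (simp add: b'_def)
      then show "\<exists>w\<in>cvs.span (insert b B). \<forall>v\<in>insert b B. ip (a - w) v = 0"
        using span_w ortho_B by blast
    qed
  qed
  obtain B where B: "B \<subseteq> W" "cvs.independent B" "W \<subseteq> cvs.span B"
    using cvs.maximal_independent_subset[of W] by blast
  have "finite B" "B \<subseteq> carrier R"
    using B W independent_finite by auto
  then obtain w where w: "w \<in> cvs.span B" "\<forall>b\<in>B. ip (a - w) b = 0"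
    using gs a by blast
  have "ip (a - w) v = 0" if "v \<in> cvs.span B" for v
    using ip_zero_on_span w(2) that by blast
  moreover have "w \<in> W"
    using cvs.span_minimal[OF B(1) W(1)] w(1) by blast
  ultimately show ?thesis
    using B by blast
qed

section \<open>Orthogonal complements of one-sided ideals\<close>

definition perp :: "('a \<Rightarrow> complex) set \<Rightarrow> ('a \<Rightarrow> complex) set" where
  "perp W = {a \<in> carrier R. \<forall>v\<in>W. ip a v = 0}"

lemma perp_disjoint: "a \<in> W \<Longrightarrow> a \<in> perp W \<Longrightarrow> a = 0"
  using ip_definite by (auto simp: perp_def)

lemma perp_decomp:
  assumes "cvs.subspace W" "W \<subseteq> carrier R" "a \<in> carrier R"
  obtains w where "w \<in> W" "a - w \<in> perp W"
  using projection_exists[OF assms] assms diff_in unfolding perp_def by blast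

definition left_ideal :: "('a \<Rightarrow> complex) set \<Rightarrow> bool" where
  "left_ideal L \<longleftrightarrow> L \<subseteq> carrier R \<and> 0 \<in> L \<and> (\<forall>x\<in>L. \<forall>y\<in>L. x + y \<in> L) \<and>
     (\<forall>a\<in>carrier R. \<forall>x\<in>L. a \<otimes> x \<in> L)"

text \<open>Scaling by c is left multiplication by c times the unit, so the ring-theoretic closure
  conditions already give a complex subspace.\<close>

lemma left_ideal_subspace:
  assumes "left_ideal L"
  shows "cvs.subspace L"
proof -
  have "scale c x \<in> L" if "x \<in> L" for c x
  proof -
    have "x \<in> carrier R"
      using assms that by (auto simp: left_ideal_def)
    then have "scale c \<one> \<otimes> x = scale c x"
      by (simp add: scale_mult_left)
    then show ?thesis
      using assms that scale_in[OF one_closed, of c] unfolding left_ideal_def by metis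
  qed
  then show ?thesis
    using assms by (auto simp: left_ideal_def cvs.subspace_def)
qed

text \<open>The adjoint moves the factor b to the other argument, where L absorbs it.\<close>

lemma left_ideal_perp:
  assumes L: "left_ideal L"
  shows "left_ideal (perp L)"
proof -
  have "b \<otimes> a \<in> perp L" if b: "b \<in> carrier R" and a: "a \<in> perp L" for a b
  proof -
    obtain b' where b': "b' \<in> carrier R"
      "\<And>x y. x \<in> carrier R \<Longrightarrow> y \<in> carrier R \<Longrightarrow> ip (b \<otimes> x) y = ip x (b' \<otimes> y)"
      using adjoint_left[OF b] by blast
    then show ?thesis
      using a b L unfolding perp_def left_ideal_def by auto
  qed
  then show ?thesis
    unfolding left_ideal_def by (auto simp: perp_def zero_in add_in ip_zero ip_add)
qed

text \<open>The mirror image, with adjoints of right multiplications. It is applied with K an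
  annihilator, whose complement thereby becomes a two-sided ideal.\<close>

lemma perp_right_mult:
  assumes K: "K \<subseteq> carrier R" "\<And>x b. x \<in> K \<Longrightarrow> b \<in> carrier R \<Longrightarrow> x \<otimes> b \<in> K"
    and a: "a \<in> perp K" and b: "b \<in> carrier R"
  shows "a \<otimes> b \<in> perp K"
proof -
  obtain b' where b': "b' \<in> carrier R"
    "\<And>x y. x \<in> carrier R \<Longrightarrow> y \<in> carrier R \<Longrightarrow> ip (x \<otimes> b) y = ip x (y \<otimes> b')"
    using adjoint_right[OF b] by blast
  then show ?thesis
    using a b K unfolding perp_def by auto
qed

section \<open>Minimal left ideals as models of simple modules\<close>

definition minimal_left_ideal :: "('a \<Rightarrow> complex) set \<Rightarrow> bool" where
  "minimal_left_ideal L \<longleftrightarrow> left_ideal L \<and> L \<noteq> {0} \<and>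
     (\<forall>L'. left_ideal L' \<longrightarrow> L' \<subseteq> L \<longrightarrow> L' = {0} \<or> L' = L)"

lemma dim_less:
  assumes W: "cvs.subspace W" and W': "W' \<subseteq> carrier R" and sub: "W \<subset> W'"
  shows "cvs.dim W < cvs.dim W'"
proof -
  obtain B where B: "B \<subseteq> W" "cvs.independent B" "W \<subseteq> cvs.span B"
    using cvs.maximal_independent_subset[of W] by blast
  obtain B' where B': "B \<subseteq> B'" "B' \<subseteq> W'" "cvs.independent B'" "W' \<subseteq> cvs.span B'"
    using cvs.maximal_independent_subset_extend[of B W'] B sub by blast
  have "B \<noteq> B'"
    using cvs.span_minimal[OF B(1) W] B' sub by auto
  then have "card B < card B'"
    using B' W' independent_finite[of B'] by (intro psubset_card_mono) auto
  then show ?thesis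
    using cvs.basis_card_eq_dim[OF B(1,3,2)] cvs.basis_card_eq_dim[OF B'(2,4,3)] by simp
qed

text \<open>Descent on the complex dimension, which drops strictly along proper inclusions of left
  ideals.\<close>

lemma minimal_left_ideal_exists:
  assumes "left_ideal L" "L \<noteq> {0}"
  shows "\<exists>L'\<subseteq>L. minimal_left_ideal L'"
  using assms
proof (induction "cvs.dim L" arbitrary: L rule: less_induct)
  case less
  show ?case
  proof (cases "minimal_left_ideal L")
    case False
    then obtain L' where L': "left_ideal L'" "L' \<subseteq> L" "L' \<noteq> {0}" "L' \<noteq> L"
      using less.prems by (auto simp: minimal_left_ideal_def)
    then have "cvs.dim L' < cvs.dim L"
      using less.prems by (intro dim_less left_ideal_subspace) (auto simp: left_ideal_def)
    then obtain L'' where "L'' \<subseteq> L'" "minimal_left_ideal L''"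
      using less.hyps[OF _ L'(1,3)] by auto
    then show ?thesis
      using L'(2) by (intro exI[of _ L'']) auto
  qed blast
qed

definition ideal_module :: "('a \<Rightarrow> complex) set \<Rightarrow> ('a \<Rightarrow> complex, 'a \<Rightarrow> complex) module" where
  "ideal_module L =
     \<lparr>carrier = L, mult = undefined, one = undefined, zero = 0, add = (+), module.smult = (\<otimes>)\<rparr>"

lemma ideal_module_simps [simp]:
  "carrier (ideal_module L) = L" "\<zero>\<^bsub>ideal_module L\<^esub> = 0"
  "x \<oplus>\<^bsub>ideal_module L\<^esub> y = x + y" "a \<odot>\<^bsub>ideal_module L\<^esub> x = a \<otimes> x"
  by (simp_all add: ideal_module_def)

lemma left_module_ideal_module:
  assumes L: "left_ideal L"
  shows "left_module R (ideal_module L)"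
proof -
  have sub: "x \<in> carrier R" if "x \<in> L" for x
    using L that by (auto simp: left_ideal_def)
  have "abelian_group (ideal_module L)"
  proof (rule abelian_groupI)
    fix x assume "x \<in> carrier (ideal_module L)"
    then have "- x \<in> L"
      using cvs.subspace_neg[OF left_ideal_subspace[OF L]] by simp
    then show "\<exists>y\<in>carrier (ideal_module L). y \<oplus>\<^bsub>ideal_module L\<^esub> x = \<zero>\<^bsub>ideal_module L\<^esub>"
      by (intro bexI[of _ "- x"]) auto
  qed (use L in \<open>auto simp: left_ideal_def algebra_simps\<close>)
  moreover have "left_module_axioms R (ideal_module L)"
    using L sub
    by unfold_locales (auto simp: add_eq left_ideal_def m_assoc mult_add_left mult_add_right)
  ultimately show ?thesis
    by (simp add: left_module_def ring_axioms)
qed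

lemma simple_ideal_module:
  assumes L: "minimal_left_ideal L"
  shows "simple_module R (ideal_module L)"
proof -
  have "H = {0} \<or> H = L" if H: "submodule H R (ideal_module L)" for H
  proof -
    note H' = submodule_zero[OF H] submodule_add[OF H] submodule_subset[OF H] submodule_smult[OF H]
    have "L \<subseteq> carrier R"
      using L by (simp add: minimal_left_ideal_def left_ideal_def)
    then have "left_ideal H"
      using H' unfolding ideal_module_simps left_ideal_def by blast
    then show ?thesis
      using L H'(3) unfolding ideal_module_simps minimal_left_ideal_def by blast
  qed
  then show ?thesis
    using L left_module_ideal_module unfolding simple_module_def minimal_left_ideal_def by simp
qed

section \<open>Annihilators and their central idempotents\<close>

definition ann :: "('a \<Rightarrow> complex, 'v) module \<Rightarrow> ('a \<Rightarrow> complex) set" where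
  "ann M = {a \<in> carrier R. \<forall>x\<in>carrier M. a \<odot>\<^bsub>M\<^esub> x = \<zero>\<^bsub>M\<^esub>}"

lemma left_ideal_annihilator:
  assumes "left_module R M"
  shows "left_ideal (ann M)"
proof -
  interpret M: left_module R M by fact
  show ?thesis
    using M.smult_l_null M.smult_r_null
    by (auto simp: left_ideal_def ann_def zero_in add_in zero_eq[symmetric] M.smult_assoc1)
      (simp add: add_eq[symmetric] M.smult_l_distr)
qed

lemma ann_right_mult:
  assumes "left_module R M" "a \<in> ann M" "b \<in> carrier R"
  shows "a \<otimes> b \<in> ann M"
proof -
  interpret M: left_module R M by fact
  show ?thesis
    using assms by (auto simp: ann_def M.smult_assoc1 M.smult_closed)
qed

lemma ann_iso_subset:
  assumes M: "left_module R M" and N: "left_module R N" and iso: "module_iso R M N"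
  shows "ann M \<subseteq> ann N"
proof
  fix a assume a: "a \<in> ann M"
  obtain f where f: "module_hom_on R M N f" "bij_betw f (carrier M) (carrier N)"
    using iso unfolding module_iso_iff by blast
  have "a \<odot>\<^bsub>N\<^esub> y = \<zero>\<^bsub>N\<^esub>" if y: "y \<in> carrier N" for y
  proof -
    obtain x where x: "x \<in> carrier M" "y = f x"
      using f(2) y by (auto simp: bij_betw_def)
    moreover have "a \<in> carrier R"
      using a by (simp add: ann_def)
    ultimately have "a \<odot>\<^bsub>N\<^esub> y = f (a \<odot>\<^bsub>M\<^esub> x)"
      using f(1) unfolding module_hom_on_def by metis
    also have "\<dots> = \<zero>\<^bsub>N\<^esub>"
      using a x module_hom_zero[OF M N f(1)] by (simp add: ann_def)
    finally show ?thesis .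
  qed
  then show "a \<in> ann N"
    using a by (simp add: ann_def)
qed

lemma ann_iso:
  assumes "left_module R M" "left_module R N" "module_iso R M N"
  shows "ann M = ann N"
  using ann_iso_subset[OF assms] ann_iso_subset[OF assms(2,1)] 
    module_iso_sym[OF assms(1,3)] by blast

text \<open>The central idempotent of the isotypic component of \<open>M\<close>: it acts on \<open>M\<close> as the identity and
  on every simple module that is not isomorphic to \<open>M\<close> as zero.\<close>

definition block_idem :: "('a \<Rightarrow> complex, 'v) module \<Rightarrow> 'a \<Rightarrow> complex" where
  "block_idem M = (SOME e. e \<in> perp (ann M) \<and> \<one> - e \<in> ann M)"

lemma block_idem:
  assumes "left_module R M"
  shows "block_idem M \<in> perp (ann M)" "\<one> - block_idem M \<in> ann M"
proof -
  have "ann M \<subseteq> carrier R"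
    by (auto simp: ann_def)
  \<comment> \<open>The unit splits along \<open>ann M\<close> and its complement; the idempotent is
    the component in the complement.\<close>
  then obtain k where "k \<in> ann M" "\<one> - k \<in> perp (ann M)"
    using perp_decomp[OF left_ideal_subspace[OF left_ideal_annihilator[OF assms]] _ one_closed]
    by blast
  then have "\<exists>e. e \<in> perp (ann M) \<and> \<one> - e \<in> ann M"
    by (intro exI[of _ "\<one> - k"]) simp
  then have "block_idem M \<in> perp (ann M) \<and> \<one> - block_idem M \<in> ann M"
    unfolding block_idem_def by (rule someI_ex)
  then show "block_idem M \<in> perp (ann M)" "\<one> - block_idem M \<in> ann M"
    by auto
qed

lemma block_idem_in: "left_module R M \<Longrightarrow> block_idem M \<in> carrier R"
  using block_idem(1)[of M] by (simp add: perp_def)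

lemma ann_in: "a \<in> ann M \<Longrightarrow> a \<in> carrier R"
  by (simp add: ann_def)

lemma ann_left_mult:
  "left_module R M \<Longrightarrow> a \<in> ann M \<Longrightarrow> b \<in> carrier R \<Longrightarrow> b \<otimes> a \<in> ann M"
  using left_ideal_annihilator[of M] by (simp add: left_ideal_def)

text \<open>The annihilator and its complement are both two-sided ideals, so each product lies in
  their intersection, which is zero.\<close>

lemma ann_block_idem:
  assumes M: "left_module R M" and a: "a \<in> ann M"
  shows "a \<otimes> block_idem M = 0" "block_idem M \<otimes> a = 0"
proof -
  let ?e = "block_idem M" and ?K = "ann M"
  note e = block_idem[OF M] block_idem_in[OF M]
  have aR: "a \<in> carrier R"
    using a by (rule ann_in)
  have "a \<otimes> ?e \<in> ?K"
    using ann_right_mult[OF M a e(3)] .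
  moreover have "a \<otimes> ?e \<in> perp ?K"
    using left_ideal_perp[OF left_ideal_annihilator[OF M]] aR e(1) by (simp add: left_ideal_def)
  ultimately show "a \<otimes> ?e = 0"
    by (rule perp_disjoint)
  have "?e \<otimes> a \<in> ?K"
    using ann_left_mult[OF M a e(3)] .
  moreover have "?e \<otimes> a \<in> perp ?K"
    using e(1) aR ann_right_mult[OF M] ann_in by (intro perp_right_mult) auto
  ultimately show "?e \<otimes> a = 0"
    by (rule perp_disjoint)
qed

text \<open>The same argument, applied to the unit minus the idempotent, which lies in
  \<open>ann M\<close>. The idempotent is thus the unit of the complementary ideal.\<close>

lemma block_idem_perp:
  assumes M: "left_module R M" and b: "b \<in> perp (ann M)"
  shows "b \<otimes> block_idem M = b" "block_idem M \<otimes> b = b"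
proof -
  let ?e = "block_idem M" and ?K = "ann M"
  note e = block_idem[OF M] block_idem_in[OF M]
  have bR: "b \<in> carrier R"
    using b by (simp add: perp_def)
  have "b \<otimes> (\<one> - ?e) \<in> ?K"
    using ann_left_mult[OF M e(2) bR] .
  moreover have "b \<otimes> (\<one> - ?e) \<in> perp ?K"
    using b ann_in[OF e(2)] ann_right_mult[OF M] ann_in
    by (intro perp_right_mult) auto
  ultimately have "b \<otimes> (\<one> - ?e) = 0"
    by (rule perp_disjoint)
  then show "b \<otimes> ?e = b"
    using mult_diff_right[OF one_closed e(3) bR] bR by simp
  have "(\<one> - ?e) \<otimes> b \<in> ?K"
    using ann_right_mult[OF M e(2) bR] .
  moreover have "(\<one> - ?e) \<otimes> b \<in> perp ?K"
    using left_ideal_perp[OF left_ideal_annihilator[OF M]] ann_in[OF e(2)] b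
    by (simp add: left_ideal_def)
  ultimately have "(\<one> - ?e) \<otimes> b = 0"
    by (rule perp_disjoint)
  then show "?e \<otimes> b = b"
    using mult_diff_left[OF one_closed e(3) bR] bR by simp
qed

definition centre :: "('a \<Rightarrow> complex) set" where
  "centre = {z \<in> carrier R. \<forall>a\<in>carrier R. z \<otimes> a = a \<otimes> z}"

text \<open>Split a along \<open>ann M\<close> and its complement: the idempotent kills the first
  component from both sides and fixes the second from both sides.\<close>

lemma block_idem_central:
  assumes M: "left_module R M"
  shows "block_idem M \<in> centre"
proof -
  have "block_idem M \<otimes> a = a \<otimes> block_idem M" if a: "a \<in> carrier R" for a
  proof -
    let ?e = "block_idem M"
    obtain k where k: "k \<in> ann M" and ak: "a - k \<in> perp (ann M)"
      using perp_decomp[OF left_ideal_subspace[OF left_ideal_annihilator[OF M]] _ a]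
      by (auto simp: ann_def)
    have kR: "k \<in> carrier R"
      using k by (rule ann_in)
    have "?e \<otimes> (a - k) = (a - k) \<otimes> ?e"
      by (simp add: block_idem_perp[OF M ak])
    then show ?thesis
      using mult_diff_left[OF a kR block_idem_in[OF M]] mult_diff_right[OF a kR block_idem_in[OF M]]
        ann_block_idem[OF M k] by simp
  qed
  then show ?thesis
    by (simp add: centre_def block_idem_in[OF M])
qed

lemma block_idem_acts:
  assumes M: "left_module R M" and x: "x \<in> carrier M"
  shows "block_idem M \<odot>\<^bsub>M\<^esub> x = x"
proof -
  interpret M: left_module R M by fact
  note e = block_idem(2)[OF M] block_idem_in[OF M]
  have "\<one> = (\<one> - block_idem M) \<oplus> block_idem M"
    by (simp add: add_eq)
  then have "x = (\<one> - block_idem M) \<odot>\<^bsub>M\<^esub> x \<oplus>\<^bsub>M\<^esub> block_idem M \<odot>\<^bsub>M\<^esub> x"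
    using M.smult_l_distr[OF ann_in[OF e(1)] e(2) x] M.smult_one[OF x] by metis
  also have "\<dots> = block_idem M \<odot>\<^bsub>M\<^esub> x"
    using e x M.smult_closed[OF e(2) x] by (simp add: ann_def)
  finally show ?thesis ..
qed

text \<open>The annihilator can be recovered from the idempotent. This is what lets equality of
  idempotents decide isomorphism.\<close>

lemma ann_eq:
  assumes M: "left_module R M"
  shows "ann M = {a \<in> carrier R. a \<otimes> block_idem M = 0}"
proof (intro equalityI subsetI)
  fix a assume a: "a \<in> {a \<in> carrier R. a \<otimes> block_idem M = 0}"
  then have "a \<otimes> (\<one> - block_idem M) = a"
    using mult_diff_right[OF one_closed block_idem_in[OF M], of a] by simp
  then show "a \<in> ann M"
    using ann_left_mult[OF M block_idem(2)[OF M], of a] a by simp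
qed (auto simp: ann_block_idem[OF M] ann_in)

lemma block_idem_cong:
  "ann M = ann N \<Longrightarrow> block_idem M = block_idem N"
  by (simp add: block_idem_def)

lemma simple_module_left: "simple_module R M \<Longrightarrow> left_module R M"
  by (simp add: simple_module_def)

lemma block_idem_nonzero:
  assumes "simple_module R M"
  shows "block_idem M \<noteq> 0"
proof
  interpret M: left_module R M using assms by (rule simple_module_left)
  assume "block_idem M = 0"
  then have "x = \<zero>\<^bsub>M\<^esub>" if "x \<in> carrier M" for x
    using block_idem_acts[OF M.left_module_axioms that] M.smult_l_null[OF that] zero_eq by simp
  then have "carrier M = {\<zero>\<^bsub>M\<^esub>}"
    by auto
  then show False
    using assms by (simp add: simple_module_def)
qed

text \<open>For a suitable x the map that sends a to a x is nonzero on L, and Schur's lemma makes it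
  bijective. The concrete form of the map is exported because the orthogonality of idempotents
  writes every element of M as such a product.\<close>

lemma iso_ideal_module:
  assumes M: "simple_module R M" and L: "minimal_left_ideal L" and nsub: "\<not> L \<subseteq> ann M"
  obtains x where "x \<in> carrier M" "module_hom_on R (ideal_module L) M (\<lambda>a. a \<odot>\<^bsub>M\<^esub> x)"
    "bij_betw (\<lambda>a. a \<odot>\<^bsub>M\<^esub> x) L (carrier M)"
proof -
  interpret M: left_module R M using M by (rule simple_module_left)
  have LR: "L \<subseteq> carrier R"
    using L by (simp add: minimal_left_ideal_def left_ideal_def)
  obtain a x where ax: "a \<in> L" "x \<in> carrier M" "a \<odot>\<^bsub>M\<^esub> x \<noteq> \<zero>\<^bsub>M\<^esub>"
    using nsub LR by (auto simp: ann_def)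
  have hom: "module_hom_on R (ideal_module L) M (\<lambda>a. a \<odot>\<^bsub>M\<^esub> x)"
    unfolding module_hom_on_def ideal_module_simps add_eq[symmetric]
    using ax(2) LR by (auto simp: M.smult_closed M.smult_l_distr M.smult_assoc1 subset_iff)
  have "bij_betw (\<lambda>a. a \<odot>\<^bsub>M\<^esub> x) L (carrier M)"
    using simple_module_hom_iso[OF simple_ideal_module[OF L] M hom, of a] ax by simp
  then show ?thesis
    using that ax hom by blast
qed

text \<open>Any minimal left ideal inside the complement of \<open>ann M\<close> will do: the
  complement is nonzero, as it contains the idempotent, and it meets the annihilator only in
  zero.\<close>

lemma minimal_left_ideal_not_annihilated:
  assumes M: "simple_module R M"
  shows "\<exists>L. minimal_left_ideal L \<and> \<not> L \<subseteq> ann M"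
proof -
  note LM = simple_module_left[OF M]
  have "block_idem M \<in> perp (ann M)" "block_idem M \<noteq> 0"
    using block_idem(1)[OF LM] block_idem_nonzero[OF M] by auto
  then have "perp (ann M) \<noteq> {0}"
    by blast
  then obtain L where L: "L \<subseteq> perp (ann M)" "minimal_left_ideal L"
    using minimal_left_ideal_exists[OF left_ideal_perp[OF left_ideal_annihilator[OF LM]]] by blast
  have "\<not> L \<subseteq> ann M"
  proof
    assume "L \<subseteq> ann M"
    then have "L \<subseteq> {0}"
      using L(1) perp_disjoint by blast
    then show False
      using L(2) by (auto simp: minimal_left_ideal_def left_ideal_def)
  qed
  then show ?thesis
    using L by blast
qed

lemma module_iso_ideal_module:
  assumes M: "simple_module R M" and L: "minimal_left_ideal L" and nsub: "\<not> L \<subseteq> ann M"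
  shows "module_iso R (ideal_module L) M"
  using iso_ideal_module[OF assms] unfolding module_iso_iff by (metis ideal_module_simps(1))

lemma simple_module_iso_ideal:
  assumes M: "simple_module R M"
  shows "\<exists>L. minimal_left_ideal L \<and> module_iso R M (ideal_module L)"
proof -
  obtain L where L: "minimal_left_ideal L" "\<not> L \<subseteq> ann M"
    using minimal_left_ideal_not_annihilated[OF M] by auto
  then have "left_module R (ideal_module L)"
    by (simp add: minimal_left_ideal_def left_module_ideal_module)
  then show ?thesis
    using module_iso_sym[OF _ module_iso_ideal_module[OF M L]] L(1) by auto
qed

lemma module_iso_if_not_annihilated:
  assumes M: "simple_module R M" and N: "simple_module R N" and L: "minimal_left_ideal L"
    and "\<not> L \<subseteq> ann M" "\<not> L \<subseteq> ann N"
  shows "module_iso R M N"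
proof (rule module_iso_trans)
  have "left_module R (ideal_module L)"
    using simple_module_left[OF simple_ideal_module[OF L]] .
  then show "module_iso R M (ideal_module L)"
    using module_iso_ideal_module[OF M L assms(4)] by (rule module_iso_sym)
  show "module_iso R (ideal_module L) N"
    using module_iso_ideal_module[OF N L assms(5)] .
qed

text \<open>Equal idempotents give equal annihilators, so a single minimal left ideal acts
  nontrivially on both modules and is isomorphic to each of them.\<close>

lemma module_iso_iff_block_idem:
  assumes M: "simple_module R M" and N: "simple_module R N"
  shows "module_iso R M N \<longleftrightarrow> block_idem M = block_idem N"
proof
  note LM = simple_module_left[OF M] simple_module_left[OF N]
  assume "module_iso R M N"
  then show "block_idem M = block_idem N"
    by (rule block_idem_cong[OF ann_iso[OF LM]])
next
  note LM = simple_module_left[OF M] simple_module_left[OF N]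
  assume "block_idem M = block_idem N"
  then have "ann M = ann N"
    by (simp add: ann_eq LM)
  moreover obtain L where "minimal_left_ideal L" "\<not> L \<subseteq> ann M"
    using minimal_left_ideal_not_annihilated[OF M] by auto
  ultimately show "module_iso R M N"
    using module_iso_if_not_annihilated[OF M N] by metis
qed

text \<open>A minimal left ideal L that acts nontrivially on M must annihilate N, since otherwise M
  and N would be isomorphic. Every element of M has the form a x with a in L, and the idempotent of
  N kills each such a.\<close>

lemma block_idem_orthogonal:
  assumes M: "simple_module R M" and N: "simple_module R N" and ne: "block_idem M \<noteq> block_idem N"
  shows "block_idem N \<otimes> block_idem M = 0"
proof -
  interpret M: left_module R M using M by (rule simple_module_left)
  note LN = simple_module_left[OF N]
  obtain L where L: "minimal_left_ideal L" "\<not> L \<subseteq> ann M"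
    using minimal_left_ideal_not_annihilated[OF M] by blast
  have LR: "L \<subseteq> carrier R"
    using L by (simp add: minimal_left_ideal_def left_ideal_def)
  have LannN: "L \<subseteq> ann N"
    using ne module_iso_iff_block_idem[OF M N] module_iso_if_not_annihilated[OF M N L(1) L(2)] by auto
  obtain x where x: "x \<in> carrier M" and bij: "bij_betw (\<lambda>a. a \<odot>\<^bsub>M\<^esub> x) L (carrier M)"
    using iso_ideal_module[OF M L] by blast
  have "block_idem N \<odot>\<^bsub>M\<^esub> y = \<zero>\<^bsub>M\<^esub>" if y: "y \<in> carrier M" for y
  proof -
    obtain a where a: "a \<in> L" "y = a \<odot>\<^bsub>M\<^esub> x"
      using bij y by (auto simp: bij_betw_def)
    then have "block_idem N \<odot>\<^bsub>M\<^esub> y = (block_idem N \<otimes> a) \<odot>\<^bsub>M\<^esub> x"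
      using x LR block_idem_in[OF LN] by (auto simp: M.smult_assoc1)
    also have "\<dots> = \<zero>\<^bsub>M\<^esub>"
      using ann_block_idem(2)[OF LN] a LannN M.smult_l_null[OF x] zero_eq by auto
    finally show ?thesis .
  qed
  then have "block_idem N \<in> ann M"
    using block_idem_in[OF LN] by (simp add: ann_def)
  then show ?thesis
    using ann_block_idem(1)[OF M.left_module_axioms] by simp
qed

end

section \<open>Eigenvectors\<close>

text \<open>The vector p(T) v, computed by Horner's scheme. T will be linear only on a subspace, so
  an operator p(T) on all functions is never formed.\<close>

definition poly_act :: "(('a \<Rightarrow> complex) \<Rightarrow> 'a \<Rightarrow> complex) \<Rightarrow> ('a \<Rightarrow> complex) \<Rightarrow> complex poly \<Rightarrow> 'a \<Rightarrow> complex" where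
  "poly_act T v p = fold_coeffs (\<lambda>c w. scale c v + T w) p 0"

text \<open>Take a nonzero polynomial p of least degree with p(T) v = 0. It has a root c, and if p =
  (x - c) q, then q(T) v is nonzero by minimality and is an eigenvector for c.\<close>

lemma linear_eigenvector:
  fixes T :: "('a \<Rightarrow> complex) \<Rightarrow> 'a \<Rightarrow> complex"
  assumes W: "cvs.subspace W" "W \<subseteq> cvs.span B" "finite B"
    and T_closed: "\<And>w. w \<in> W \<Longrightarrow> T w \<in> W"
    and T_add: "\<And>u w. u \<in> W \<Longrightarrow> w \<in> W \<Longrightarrow> T (u + w) = T u + T w"
    and T_scale: "\<And>c w. w \<in> W \<Longrightarrow> T (scale c w) = scale c (T w)"
    and v: "v \<in> W" "v \<noteq> 0"
  shows "\<exists>w\<in>W. \<exists>c. w \<noteq> 0 \<and> T w = scale c w"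
proof -
  have T0: "T 0 = 0"
    using T_add[of 0 0] cvs.subspace_0[OF W(1)] by simp
  have act_0 [simp]: "poly_act T v 0 = 0"
    by (simp add: poly_act_def)
  have act_pCons [simp]: "poly_act T v (pCons c p) = scale c v + T (poly_act T v p)" for c p
    by (cases "c = 0 \<and> p = 0") (auto simp: poly_act_def T0)
  have act_in: "poly_act T v p \<in> W" for p
  proof (induction p)
    case 0
    show ?case
      unfolding act_0 by (rule cvs.subspace_0[OF W(1)])
  next
    case (pCons c p)
    then show ?case
      unfolding act_pCons
      by (intro cvs.subspace_add[OF W(1)] cvs.subspace_scale[OF W(1)] T_closed v)
  qed
  have act_add: "poly_act T v (p + q) = poly_act T v p + poly_act T v q" for p q
  proof (induction p q rule: poly_induct2)
    case (pCons a p b q)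
    then show ?case
      by (simp only: add_pCons act_pCons T_add[OF act_in act_in] cvs.scale_left_distrib ac_simps)
  qed simp
  have act_smult: "poly_act T v (Polynomial.smult c p) = scale c (poly_act T v p)" for c p
  proof (induction p)
    case (pCons a p)
    then show ?case
      by (simp only: smult_pCons act_pCons T_scale[OF act_in] cvs.scale_right_distrib cvs.scale_scale)
  qed simp
  have act_sum: "poly_act T v (sum f I) = (\<Sum>i\<in>I. poly_act T v (f i))" for f :: "nat \<Rightarrow> complex poly" and I
    by (induction I rule: infinite_finite_induct) (auto simp: act_add)
  define t where "t i = poly_act T v (monom 1 i)" for i
  have "\<exists>p. p \<noteq> 0 \<and> poly_act T v p = 0"
  \<comment> \<open>Linear dependence is a property of sets, so a repetition among the iterates of v
    is treated separately: it yields the polynomial x^i - x^j. Without repetition the iterates form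
    an infinite set in a finite-dimensional space.\<close>
  proof (cases "inj t")
    case False
    then obtain i j where ij: "i \<noteq> j" "t i = t j"
      by (auto simp: inj_def)
    let ?p = "monom 1 i + Polynomial.smult (- 1) (monom 1 j) :: complex poly"
    have "coeff ?p i = 1"
      using ij by simp
    then have "?p \<noteq> 0"
      by (metis coeff_0 zero_neq_one)
    moreover have "poly_act T v ?p = 0"
      using ij(2) unfolding act_add act_smult t_def by (auto simp: fun_eq_iff)
    ultimately show ?thesis
      by blast
  next
    case True
    have "range t \<subseteq> cvs.span B"
      using act_in W(2) unfolding t_def by blast
    moreover have "infinite (range t)"
      using True finite_imageD by blast
    ultimately have "cvs.dependent (range t)"
      using cvs.independent_span_bound[OF W(3)] by blast
    then obtain A u a where A: "finite A" "A \<subseteq> range t" "a \<in> A" "u a \<noteq> 0"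
      "(\<Sum>a\<in>A. scale (u a) a) = 0"
      unfolding cvs.dependent_explicit by blast
    define I where "I = t -` A"
    have I: "A = t ` I" "finite I"
      using A True by (auto simp: I_def finite_vimageI)
    let ?p = "\<Sum>i\<in>I. Polynomial.smult (u (t i)) (monom 1 i)"
    have "poly_act T v ?p = (\<Sum>i\<in>I. scale (u (t i)) (t i))"
      by (simp only: act_sum act_smult t_def)
    also have "\<dots> = (\<Sum>a\<in>A. scale (u a) a)"
      unfolding I(1) using True by (subst sum.reindex) (auto intro: inj_on_subset)
    finally have "poly_act T v ?p = 0"
      using A by simp
    moreover obtain i where i: "i \<in> I" "a = t i"
      using A I by blast
    have "coeff ?p i = (\<Sum>j\<in>I. if j = i then u (t j) else 0)"
      by (simp add: coeff_sum) (intro sum.cong, auto)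
    then have "coeff ?p i = u a"
      using i I(2) by simp
    then have "?p \<noteq> 0"
      using A(4) by (metis coeff_0)
    ultimately show ?thesis
      by blast
  qed
  then obtain p where p: "p \<noteq> 0" "poly_act T v p = 0"
    and min: "\<And>q. q \<noteq> 0 \<Longrightarrow> poly_act T v q = 0 \<Longrightarrow> degree p \<le> degree q"
    using exists_least_iff[of "\<lambda>n. \<exists>p. p \<noteq> 0 \<and> poly_act T v p = 0 \<and> degree p = n"]
    by (metis leI)
  have "degree p \<noteq> 0"
  proof
    assume "degree p = 0"
    then obtain c where "p = [:c:]"
      by (rule degree_eq_zeroE)
    then show False
      using p v by (auto simp: T0)
  qed
  then have "\<not> constant (poly p)"
    by (simp add: constant_degree)
  then obtain c where "poly p c = 0"
    using fundamental_theorem_of_algebra by blast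
  then obtain q where q: "p = [:- c, 1:] * q"
    by (auto simp: poly_eq_0_iff_dvd)
  then have "q \<noteq> 0"
    using p by auto
  then have "degree q < degree p"
    unfolding q by (subst degree_mult_eq) auto
  then have nz: "poly_act T v q \<noteq> 0"
    using min \<open>q \<noteq> 0\<close> by force
  have q': "p = Polynomial.smult (- c) q + pCons 0 q"
    unfolding q by (simp add: pCons_one)
  have "scale (- c) (poly_act T v q) + T (poly_act T v q) = 0"
    using p(2) unfolding q' act_add act_smult act_pCons cvs.scale_zero_left add_0 .
  then have "T (poly_act T v q) = scale c (poly_act T v q)"
    by (simp only: cvs.scale_minus_left neg_eq_iff_add_eq_0[symmetric] minus_minus)
  then show ?thesis
    using nz act_in by blast
qed

section \<open>The centre and its basis of central idempotents\<close>

context star_algebra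
begin

text \<open>Schur's lemma for a central element. M is a bare module on an arbitrary type, so the
  eigenvector is sought in the left ideal generated by the idempotent, and the scalar is then
  carried over to M.\<close>

lemma centre_scalar:
  assumes M: "simple_module R M" and z: "z \<in> centre"
  shows "\<exists>c. z \<otimes> block_idem M = scale c (block_idem M)"
proof -
  interpret M: left_module R M using M by (rule simple_module_left)
  let ?e = "block_idem M"
  have eR: "?e \<in> carrier R"
    using block_idem_in[OF M.left_module_axioms] .
  have zR: "z \<in> carrier R"
    using z by (simp add: centre_def)
  define W where "W = (\<lambda>a. a \<otimes> ?e) ` carrier R"
  have WR: "W \<subseteq> carrier R"
    using eR by (auto simp: W_def)
  have W_sub: "cvs.subspace W"
  proof (rule cvs.subspaceI)
    show "0 \<in> W"
      using zero_in mult_zero(1)[OF eR] unfolding W_def by (metis imageI)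
    show "x + y \<in> W" if "x \<in> W" "y \<in> W" for x y
      using that add_in mult_add_left[OF _ _ eR, symmetric] by (auto simp: W_def)
    show "scale c x \<in> W" if "x \<in> W" for c x
      using that scale_in scale_mult_left[OF _ eR, symmetric] by (auto simp: W_def)
  qed
  have W_span: "W \<subseteq> cvs.span basis"
    using WR carrier_subset_span by blast
  have W_closed: "z \<otimes> w \<in> W" if "w \<in> W" for w
    using that zR eR by (auto simp: W_def m_assoc[symmetric])
  have eW: "?e \<in> W"
    unfolding W_def using eR by (intro image_eqI[of _ _ \<one>]) auto
  have "\<exists>w\<in>W. \<exists>c. w \<noteq> 0 \<and> z \<otimes> w = scale c w"
    using W_closed zR WR mult_add_right[OF _ _ zR] scale_mult_right[OF zR]
    by (intro linear_eigenvector[OF W_sub W_span finite_basis _ _ _ eW block_idem_nonzero[OF M]])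
      (auto simp: subset_iff)
  then obtain w c where w: "w \<in> W" "w \<noteq> 0" "z \<otimes> w = scale c w"
    by blast
  have wR: "w \<in> carrier R"
    using w WR by blast
  have w_eq: "w \<otimes> ?e = w"
  proof -
    obtain a where a: "a \<in> carrier R" "w = a \<otimes> ?e"
      using w(1) by (auto simp: W_def)
    have "?e \<otimes> ?e = ?e"
      using block_idem_perp(1)[OF M.left_module_axioms block_idem(1)[OF M.left_module_axioms]] .
    then show ?thesis
      using a eR by (simp add: m_assoc)
  qed
  \<comment> \<open>Subtracting the eigenvalue gives a central d with d w = 0. Since w acts
    nontrivially on M, the kernel of d on M is a nonzero submodule, hence all of M.\<close>
  define d where "d = z - scale c \<one>"
  have dR: "d \<in> carrier R"
    unfolding d_def by (intro diff_in zR scale_in one_closed)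
  have d_mult: "d \<otimes> a = z \<otimes> a - scale c a" if "a \<in> carrier R" for a
    using that zR scale_in[of \<one> c] by (simp add: d_def mult_diff_left scale_mult_left)
  have d_mult': "a \<otimes> d = a \<otimes> z - scale c a" if "a \<in> carrier R" for a
    using that zR scale_in[of \<one> c] by (simp add: d_def mult_diff_right scale_mult_right)
  have d_comm: "d \<otimes> a = a \<otimes> d" if "a \<in> carrier R" for a
    using z that by (simp add: d_mult d_mult' centre_def)
  have "w \<notin> ann M"
    using ann_block_idem(1)[OF M.left_module_axioms] w_eq w(2) by metis
  then obtain x where x: "x \<in> carrier M" "w \<odot>\<^bsub>M\<^esub> x \<noteq> \<zero>\<^bsub>M\<^esub>"
    using wR by (auto simp: ann_def)
  let ?H = "{x \<in> carrier M. d \<odot>\<^bsub>M\<^esub> x = \<zero>\<^bsub>M\<^esub>}"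
  have "d \<odot>\<^bsub>M\<^esub> (a \<odot>\<^bsub>M\<^esub> y) = \<zero>\<^bsub>M\<^esub>"
    if "a \<in> carrier R" "y \<in> carrier M" "d \<odot>\<^bsub>M\<^esub> y = \<zero>\<^bsub>M\<^esub>" for a y
    using that dR d_comm M.smult_assoc1[of d a y] M.smult_assoc1[of a d y] M.smult_r_null by simp
  then have "submodule ?H R M"
    using dR by (intro M.submoduleI) (auto simp: M.smult_r_null M.smult_r_distr M.smult_closed)
  moreover have "d \<odot>\<^bsub>M\<^esub> (w \<odot>\<^bsub>M\<^esub> x) = \<zero>\<^bsub>M\<^esub>"
    using M.smult_assoc1[OF dR wR x(1)] d_mult[OF wR] w(3) M.smult_l_null[OF x(1)] zero_eq by simp
  then have "w \<odot>\<^bsub>M\<^esub> x \<in> ?H"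
    using M.smult_closed[OF wR x(1)] by simp
  ultimately have "?H = carrier M"
    using M x(2) unfolding simple_module_def by (metis singletonD)
  then have "d \<in> ann M"
    using dR unfolding ann_def by blast
  then have "d \<otimes> ?e = 0"
    using ann_block_idem(1)[OF M.left_module_axioms] by simp
  then show ?thesis
    using d_mult[OF eR] by auto
qed

text \<open>Ranging over minimal left ideals keeps the set independent of any type of modules; every
  simple module is isomorphic to one of these ideals.\<close>

definition block_idems :: "('a \<Rightarrow> complex) set" where
  "block_idems = {block_idem (ideal_module L) | L. minimal_left_ideal L}"

lemma block_idem_in_block_idems:
  assumes "simple_module R M"
  shows "block_idem M \<in> block_idems"
proof -
  obtain L where L: "minimal_left_ideal L" "module_iso R M (ideal_module L)"
    using simple_module_iso_ideal[OF assms] by auto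
  then have "block_idem M = block_idem (ideal_module L)"
    by (intro block_idem_cong ann_iso simple_module_left simple_ideal_module assms)
  then show ?thesis
    using L by (auto simp: block_idems_def)
qed

lemma block_idemsE:
  assumes "e \<in> block_idems"
  obtains L where "minimal_left_ideal L" "simple_module R (ideal_module L)"
    "e = block_idem (ideal_module L)"
  using assms simple_ideal_module unfolding block_idems_def by blast

lemma block_idems_centre: "e \<in> block_idems \<Longrightarrow> e \<in> centre"
  by (metis block_idemsE block_idem_central simple_module_left)

lemma block_idems_in: "e \<in> block_idems \<Longrightarrow> e \<in> carrier R"
  using block_idems_centre by (simp add: centre_def)

lemma block_idems_nonzero: "e \<in> block_idems \<Longrightarrow> e \<noteq> 0"
  by (metis block_idemsE block_idem_nonzero)

lemma block_idems_mult:
  assumes "e \<in> block_idems" "f \<in> block_idems"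
  shows "e \<otimes> f = (if e = f then e else 0)"
proof -
  obtain L where L: "simple_module R (ideal_module L)" "e = block_idem (ideal_module L)"
    using assms(1) by (rule block_idemsE)
  obtain K where K: "simple_module R (ideal_module K)" "f = block_idem (ideal_module K)"
    using assms(2) by (rule block_idemsE)
  note LL = simple_module_left[OF L(1)]
  show ?thesis
    using block_idem_orthogonal[OF K(1) L(1)] block_idem_perp(1)[OF LL block_idem(1)[OF LL]] L K by auto
qed

text \<open>Multiplying a linear relation by one of the idempotents isolates its
  coefficient.\<close>

lemma independent_block_idems: "cvs.independent block_idems"
proof
  assume "cvs.dependent block_idems"
  then obtain A u f where A: "finite A" "A \<subseteq> block_idems" "f \<in> A" "u f \<noteq> 0"
    "(\<Sum>e\<in>A. scale (u e) e) = 0"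
    unfolding cvs.dependent_explicit by blast
  have AR: "e \<in> carrier R" if "e \<in> A" for e
    using A that block_idems_in by blast
  have "0 = (\<Sum>e\<in>A. scale (u e) e) \<otimes> f"
    using A AR mult_zero by simp
  also have "\<dots> = (\<Sum>e\<in>A. scale (u e) e \<otimes> f)"
    using A AR scale_in by (intro mult_sum_left) auto
  also have "\<dots> = (\<Sum>e\<in>A. if e = f then scale (u f) f else 0)"
    using A AR by (intro sum.cong refl) (auto simp: scale_mult_left block_idems_mult subset_iff)
  also have "\<dots> = scale (u f) f"
    using A by simp
  finally show False
    using A block_idems_nonzero by auto
qed

lemma finite_block_idems: "finite block_idems"
  using independent_finite independent_block_idems block_idems_in by blast

text \<open>The defect u of the sum is central and is killed by every idempotent. If the complement
  of its annihilator A were nonzero, it would contain a minimal left ideal L; the idempotent of L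
  fixes L, so u kills L and L lies in A as well, which is absurd.\<close>

lemma sum_block_idems: "\<Sum>block_idems = \<one>"
proof -
  define u where "u = \<one> - \<Sum>block_idems"
  have sum_R: "\<Sum>block_idems \<in> carrier R"
    using sum_in[of block_idems "\<lambda>e. e"] block_idems_in by simp
  have uR: "u \<in> carrier R"
    unfolding u_def using sum_R by (intro diff_in) auto
  have u_e: "u \<otimes> e = 0" if "e \<in> block_idems" for e
  proof -
    have "\<Sum>block_idems \<otimes> e = (\<Sum>f\<in>block_idems. f \<otimes> e)"
      using block_idems_in that by (intro mult_sum_left) auto
    also have "\<dots> = (\<Sum>f\<in>block_idems. if f = e then e else 0)"
      using that by (intro sum.cong) (auto simp: block_idems_mult)
    also have "\<dots> = e"
      using that finite_block_idems by simp
    finally show ?thesis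
      unfolding u_def using mult_diff_left[OF one_closed sum_R block_idems_in[OF that]]
        block_idems_in[OF that] by simp
  qed
  define A where "A = {a \<in> carrier R. u \<otimes> a = 0}"
  have u_comm: "u \<otimes> a = a \<otimes> u" if "a \<in> carrier R" for a
  proof -
    have "\<Sum>block_idems \<otimes> a = (\<Sum>e\<in>block_idems. e \<otimes> a)"
      using block_idems_in that by (intro mult_sum_left) auto
    also have "\<dots> = (\<Sum>e\<in>block_idems. a \<otimes> e)"
      using block_idems_centre that by (intro sum.cong) (auto simp: centre_def)
    also have "\<dots> = a \<otimes> \<Sum>block_idems"
      using block_idems_in that by (intro mult_sum_right[symmetric]) auto
    finally have "\<Sum>block_idems \<otimes> a = a \<otimes> \<Sum>block_idems" .
    then show ?thesis
      unfolding u_def using that sum_R by (simp add: mult_diff_left mult_diff_right)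
  qed
  have "u \<otimes> (a \<otimes> x) = 0" if "a \<in> carrier R" "x \<in> carrier R" "u \<otimes> x = 0" for a x
    using m_assoc[OF uR that(1,2)] m_assoc[OF that(1) uR that(2)] u_comm[OF that(1)] that
    by (simp add: mult_zero)
  then have "left_ideal A"
    unfolding left_ideal_def A_def
    using uR by (auto simp: zero_in add_in mult_zero mult_add_right)
  have "perp A = {0}"
  proof (rule ccontr)
    assume "perp A \<noteq> {0}"
    then obtain L where L: "L \<subseteq> perp A" "minimal_left_ideal L"
      using minimal_left_ideal_exists[OF left_ideal_perp[OF \<open>left_ideal A\<close>]] by blast
    note LM = simple_module_left[OF simple_ideal_module[OF L(2)]]
    have e: "block_idem (ideal_module L) \<in> block_idems"
      using L(2) by (auto simp: block_idems_def)
    have "a \<in> A" if a: "a \<in> L" for a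
    proof -
      have aR: "a \<in> carrier R"
        using L a by (auto simp: minimal_left_ideal_def left_ideal_def)
      have "a = block_idem (ideal_module L) \<otimes> a"
        using block_idem_acts[OF LM, of a] a by simp
      then have "u \<otimes> a = (u \<otimes> block_idem (ideal_module L)) \<otimes> a"
        using m_assoc[OF uR block_idems_in[OF e] aR] by simp
      then show ?thesis
        using u_e[OF e] aR by (simp add: A_def mult_zero)
    qed
    then have "L \<subseteq> {0}"
      using L(1) perp_disjoint by blast
    then show False
      using L(2) by (auto simp: minimal_left_ideal_def left_ideal_def)
  qed
  moreover obtain w where "w \<in> A" "\<one> - w \<in> perp A"
    using perp_decomp[OF left_ideal_subspace[OF \<open>left_ideal A\<close>], of \<one>] by (auto simp: A_def)
  ultimately have "\<one> \<in> A"
    by simp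
  then show ?thesis
    using uR by (simp add: A_def u_def)
qed

text \<open>Multiply a central z by the unit, written as the sum of the idempotents: by
  \<open>centre_scalar\<close> every term is a multiple of its idempotent.\<close>

theorem span_block_idems: "cvs.span block_idems = centre"
proof
  have "cvs.subspace centre"
    unfolding cvs.subspace_def centre_def
    by (auto simp: zero_in add_in scale_in mult_zero mult_add_left mult_add_right scale_mult_left
        scale_mult_right)
  then show "cvs.span block_idems \<subseteq> centre"
    using block_idems_centre by (intro cvs.span_minimal) auto
next
  show "centre \<subseteq> cvs.span block_idems"
  proof
    fix z assume z: "z \<in> centre"
    then have zR: "z \<in> carrier R"
      by (simp add: centre_def)
    have "\<exists>c. z \<otimes> e = scale c e" if "e \<in> block_idems" for e
      using that by (elim block_idemsE) (metis centre_scalar z)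
    then obtain c where c: "\<And>e. e \<in> block_idems \<Longrightarrow> z \<otimes> e = scale (c e) e"
      by metis
    have "z = z \<otimes> \<Sum>block_idems"
      using zR by (simp add: sum_block_idems)
    also have "\<dots> = (\<Sum>e\<in>block_idems. scale (c e) e)"
      using zR block_idems_in c by (simp add: mult_sum_right)
    also have "\<dots> \<in> cvs.span block_idems"
      by (intro cvs.span_sum cvs.span_scale cvs.span_base)
    finally show "z \<in> cvs.span block_idems" .
  qed
qed

text \<open>A coefficient function is determined by its values along an enumeration of the finite
  set S.\<close>

lemma inj_on_into_nat_functions:
  "\<exists>h :: ('a \<Rightarrow> complex) \<Rightarrow> nat \<Rightarrow> complex. inj_on h (carrier R)"
proof -
  obtain e :: "nat \<Rightarrow> 'a" where e: "bij_betw e {0..<card S} S"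
    using ex_bij_betw_nat_finite[OF finite_S] by blast
  have "inj_on (\<lambda>f n. f (e n)) (carrier R)"
  proof (rule inj_onI)
    fix f g assume fg: "f \<in> carrier R" "g \<in> carrier R" "(\<lambda>n. f (e n)) = (\<lambda>n. g (e n))"
    show "f = g"
    proof
      fix x
      show "f x = g x"
      proof (cases "x \<in> S")
        case True
        then obtain n where "x = e n"
          using e by (auto simp: bij_betw_def)
        then show ?thesis
          using fg(3) by (metis)
      next
        case False
        then show ?thesis
          using fg by (simp add: carrier_eq)
      qed
    qed
  qed
  then show ?thesis
    by blast
qed

lemma simple_module_nat_functions:
  assumes M: "simple_module R M"
  shows "\<exists>N :: ('a \<Rightarrow> complex, nat \<Rightarrow> complex) module. simple_module R N \<and> module_iso R M N"
proof -
  obtain L where L: "minimal_left_ideal L" "module_iso R M (ideal_module L)"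
    using simple_module_iso_ideal[OF M] by auto
  obtain h :: "('a \<Rightarrow> complex) \<Rightarrow> nat \<Rightarrow> complex" where h: "inj_on h (carrier R)"
    using inj_on_into_nat_functions by blast
  have "L \<subseteq> carrier R"
    using L(1) by (simp add: minimal_left_ideal_def left_ideal_def)
  then have inj: "inj_on h (carrier (ideal_module L))"
    using inj_on_subset[OF h] by simp
  note LM = simple_module_left[OF simple_ideal_module[OF L(1)]]
  have "module_iso R M (image_module h (ideal_module L))"
    using module_iso_trans[OF L(2) module_iso_image_module[OF LM inj]] .
  then show ?thesis
    using simple_module_iso[OF M left_module_image_module[OF LM inj]] by blast
qed

text \<open>The class attached to an idempotent consists of all modules on the fixed type that have
  this idempotent. None of these classes is empty, because every minimal left ideal can be moved to
  that type.\<close>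

lemma bij_betw_block_idems_classes:
  fixes \<M> :: "('a \<Rightarrow> complex, nat \<Rightarrow> complex) module set"
  defines "\<M> \<equiv> {M. simple_module R M}"
  shows "\<exists>F. bij_betw F block_idems (\<M> // {(M, N) \<in> \<M> \<times> \<M>. module_iso R M N})"
proof -
  define r where "r = {(M, N) \<in> \<M> \<times> \<M>. module_iso R M N}"
  define F where "F e = {M \<in> \<M>. block_idem M = e}" for e
  have img: "r `` {M} = F (block_idem M)" if "M \<in> \<M>" for M
    using that by (auto simp: r_def F_def \<M>_def module_iso_iff_block_idem)
  have surj: "block_idem ` \<M> = block_idems"
  proof (intro equalityI subsetI)
    fix e assume "e \<in> block_idems"
    then obtain L where L: "simple_module R (ideal_module L)" "e = block_idem (ideal_module L)"
      by (rule block_idemsE)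
    obtain N :: "('a \<Rightarrow> complex, nat \<Rightarrow> complex) module"
      where N: "simple_module R N" "module_iso R (ideal_module L) N"
      using simple_module_nat_functions[OF L(1)] by blast
    then show "e \<in> block_idem ` \<M>"
      using L block_idem_cong[OF ann_iso] simple_module_left unfolding \<M>_def
      by (metis (mono_tags, lifting) image_eqI mem_Collect_eq)
  qed (auto simp: \<M>_def block_idem_in_block_idems)
  have "inj_on F block_idems"
    unfolding surj[symmetric] by (rule inj_onI) (auto simp: F_def)
  moreover have "F ` block_idems = \<M> // r"
    unfolding surj[symmetric] quotient_def using img by auto
  ultimately show ?thesis
    unfolding r_def bij_betw_def by blast
qed

end

section \<open>Monoid algebras\<close>

lemma monoid_algebra_simps:
  "carrier (monoid_algebra G) = {f. \<forall>x. x \<notin> carrier G \<longrightarrow> f x = 0}"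
  "\<one>\<^bsub>monoid_algebra G\<^esub> = (\<lambda>z. if z = \<one>\<^bsub>G\<^esub> then 1 else 0)"
  "\<zero>\<^bsub>monoid_algebra G\<^esub> = 0"
  "f \<oplus>\<^bsub>monoid_algebra G\<^esub> g = f + g"
  by (auto simp: monoid_algebra_def)

locale finite_monoid = monoid G for G :: "('a, 'm) monoid_scheme" (structure) +
  assumes finite_carrier: "finite (carrier G)"
begin

abbreviation (input) algebra_of :: "('a \<Rightarrow> complex) ring" (\<open>\<A>\<close>) where
  "\<A> \<equiv> monoid_algebra G"

abbreviation (input) algebra_mult :: "('a \<Rightarrow> complex) \<Rightarrow> ('a \<Rightarrow> complex) \<Rightarrow> 'a \<Rightarrow> complex"
    (infixl \<open>\<star>\<close> 70) where
  "f \<star> g \<equiv> f \<otimes>\<^bsub>monoid_algebra G\<^esub> g"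

lemma monoid_algebra_mult:
  "(f \<star> g) z =
    (\<Sum>x\<in>carrier G. \<Sum>y\<in>carrier G. if x \<otimes> y = z then f x * g y else 0)"
proof -
  have "(f \<star> g) z =
    (\<Sum>(x, y)\<in>{(x, y) \<in> carrier G \<times> carrier G. x \<otimes> y = z}. f x * g y)"
    by (simp add: monoid_algebra_def)
  also have "\<dots> = (\<Sum>(x, y)\<in>carrier G \<times> carrier G. if x \<otimes> y = z then f x * g y else 0)"
    using finite_carrier by (intro sum.mono_neutral_cong_left) (auto split: if_splits)
  also have "\<dots> = (\<Sum>x\<in>carrier G. \<Sum>y\<in>carrier G. if x \<otimes> y = z then f x * g y else 0)"
    by (simp add: sum.cartesian_product)
  finally show ?thesis .
qed

text \<open>Summing against a test function h removes the constraint on the product. Associativity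
  and the multiplicativity of \<open>\<Phi>\<close> are both reduced to this.\<close>

lemma monoid_algebra_mult_sum:
  "(\<Sum>z\<in>carrier G. (f \<star> g) z * h z) =
    (\<Sum>x\<in>carrier G. \<Sum>y\<in>carrier G. f x * g y * h (x \<otimes> y))"
proof -
  have "(\<Sum>z\<in>carrier G. (f \<star> g) z * h z) =
    (\<Sum>z\<in>carrier G. \<Sum>x\<in>carrier G. \<Sum>y\<in>carrier G. if x \<otimes> y = z then f x * g y * h z else 0)"
    unfolding monoid_algebra_mult sum_distrib_right by (intro sum.cong refl) auto
  also have "\<dots> = (\<Sum>x\<in>carrier G. \<Sum>z\<in>carrier G. \<Sum>y\<in>carrier G.
      if x \<otimes> y = z then f x * g y * h z else 0)"
    by (rule sum.swap)
  also have "\<dots> = (\<Sum>x\<in>carrier G. \<Sum>y\<in>carrier G. \<Sum>z\<in>carrier G.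
      if x \<otimes> y = z then f x * g y * h z else 0)"
    by (intro sum.cong refl sum.swap)
  also have "\<dots> = (\<Sum>x\<in>carrier G. \<Sum>y\<in>carrier G. f x * g y * h (x \<otimes> y))"
    using finite_carrier by (intro sum.cong refl) (simp add: sum.delta)
  finally show ?thesis .
qed

lemma monoid_algebra_mult_assoc:
  "f \<star> g \<star> h = f \<star> (g \<star> h)"
proof
  fix z
  let ?S = "carrier G"
  have "(f \<star> g \<star> h) z =
    (\<Sum>w\<in>?S. (f \<star> g) w * (\<Sum>c\<in>?S. if w \<otimes> c = z then h c else 0))"
    unfolding monoid_algebra_mult[of _ h] sum_distrib_left by (intro sum.cong refl) auto
  also have "\<dots> = (\<Sum>a\<in>?S. \<Sum>b\<in>?S. \<Sum>c\<in>?S.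
      if a \<otimes> b \<otimes> c = z then f a * g b * h c else 0)"
    unfolding monoid_algebra_mult_sum unfolding sum_distrib_left by (intro sum.cong refl) auto
  also have "\<dots> = (\<Sum>a\<in>?S. \<Sum>b\<in>?S. \<Sum>c\<in>?S.
      g b * h c * (if a \<otimes> (b \<otimes> c) = z then f a else 0))"
    by (intro sum.cong refl) (auto simp: m_assoc)
  also have "\<dots> = (\<Sum>a\<in>?S. \<Sum>w\<in>?S. (g \<star> h) w *
      (if a \<otimes> w = z then f a else 0))"
    by (intro sum.cong refl monoid_algebra_mult_sum[symmetric])
  also have "\<dots> = (f \<star> (g \<star> h)) z"
    unfolding monoid_algebra_mult[of f] by (intro sum.cong refl) auto
  finally show "(f \<star> g \<star> h) z = (f \<star> (g \<star> h)) z" .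
qed

lemma ring_monoid_algebra: "ring \<A>"
proof (rule ringI)
  note [simp] = monoid_algebra_simps
  show "abelian_group \<A>"
  proof (rule abelian_groupI)
    fix f assume "f \<in> carrier \<A>"
    then show "\<exists>g\<in>carrier \<A>. g \<oplus>\<^bsub>\<A>\<^esub> f = \<zero>\<^bsub>\<A>\<^esub>"
      by (intro bexI[of _ "- f"]) auto
  qed (auto simp: algebra_simps)
  show "monoid \<A>"
  proof (rule monoidI)
    fix f g assume "f \<in> carrier \<A>" "g \<in> carrier \<A>"
    have "(f \<star> g) z = 0" if "z \<notin> carrier G" for z
      unfolding monoid_algebra_mult using that by (intro sum.neutral ballI) auto
    then show "f \<star> g \<in> carrier \<A>"
      by simp
  next
    fix f assume f: "f \<in> carrier \<A>"
    show "\<one>\<^bsub>\<A>\<^esub> \<star> f = f"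
    proof
      fix z
      have "(\<one>\<^bsub>\<A>\<^esub> \<star> f) z =
        (\<Sum>x\<in>carrier G. if x = \<one> then \<Sum>y\<in>carrier G. if y = z then f y else 0 else 0)"
        unfolding monoid_algebra_mult monoid_algebra_simps(2)
        by (intro sum.cong refl) (auto intro!: sum.cong sum.neutral)
      then show "(\<one>\<^bsub>\<A>\<^esub> \<star> f) z = f z"
        using f finite_carrier by auto
    qed
    show "f \<star> \<one>\<^bsub>\<A>\<^esub> = f"
    proof
      fix z
      have "(f \<star> \<one>\<^bsub>\<A>\<^esub>) z =
        (\<Sum>x\<in>carrier G. \<Sum>y\<in>carrier G. if y = \<one> then if x = z then f x else 0 else 0)"
        unfolding monoid_algebra_mult monoid_algebra_simps(2)
        by (intro sum.cong refl) (auto intro!: sum.cong sum.neutral)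
      then show "(f \<star> \<one>\<^bsub>\<A>\<^esub>) z = f z"
        using f finite_carrier by auto
    qed
  qed (auto simp: monoid_algebra_mult_assoc)
next
  fix f g h
  show "(f \<oplus>\<^bsub>\<A>\<^esub> g) \<star> h =
    f \<star> h \<oplus>\<^bsub>\<A>\<^esub> g \<star> h"
    unfolding monoid_algebra_simps
    by (rule ext) (auto simp: monoid_algebra_mult sum.distrib[symmetric] distrib_right
        intro!: sum.cong)
  show "h \<star> (f \<oplus>\<^bsub>\<A>\<^esub> g) =
    h \<star> f \<oplus>\<^bsub>\<A>\<^esub> h \<star> g"
    unfolding monoid_algebra_simps
    by (rule ext) (auto simp: monoid_algebra_mult sum.distrib[symmetric] distrib_left
        intro!: sum.cong)
qed

end

section \<open>Monoids of partial injections\<close>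

text \<open>A faithful representation by partial functions whose image is closed under converse.
  Converses being single-valued too, all these functions are injective: an inverse monoid in the
  form given by the Wagner-Preston theorem.\<close>

locale partial_injection_monoid = finite_monoid G for G :: "('a, 'm) monoid_scheme" (structure) +
  fixes rel :: "'a \<Rightarrow> ('b \<times> 'b) set"
  assumes rel_inj: "inj_on rel (carrier G)"
    and rel_mult: "\<lbrakk>x \<in> carrier G; y \<in> carrier G\<rbrakk> \<Longrightarrow> rel (x \<otimes> y) = rel x O rel y"
    and rel_converse: "x \<in> carrier G \<Longrightarrow> \<exists>y\<in>carrier G. rel y = (rel x)\<inverse>"
    and rel_single_valued: "x \<in> carrier G \<Longrightarrow> single_valued (rel x)"
begin

definition cnv :: "'a \<Rightarrow> 'a" where
  "cnv x = (SOME y. y \<in> carrier G \<and> rel y = (rel x)\<inverse>)"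

lemma cnv:
  assumes "x \<in> carrier G"
  shows "cnv x \<in> carrier G" "rel (cnv x) = (rel x)\<inverse>"
  using someI_ex[of "\<lambda>y. y \<in> carrier G \<and> rel y = (rel x)\<inverse>"] rel_converse[OF assms]
  unfolding cnv_def by auto

lemma rel_eqI: "\<lbrakk>x \<in> carrier G; y \<in> carrier G; rel x = rel y\<rbrakk> \<Longrightarrow> x = y"
  using rel_inj by (auto dest: inj_onD)

lemma cnv_cnv: "x \<in> carrier G \<Longrightarrow> cnv (cnv x) = x"
  by (rule rel_eqI) (simp_all add: cnv)

lemma rel_functional: "x \<in> carrier G \<Longrightarrow> (a, b) \<in> rel x \<Longrightarrow> (a, c) \<in> rel x \<Longrightarrow> b = c"
  using rel_single_valued by (auto dest: single_valuedD)

lemma rel_injective: "x \<in> carrier G \<Longrightarrow> (a, c) \<in> rel x \<Longrightarrow> (b, c) \<in> rel x \<Longrightarrow> a = b"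
  using rel_functional[of "cnv x" c a b] by (simp add: cnv)

text \<open>Composability in the inductive groupoid of the inverse monoid \<open>G\<close>.\<close>

definition composable :: "('a \<times> 'a) set" where
  "composable = {(x, y) \<in> carrier G \<times> carrier G. Range (rel x) = Domain (rel y)}"

lemma finite_composable: "finite composable"
  by (rule finite_subset[of _ "carrier G \<times> carrier G"]) (auto simp: composable_def finite_carrier)

text \<open>The product of the groupoid algebra: pairs that are not composable contribute zero, and
  on composable pairs the groupoid composition is the monoid product.\<close>

definition conv :: "('a \<Rightarrow> complex) \<Rightarrow> ('a \<Rightarrow> complex) \<Rightarrow> 'a \<Rightarrow> complex" where
  "conv f g z = (\<Sum>(x, y)\<in>composable. if x \<otimes> y = z then f x * g y else 0)"

lemma conv_sum: "(\<Sum>z\<in>carrier G. conv f g z * h z) = (\<Sum>(x, y)\<in>composable. f x * g y * h (x \<otimes> y))"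
proof -
  have "(\<Sum>z\<in>carrier G. conv f g z * h z) =
    (\<Sum>z\<in>carrier G. \<Sum>(x, y)\<in>composable. if x \<otimes> y = z then f x * g y * h z else 0)"
    unfolding conv_def sum_distrib_right by (intro sum.cong refl) auto
  also have "\<dots> = (\<Sum>p\<in>composable. \<Sum>z\<in>carrier G.
      case p of (x, y) \<Rightarrow> if x \<otimes> y = z then f x * g y * h z else 0)"
    by (rule sum.swap)
  also have "\<dots> = (\<Sum>(x, y)\<in>composable. f x * g y * h (x \<otimes> y))"
    using finite_carrier by (intro sum.cong refl) (auto simp: composable_def sum.delta)
  finally show ?thesis .
qed

text \<open>Both factors are forced: t is s restricted to the domain of u, and t' is s' restricted
  to the image of that domain under s. The first product is this restriction of s because
  \<open>u \<otimes> cnv u\<close> is the partial identity on the domain of u.\<close>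

lemma composable_factor:
  assumes s: "s \<in> carrier G" "s' \<in> carrier G" and u: "u \<in> carrier G" "rel u \<subseteq> rel s O rel s'"
  shows "{(t, t') \<in> composable. t \<otimes> t' = u \<and> rel t \<subseteq> rel s \<and> rel t' \<subseteq> rel s'} =
    {(u \<otimes> cnv u \<otimes> s, cnv s \<otimes> u)}" (is "?A = {(?t, ?t')}")
proof -
  have cl: "?t \<in> carrier G" "?t' \<in> carrier G"
    using assms by (auto simp: cnv)
  have rt: "rel ?t = {(a, b) \<in> rel s. a \<in> Domain (rel u)}"
  proof -
    have "rel ?t = rel u O (rel u)\<inverse> O rel s"
      using assms by (simp add: rel_mult cnv O_assoc)
    also have "\<dots> = {(a, b) \<in> rel s. a \<in> Domain (rel u)}"
      using rel_injective[OF u(1)] by fast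
    finally show ?thesis .
  qed
  have rt': "rel ?t' = {(b, c) \<in> rel s'. \<exists>a. (a, b) \<in> rel s \<and> a \<in> Domain (rel u)}"
  proof -
    have "rel ?t' = (rel s)\<inverse> O rel u"
      using assms by (simp add: rel_mult cnv)
    also have "\<dots> = {(b, c) \<in> rel s'. \<exists>a. (a, b) \<in> rel s \<and> a \<in> Domain (rel u)}"
    proof (intro equalityI subrelI)
      fix b c assume "(b, c) \<in> (rel s)\<inverse> O rel u"
      then obtain a where a: "(a, b) \<in> rel s" "(a, c) \<in> rel u"
        by blast
      then obtain b' where b': "(a, b') \<in> rel s" "(b', c) \<in> rel s'"
        using u(2) by blast
      then have "b' = b"
        using rel_functional[OF s(1)] a(1) by blast
      then show "(b, c) \<in> {(b, c) \<in> rel s'. \<exists>a. (a, b) \<in> rel s \<and> a \<in> Domain (rel u)}"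
        using a b' by blast
    next
      fix b c assume "(b, c) \<in> {(b, c) \<in> rel s'. \<exists>a. (a, b) \<in> rel s \<and> a \<in> Domain (rel u)}"
      then obtain a c' where a: "(b, c) \<in> rel s'" "(a, b) \<in> rel s" "(a, c') \<in> rel u"
        by blast
      then obtain b' where b': "(a, b') \<in> rel s" "(b', c') \<in> rel s'"
        using u(2) by blast
      then have "b' = b"
        using rel_functional[OF s(1)] a(2) by blast
      then have "c' = c"
        using rel_functional[OF s(2)] a(1) b' by blast
      then show "(b, c) \<in> (rel s)\<inverse> O rel u"
        using a by blast
    qed
    finally show ?thesis .
  qed
  have "Range (rel ?t) = Domain (rel ?t')"
  proof -
    have "\<exists>c. (b, c) \<in> rel s'" if "(a, b) \<in> rel s" "(a, c') \<in> rel u" for a b c'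
      using that u(2) rel_functional[OF s(1)] by blast
    then show ?thesis
      unfolding rt rt' by blast
  qed
  moreover have "?t \<otimes> ?t' = u"
  proof (rule rel_eqI)
    have "rel (?t \<otimes> ?t') = rel ?t O rel ?t'"
      using cl by (simp add: rel_mult)
    also have "\<dots> = rel u"
    proof (intro equalityI subrelI)
      fix a c assume "(a, c) \<in> rel ?t O rel ?t'"
      then obtain b a' c' where b: "(a, b) \<in> rel s" "(a, c') \<in> rel u" "(b, c) \<in> rel s'"
        unfolding rt rt' by blast
      then obtain b' where b': "(a, b') \<in> rel s" "(b', c') \<in> rel s'"
        using u(2) by blast
      then have "b' = b"
        using rel_functional[OF s(1)] b(1) by blast
      then have "c' = c"
        using rel_functional[OF s(2)] b(3) b' by blast
      then show "(a, c) \<in> rel u"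
        using b by simp
    next
      fix a c assume ac: "(a, c) \<in> rel u"
      then obtain b where "(a, b) \<in> rel s" "(b, c) \<in> rel s'"
        using u(2) by blast
      then show "(a, c) \<in> rel ?t O rel ?t'"
        unfolding rt rt' using ac by blast
    qed
    finally show "rel (?t \<otimes> ?t') = rel u" .
  qed (use cl u in auto)
  ultimately have mem: "(?t, ?t') \<in> ?A"
    using cl by (auto simp: composable_def rt rt')
  have "t = ?t \<and> t' = ?t'" if tt: "(t, t') \<in> ?A" for t t'
  proof -
    have t: "t \<in> carrier G" "t' \<in> carrier G" "Range (rel t) = Domain (rel t')"
      "rel t \<subseteq> rel s" "rel t' \<subseteq> rel s'"
      using tt by (auto simp: composable_def)
    have u_eq: "rel u = rel t O rel t'"
      using tt by (auto simp: composable_def rel_mult)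
    have dom: "Domain (rel u) = Domain (rel t)"
      unfolding u_eq using t(3) by blast
    have "rel t = rel ?t"
      unfolding rt dom using t(4) rel_functional[OF s(1)] by blast
    moreover have "rel t' = rel ?t'"
    proof -
      have "rel t' = {(b, c) \<in> rel s'. b \<in> Range (rel t)}"
        unfolding t(3) using t(5) rel_functional[OF s(2)] by blast
      also have "Range (rel t) = {b. \<exists>a. (a, b) \<in> rel s \<and> a \<in> Domain (rel t)}"
        using t(4) rel_functional[OF s(1)] by blast
      finally show ?thesis
        unfolding rt' dom by simp
    qed
    ultimately show ?thesis
      using t cl by (simp add: rel_eqI)
  qed
  then show ?thesis
    using mem by blast
qed

text \<open>Writing \<open>t \<le> s\<close> for \<open>rel t \<subseteq> rel s\<close>, the map \<open>s \<mapsto> \<Sum>t\<le>s. t\<close> is an isomorphism from the monoid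
  algebra to the algebra of the inductive groupoid; this is its effect on coefficient functions.\<close>

definition groupoid_coeffs :: "('a \<Rightarrow> complex) \<Rightarrow> 'a \<Rightarrow> complex" (\<open>\<Phi>\<close>) where
  "\<Phi> f t =
     (if t \<in> carrier G then \<Sum>s\<in>carrier G. if rel t \<subseteq> rel s then f s else 0 else 0)"

text \<open>The composable factorisations of u into a part of s and a part of s' number one if u
  lies below \<open>s \<otimes> s'\<close>, and zero otherwise. Writing this indicator as a count
  and exchanging the sums produces the convolution.\<close>

lemma groupoid_coeffs_mult:
  assumes u: "u \<in> carrier G"
  shows "\<Phi> (f \<star> g) u =
    conv (\<Phi> f) (\<Phi> g) u"
proof -
  let ?S = "carrier G"
  let ?A = "\<lambda>s s'. {(t, t') \<in> composable. t \<otimes> t' = u \<and> rel t \<subseteq> rel s \<and> rel t' \<subseteq> rel s'}"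
  have card_A: "card (?A s s') = (if rel u \<subseteq> rel (s \<otimes> s') then 1 else 0)"
    if "s \<in> ?S" "s' \<in> ?S" for s s'
  proof (cases "rel u \<subseteq> rel (s \<otimes> s')")
    case True
    then show ?thesis
      using composable_factor[OF that u] that by (simp add: rel_mult)
  next
    case False
    have "rel u \<subseteq> rel (s \<otimes> s')" if "(t, t') \<in> ?A s s'" for t t'
    proof -
      have "rel u = rel t O rel t'"
        using that by (auto simp: composable_def rel_mult)
      also have "\<dots> \<subseteq> rel s O rel s'"
        using that by (intro relcomp_mono) auto
      finally show ?thesis
        using \<open>s \<in> ?S\<close> \<open>s' \<in> ?S\<close> by (simp add: rel_mult)
    qed
    then have A: "?A s s' = {}"
      using False by blast
    show ?thesis
      unfolding A using False by simp
  qed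
  have "\<Phi> (f \<star> g) u =
    (\<Sum>z\<in>?S. (f \<star> g) z * (if rel u \<subseteq> rel z then 1 else 0))"
    using u unfolding groupoid_coeffs_def by (auto intro!: sum.cong)
  also have "\<dots> = (\<Sum>s\<in>?S. \<Sum>s'\<in>?S. f s * g s' * of_nat (card (?A s s')))"
    unfolding monoid_algebra_mult_sum by (intro sum.cong refl) (simp add: card_A)
  also have "\<dots> = (\<Sum>s\<in>?S. \<Sum>s'\<in>?S. \<Sum>(t, t')\<in>composable.
      if t \<otimes> t' = u \<and> rel t \<subseteq> rel s \<and> rel t' \<subseteq> rel s' then f s * g s' else 0)"
  proof (intro sum.cong refl)
    fix s s'
    have "(\<Sum>(t, t')\<in>composable.
        if t \<otimes> t' = u \<and> rel t \<subseteq> rel s \<and> rel t' \<subseteq> rel s' then f s * g s' else 0) =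
      (\<Sum>p\<in>?A s s'. f s * g s')"
      using finite_composable by (intro sum.mono_neutral_cong_right) (auto split: if_splits)
    then show "f s * g s' * of_nat (card (?A s s')) = (\<Sum>(t, t')\<in>composable.
        if t \<otimes> t' = u \<and> rel t \<subseteq> rel s \<and> rel t' \<subseteq> rel s' then f s * g s' else 0)"
      by simp
  qed
  also have "\<dots> = (\<Sum>s\<in>?S. \<Sum>p\<in>composable. \<Sum>s'\<in>?S. case p of (t, t') \<Rightarrow>
      if t \<otimes> t' = u \<and> rel t \<subseteq> rel s \<and> rel t' \<subseteq> rel s' then f s * g s' else 0)"
    by (intro sum.cong refl sum.swap)
  also have "\<dots> = (\<Sum>p\<in>composable. \<Sum>s\<in>?S. \<Sum>s'\<in>?S. case p of (t, t') \<Rightarrow>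
      if t \<otimes> t' = u \<and> rel t \<subseteq> rel s \<and> rel t' \<subseteq> rel s' then f s * g s' else 0)"
    by (rule sum.swap)
  also have "\<dots> = conv (\<Phi> f) (\<Phi> g) u"
    unfolding conv_def
  proof (intro sum.cong refl, clarify)
    fix t t' assume tt: "(t, t') \<in> composable"
    have "\<Phi> f t * \<Phi> g t' = (\<Sum>s\<in>?S. \<Sum>s'\<in>?S.
        (if rel t \<subseteq> rel s then f s else 0) * (if rel t' \<subseteq> rel s' then g s' else 0))"
      using tt by (simp add: groupoid_coeffs_def composable_def sum_product)
    also have "\<dots> = (\<Sum>s\<in>?S. \<Sum>s'\<in>?S. if rel t \<subseteq> rel s \<and> rel t' \<subseteq> rel s' then f s * g s' else 0)"
      by (intro sum.cong refl) auto
    finally show "(\<Sum>s\<in>?S. \<Sum>s'\<in>?S.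
        if t \<otimes> t' = u \<and> rel t \<subseteq> rel s \<and> rel t' \<subseteq> rel s' then f s * g s' else 0) =
      (if t \<otimes> t' = u then \<Phi> f t * \<Phi> g t' else 0)"
      by (cases "t \<otimes> t' = u") auto
  qed
  finally show ?thesis .
qed

lemma groupoid_coeffs_add: "\<Phi> (f + g) = \<Phi> f + \<Phi> g"
  by (rule ext) (auto simp: groupoid_coeffs_def sum.distrib[symmetric] intro!: sum.cong)

lemma groupoid_coeffs_scale: "\<Phi> (scale c f) = scale c (\<Phi> f)"
  by (rule ext) (auto simp: groupoid_coeffs_def sum_distrib_left intro!: sum.cong)

lemma groupoid_coeffs_zero: "\<Phi> 0 = 0"
  by (rule ext) (auto simp: groupoid_coeffs_def intro!: sum.neutral)

lemma groupoid_coeffs_outside: "t \<notin> carrier G \<Longrightarrow> \<Phi> f t = 0"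
  by (simp add: groupoid_coeffs_def)

text \<open>The map is unitriangular for inclusion of relations: \<open>\<Phi> f t\<close> is
  \<open>f t\<close> plus the coefficients of strictly larger elements, which vanish by induction
  from the top.\<close>

lemma groupoid_coeffs_kernel:
  assumes f: "f \<in> carrier \<A>" and zero: "\<Phi> f = 0"
  shows "f = 0"
proof -
  have "f t = 0" if "t \<in> carrier G" for t
    using that
  proof (induction "card {s \<in> carrier G. rel t \<subset> rel s}" arbitrary: t rule: less_induct)
    case less
    have "f s = 0" if s: "s \<in> carrier G" "rel t \<subset> rel s" for s
    proof -
      have "{r \<in> carrier G. rel s \<subset> rel r} \<subset> {r \<in> carrier G. rel t \<subset> rel r}"
        using s by blast
      then show ?thesis
        using less.hyps[OF _ s(1)] finite_carrier by (simp add: psubset_card_mono)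
    qed
    then have "(if rel t \<subseteq> rel s then f s else 0) = (if s = t then f t else 0)"
      if "s \<in> carrier G" for s
      using that less.prems rel_eqI[of s t] by auto
    then have "(\<Sum>s\<in>carrier G. if rel t \<subseteq> rel s then f s else 0) =
      (\<Sum>s\<in>carrier G. if s = t then f t else 0)"
      by (intro sum.cong refl)
    then have "\<Phi> f t = f t"
      using less.prems finite_carrier by (simp add: groupoid_coeffs_def)
    then show ?case
      using zero by simp
  qed
  then show ?thesis
    using f by (intro ext) (auto simp: monoid_algebra_simps)
qed

text \<open>Moebius inversion without an explicit Moebius function: the image of the indicator of h
  is the indicator of everything below h, and the preimages for the strictly smaller elements, given
  by induction, are subtracted.\<close>

lemma groupoid_coeffs_delta:
  assumes "h \<in> carrier G"
  shows "\<exists>a\<in>carrier \<A>. \<Phi> a = (\<lambda>t. if t = h then 1 else 0)"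
  using assms
proof (induction "card {t \<in> carrier G. rel t \<subset> rel h}" arbitrary: h rule: less_induct)
  case less
  let ?B = "{t \<in> carrier G. rel t \<subset> rel h}"
  have "\<exists>a\<in>carrier \<A>. \<Phi> a = (\<lambda>u. if u = t then 1 else 0)"
    if t: "t \<in> ?B" for t
  proof -
    have "{r \<in> carrier G. rel r \<subset> rel t} \<subset> ?B"
      using t by blast
    then show ?thesis
      using less.hyps[of t] t finite_carrier by (simp add: psubset_card_mono)
  qed
  then have "\<forall>t\<in>?B. \<exists>a. a \<in> carrier \<A> \<and>
      \<Phi> a = (\<lambda>u. if u = t then 1 else 0)"
    by blast
  from bchoice[OF this] obtain a where a: "\<And>t. t \<in> ?B \<Longrightarrow> a t \<in> carrier \<A>"
    "\<And>t. t \<in> ?B \<Longrightarrow> \<Phi> (a t) = (\<lambda>u. if u = t then 1 else 0)"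
    by auto
  have sum_a: "\<Phi> (\<Sum>t\<in>T. a t) = (\<Sum>t\<in>T. \<Phi> (a t))" for T
    by (induction T rule: infinite_finite_induct)
      (simp_all add: groupoid_coeffs_add groupoid_coeffs_zero del: plus_fun_apply zero_fun_apply)
  let ?d = "\<lambda>t. if t = h then 1 else (0 :: complex)"
  let ?b = "?d + scale (- 1) (\<Sum>t\<in>?B. a t)"
  have "?b \<in> carrier \<A>"
    using a(1) less.prems by (auto simp: monoid_algebra_simps sum_fun_apply)
  moreover have "\<Phi> ?b = ?d"
  proof
    fix t
    have 1: "(\<Sum>u\<in>?B. \<Phi> (a u)) t = (if t \<in> ?B then 1 else 0)"
    proof -
      have "(\<Sum>u\<in>?B. \<Phi> (a u)) t = (\<Sum>u\<in>?B. if t = u then 1 else 0)"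
        unfolding sum_fun_apply using a(2) by (intro sum.cong refl) auto
      then show ?thesis
        using finite_carrier by simp
    qed
    have 2: "\<Phi> ?d t = (if t \<in> carrier G \<and> rel t \<subseteq> rel h then 1 else 0)"
    proof -
      have "(\<Sum>s\<in>carrier G. if rel t \<subseteq> rel s then ?d s else 0) =
        (\<Sum>s\<in>carrier G. if s = h then if rel t \<subseteq> rel h then 1 else 0 else 0)"
        by (intro sum.cong refl) auto
      then show ?thesis
        using finite_carrier less.prems by (simp add: groupoid_coeffs_def)
    qed
    show "\<Phi> ?b t = ?d t"
      unfolding groupoid_coeffs_add groupoid_coeffs_scale sum_a plus_fun_apply scale_apply 1 2
      using less.prems rel_eqI[of t h] by auto
  qed
  ultimately show ?case
    by blast
qed

end

section \<open>Inner product and adjoints in the groupoid basis\<close>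

context partial_injection_monoid
begin

definition coeff_inner :: "('a \<Rightarrow> complex) \<Rightarrow> ('a \<Rightarrow> complex) \<Rightarrow> complex" where
  "coeff_inner f g = (\<Sum>t\<in>carrier G. \<Phi> f t * cnj (\<Phi> g t))"

definition star :: "('a \<Rightarrow> complex) \<Rightarrow> 'a \<Rightarrow> complex" where
  "star f t = (if t \<in> carrier G then cnj (f (cnv t)) else 0)"

text \<open>Inversion preserves inclusion of relations, so the involution has the same shape before
  and after the change of basis.\<close>

lemma groupoid_coeffs_star:
  assumes t: "t \<in> carrier G"
  shows "\<Phi> (star f) t = cnj (\<Phi> f (cnv t))"
proof -
  have "(\<Sum>s\<in>carrier G. if rel t \<subseteq> rel s then star f s else 0) =
    (\<Sum>s\<in>carrier G. cnj (if rel (cnv t) \<subseteq> rel s then f s else 0))"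
    by (rule sum.reindex_bij_witness[of _ cnv cnv])
      (auto simp: cnv cnv_cnv star_def t)
  then show ?thesis
    using t by (simp add: groupoid_coeffs_def cnv)
qed

lemma composable_in: "(x, y) \<in> composable \<Longrightarrow> x \<in> carrier G \<and> y \<in> carrier G"
  by (simp add: composable_def)

text \<open>Left cancellation in the groupoid: on composable pairs the inverse of x undoes
  multiplication by x, which for arbitrary pairs of monoid elements may fail.\<close>

lemma composable_left_converse:
  assumes xy: "(x, y) \<in> composable"
  shows "(cnv x, x \<otimes> y) \<in> composable" "cnv x \<otimes> (x \<otimes> y) = y"
proof -
  have x: "x \<in> carrier G" and y: "y \<in> carrier G" and R: "Range (rel x) = Domain (rel y)"
    using xy by (auto simp: composable_def)
  have "Domain (rel x O rel y) = Domain (rel x)"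
    using R by blast
  then show "(cnv x, x \<otimes> y) \<in> composable"
    using x y by (simp add: composable_def cnv rel_mult)
  have "(rel x)\<inverse> O rel x O rel y = rel y"
  proof (intro equalityI subrelI)
    fix b c assume "(b, c) \<in> (rel x)\<inverse> O rel x O rel y"
    then show "(b, c) \<in> rel y"
      using rel_functional[OF x] by blast
  next
    fix b c assume bc: "(b, c) \<in> rel y"
    then obtain a where "(a, b) \<in> rel x"
      using R by blast
    then show "(b, c) \<in> (rel x)\<inverse> O rel x O rel y"
      using bc by blast
  qed
  then show "cnv x \<otimes> (x \<otimes> y) = y"
    using x y by (intro rel_eqI) (simp_all add: cnv rel_mult)
qed

lemma composable_right_converse:
  assumes xy: "(x, y) \<in> composable"
  shows "(x \<otimes> y, cnv y) \<in> composable" "x \<otimes> y \<otimes> cnv y = x"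
proof -
  have x: "x \<in> carrier G" and y: "y \<in> carrier G" and R: "Range (rel x) = Domain (rel y)"
    using xy by (auto simp: composable_def)
  have "Range (rel x O rel y) = Range (rel y)"
    using R by blast
  then show "(x \<otimes> y, cnv y) \<in> composable"
    using x y by (simp add: composable_def cnv rel_mult)
  have "(rel x O rel y) O (rel y)\<inverse> = rel x"
  proof (intro equalityI subrelI)
    fix a b assume "(a, b) \<in> (rel x O rel y) O (rel y)\<inverse>"
    then show "(a, b) \<in> rel x"
      using rel_injective[OF y] by blast
  next
    fix a b assume ab: "(a, b) \<in> rel x"
    then obtain c where "(b, c) \<in> rel y"
      using R by blast
    then show "(a, b) \<in> (rel x O rel y) O (rel y)\<inverse>"
      using ab by blast
  qed
  then show "x \<otimes> y \<otimes> cnv y = x"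
    using x y by (intro rel_eqI) (simp_all add: cnv rel_mult)
qed

lemma coeff_inner_mult_left:
  "coeff_inner (f \<star> g) h =
    (\<Sum>(x, y)\<in>composable. \<Phi> f x * \<Phi> g y * cnj (\<Phi> h (x \<otimes> y)))"
  using conv_sum[of "\<Phi> f" "\<Phi> g" "\<lambda>t. cnj (\<Phi> h t)"]
  by (simp add: coeff_inner_def groupoid_coeffs_mult)

lemma coeff_inner_mult_right:
  "coeff_inner h (f \<star> g) =
    (\<Sum>(x, y)\<in>composable. \<Phi> h (x \<otimes> y) * cnj (\<Phi> f x * \<Phi> g y))"
proof -
  have sym: "coeff_inner h k = cnj (coeff_inner k h)" for h k
    by (simp add: coeff_inner_def mult.commute)
  show ?thesis
    unfolding sym[of h] coeff_inner_mult_left cnj_sum by (intro sum.cong refl) (auto simp: mult_ac)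
qed

text \<open>Sending (x, y) to \<open>(cnv x, x \<otimes> y)\<close> is an involution on composable
  pairs that carries one sum to the other.\<close>

lemma coeff_inner_star_left:
  "coeff_inner (f \<star> g) h = coeff_inner g (star f \<star> h)"
  unfolding coeff_inner_mult_left coeff_inner_mult_right
  by (rule sum.reindex_bij_witness[of _ "\<lambda>(x, y). (cnv x, x \<otimes> y)"
        "\<lambda>(x, y). (cnv x, x \<otimes> y)"])
    (auto simp: composable_left_converse cnv_cnv dest: composable_in,
      simp add: composable_def groupoid_coeffs_star cnv cnv_cnv)

lemma coeff_inner_star_right:
  "coeff_inner (g \<star> f) h = coeff_inner g (h \<star> star f)"
  unfolding coeff_inner_mult_left coeff_inner_mult_right
  by (rule sum.reindex_bij_witness[of _ "\<lambda>(x, y). (x \<otimes> y, cnv y)"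
        "\<lambda>(x, y). (x \<otimes> y, cnv y)"])
    (auto simp: composable_right_converse cnv_cnv dest: composable_in,
      simp add: composable_def groupoid_coeffs_star cnv cnv_cnv)

lemma star_algebra: "star_algebra \<A> (carrier G) coeff_inner"
proof (intro star_algebra.intro star_algebra_axioms.intro)
  show "ring \<A>"
    by (rule ring_monoid_algebra)
  show "scale c f \<star> g = scale c (f \<star> g)" for c f g
    by (rule ext) (auto simp: monoid_algebra_mult sum_distrib_left intro!: sum.cong)
  show "f \<star> scale c g = scale c (f \<star> g)" for c f g
    by (rule ext) (auto simp: monoid_algebra_mult sum_distrib_left intro!: sum.cong)
  show "coeff_inner (f + g) h = coeff_inner f h + coeff_inner g h" for f g h
    by (simp add: coeff_inner_def groupoid_coeffs_add distrib_right sum.distrib del: plus_fun_apply)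
      (simp add: distrib_right sum.distrib)
  show "coeff_inner (scale c f) h = c * coeff_inner f h" for c f h
    by (simp add: coeff_inner_def groupoid_coeffs_scale sum_distrib_left mult_ac del: scale_apply)
      (simp add: sum_distrib_left mult_ac)
  show "coeff_inner g f = cnj (coeff_inner f g)" for f g
    by (simp add: coeff_inner_def mult.commute)
  show "f = 0" if f: "f \<in> carrier \<A>" and zero: "coeff_inner f f = 0" for f
  proof -
    have "coeff_inner f f = of_real (\<Sum>t\<in>carrier G. (cmod (\<Phi> f t))\<^sup>2)"
      unfolding coeff_inner_def complex_norm_square[symmetric] by simp
    then have "(\<Sum>t\<in>carrier G. (cmod (\<Phi> f t))\<^sup>2) = 0"
      using zero by (metis of_real_eq_0_iff)
    then have "\<Phi> f t = 0" if "t \<in> carrier G" for t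
      using that finite_carrier by (simp add: sum_nonneg_eq_0_iff)
    then have "\<Phi> f = 0"
      using groupoid_coeffs_outside by (intro ext) (metis zero_fun_apply)
    then show ?thesis
      using groupoid_coeffs_kernel[OF f] by simp
  qed
  show "\<exists>a'\<in>carrier \<A>. \<forall>b\<in>carrier \<A>. \<forall>c\<in>carrier \<A>.
      coeff_inner (a \<star> b) c = coeff_inner b (a' \<star> c)" for a
    by (intro bexI[of _ "star a"]) (auto simp: coeff_inner_star_left monoid_algebra_simps star_def)
  show "\<exists>a'\<in>carrier \<A>. \<forall>b\<in>carrier \<A>. \<forall>c\<in>carrier \<A>.
      coeff_inner (b \<star> a) c = coeff_inner b (c \<star> a')" for a
    by (intro bexI[of _ "star a"]) (auto simp: coeff_inner_star_right monoid_algebra_simps star_def)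
qed (auto simp: finite_carrier monoid_algebra_simps)

end

sublocale partial_injection_monoid \<subseteq> alg: star_algebra "monoid_algebra G" "carrier G" coeff_inner
  by (rule star_algebra)

section \<open>The centre as the space of class functions on loops\<close>

context partial_injection_monoid
begin

definition loops :: "'a set" where
  "loops = {t \<in> carrier G. Domain (rel t) = Range (rel t)}"

text \<open>An arrow h from the object of t to the object of t' that conjugates t into t', with the
  inverse of h cleared from the equation. Products are read from left to right.\<close>

definition conjugate :: "'a \<Rightarrow> 'a \<Rightarrow> bool" where
  "conjugate t t' \<longleftrightarrow> (\<exists>h\<in>carrier G. Domain (rel h) = Domain (rel t) \<and> Range (rel h) = Domain (rel t') \<and>
     rel h O rel t' = rel t O rel h)"

definition class_functions :: "('a \<Rightarrow> complex) set" where
  "class_functions = {f. (\<forall>t. t \<notin> loops \<longrightarrow> f t = 0) \<and>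
     (\<forall>t\<in>loops. \<forall>t'\<in>loops. conjugate t t' \<longrightarrow> f t = f t')}"

text \<open>By cancellation \<open>u \<otimes> h\<close> has only one composable factorisation with
  second factor h, so convolution with an indicator is a translation.\<close>

lemma conv_delta_right:
  assumes "(u, h) \<in> composable"
  shows "conv f (\<lambda>t. if t = h then 1 else 0) (u \<otimes> h) = f u"
proof -
  have *: "(if x \<otimes> y = u \<otimes> h then f x * (if y = h then 1 else 0) else 0) =
    (if (x, y) = (u, h) then f u else 0)" if xy: "(x, y) \<in> composable" for x y
    using composable_right_converse(2)[OF xy] composable_right_converse(2)[OF assms] by auto
  have "conv f (\<lambda>t. if t = h then 1 else 0) (u \<otimes> h) =
    (\<Sum>p\<in>composable. if p = (u, h) then f u else 0)"
    unfolding conv_def by (intro sum.cong refl, clarify, rule *)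
  then show ?thesis
    using assms finite_composable by simp
qed

lemma conv_delta_left:
  assumes "(h, u) \<in> composable"
  shows "conv (\<lambda>t. if t = h then 1 else 0) f (h \<otimes> u) = f u"
proof -
  have *: "(if x \<otimes> y = h \<otimes> u then (if x = h then 1 else 0) * f y else 0) =
    (if (x, y) = (h, u) then f u else 0)" if xy: "(x, y) \<in> composable" for x y
    using composable_left_converse(2)[OF xy] composable_left_converse(2)[OF assms] by auto
  have "conv (\<lambda>t. if t = h then 1 else 0) f (h \<otimes> u) =
    (\<Sum>p\<in>composable. if p = (h, u) then f u else 0)"
    unfolding conv_def by (intro sum.cong refl, clarify, rule *)
  then show ?thesis
    using assms finite_composable by simp
qed

lemma groupoid_coeffs_centre_commutes:
  assumes z: "z \<in> alg.centre" and h: "h \<in> carrier G" and u: "u \<in> carrier G"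
  shows "conv (\<Phi> z) (\<lambda>t. if t = h then 1 else 0) u =
    conv (\<lambda>t. if t = h then 1 else 0) (\<Phi> z) u"
proof -
  obtain a where a: "a \<in> carrier \<A>"
    "\<Phi> a = (\<lambda>t. if t = h then 1 else 0)"
    using groupoid_coeffs_delta[OF h] by blast
  have "z \<star> a = a \<star> z"
    using z a(1) by (simp add: alg.centre_def)
  then show ?thesis
    using groupoid_coeffs_mult[OF u, of z a] groupoid_coeffs_mult[OF u, of a z] a(2) by simp
qed

text \<open>Commuting with the identity at the domain of t kills the coefficient at a non-loop.
  Commuting with a conjugating arrow h equates the coefficients at t and t', since both are read off
  at \<open>t \<otimes> h\<close>.\<close>

lemma groupoid_coeffs_centre:
  assumes z: "z \<in> alg.centre"
  shows "\<Phi> z \<in> class_functions"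
proof -
  have "\<Phi> z t = 0" if t: "t \<notin> loops" for t
  proof (cases "t \<in> carrier G")
    case True
    then have ne: "Domain (rel t) \<noteq> Range (rel t)"
      using t by (simp add: loops_def)
    \<comment> \<open>The partial identity on the domain of t. As a left factor it returns t; as a
      right factor it would force range and domain of t to agree.\<close>
    define h where "h = t \<otimes> cnv t"
    have h: "h \<in> carrier G"
      using True by (simp add: h_def cnv)
    have rel_h: "rel h = Id_on (Domain (rel t))"
      using True rel_injective[OF True] by (auto simp: h_def rel_mult cnv)
    have ht: "(h, t) \<in> composable"
      using True h by (auto simp: composable_def rel_h)
    have "h \<otimes> t = t"
      using True h by (intro rel_eqI) (auto simp: rel_mult rel_h)
    then have "\<Phi> z t = conv (\<lambda>t. if t = h then 1 else 0) (\<Phi> z) t"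
      using conv_delta_left[OF ht, of "\<Phi> z"] by simp
    also have "\<dots> = conv (\<Phi> z) (\<lambda>t. if t = h then 1 else 0) t"
      using groupoid_coeffs_centre_commutes[OF z h True] by simp
    also have "\<dots> = 0"
      unfolding conv_def
    proof (intro sum.neutral ballI, clarify)
      fix x y assume xy: "(x, y) \<in> composable"
      have "x \<otimes> y \<noteq> t" if "y = h"
      proof
        assume "x \<otimes> y = t"
        then have "rel t = rel x O rel h"
          using xy that by (auto simp: composable_def rel_mult)
        moreover have "Range (rel x) = Domain (rel t)"
          using xy that by (auto simp: composable_def rel_h)
        ultimately have "Range (rel t) = Domain (rel t)"
          unfolding rel_h by blast
        then show False
          using ne by simp
      qed
      then show "(if x \<otimes> y = t then \<Phi> z x * (if y = h then 1 else 0) else 0) = 0"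
        by auto
    qed
    finally show ?thesis .
  qed (rule groupoid_coeffs_outside)
  moreover have "\<Phi> z t = \<Phi> z t'"
    if t: "t \<in> loops" "t' \<in> loops" and c: "conjugate t t'" for t t'
  proof -
    obtain h where h: "h \<in> carrier G" "Domain (rel h) = Domain (rel t)"
      "Range (rel h) = Domain (rel t')" "rel h O rel t' = rel t O rel h"
      using c by (auto simp: conjugate_def)
    have tG: "t \<in> carrier G" "t' \<in> carrier G"
      using t by (auto simp: loops_def)
    have comp: "(t, h) \<in> composable" "(h, t') \<in> composable"
      using h t by (auto simp: composable_def loops_def)
    have eq: "t \<otimes> h = h \<otimes> t'"
      using h tG by (intro rel_eqI) (auto simp: rel_mult)
    have "\<Phi> z t = conv (\<Phi> z) (\<lambda>t. if t = h then 1 else 0) (t \<otimes> h)"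
      using conv_delta_right[OF comp(1)] by simp
    also have "\<dots> = conv (\<lambda>t. if t = h then 1 else 0) (\<Phi> z) (h \<otimes> t')"
      unfolding eq using groupoid_coeffs_centre_commutes[OF z h(1)] h(1) tG by simp
    also have "\<dots> = \<Phi> z t'"
      using conv_delta_left[OF comp(2)] by simp
    finally show ?thesis .
  qed
  ultimately show ?thesis
    by (auto simp: class_functions_def)
qed

text \<open>A loop t followed by h equals h followed by the conjugate loop
  \<open>cnv h \<otimes> t \<otimes> h\<close>, on which f has the same value. This matches the two
  convolutions term by term.\<close>

lemma class_function_commutes:
  assumes f: "f \<in> class_functions" and u: "u \<in> carrier G"
  shows "conv f g u = conv g f u"
proof -
  let ?P = "{(t, h) \<in> composable. t \<in> loops \<and> t \<otimes> h = u}"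
  let ?Q = "{(h, t) \<in> composable. t \<in> loops \<and> h \<otimes> t = u}"
  have f0: "t \<in> loops" if "f t \<noteq> 0" for t
    using f that by (auto simp: class_functions_def)
  have "conv f g u = (\<Sum>(t, h)\<in>?P. f t * g h)"
    unfolding conv_def using finite_composable
    by (intro sum.mono_neutral_cong_right) (auto intro: f0 split: if_splits)
  also have "\<dots> = (\<Sum>(h, t)\<in>?Q. g h * f t)"
  proof (rule sum.reindex_bij_witness[of _ "\<lambda>(h, t). (h \<otimes> t \<otimes> cnv h, h)"
        "\<lambda>(t, h). (h, cnv h \<otimes> t \<otimes> h)"])
    fix p assume p: "p \<in> ?P"
    obtain t h where th: "p = (t, h)"
      by force
    have tG: "t \<in> carrier G" and hG: "h \<in> carrier G" and thc: "(t, h) \<in> composable"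
      and tl: "t \<in> loops" and thu: "t \<otimes> h = u"
      using p th by (auto simp: composable_def)
    have dom: "Range (rel t) = Domain (rel h)" "Domain (rel t) = Domain (rel h)"
      using thc tl by (auto simp: composable_def loops_def)
    let ?t = "cnv h \<otimes> t \<otimes> h"
    have c1: "(cnv h, t \<otimes> h) \<in> composable"
      using tG hG dom by (auto simp: composable_def cnv rel_mult) blast+
    have t'G: "?t \<in> carrier G"
      using tG hG by (simp add: cnv)
    have ht': "h \<otimes> ?t = t \<otimes> h"
      using composable_left_converse(2)[OF c1] hG tG by (simp add: cnv_cnv m_assoc cnv)
    have c2: "(h, ?t) \<in> composable"
      using composable_left_converse(1)[OF c1] hG tG by (simp add: cnv_cnv m_assoc cnv)
    have rel_t': "rel ?t = (rel h)\<inverse> O rel t O rel h"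
      using hG tG by (simp add: rel_mult cnv O_assoc)
    have loop': "?t \<in> loops"
    proof -
      have "Domain (rel ?t) = Range (rel h)"
        using c2 by (simp add: composable_def)
      moreover have "Range (rel ?t) = Range (rel h)"
        unfolding rel_t' using dom by blast
      ultimately show ?thesis
        using t'G by (simp add: loops_def)
    qed
    have conj: "conjugate t ?t"
      unfolding conjugate_def
    proof (intro bexI conjI)
      show "rel h O rel ?t = rel t O rel h"
        using ht' hG tG t'G by (metis rel_mult)
    qed (use c2 dom hG in \<open>auto simp: composable_def\<close>)
    show "(case case p of (t, h) \<Rightarrow> (h, cnv h \<otimes> t \<otimes> h) of
        (h, t) \<Rightarrow> (h \<otimes> t \<otimes> cnv h, h)) = p"
      using composable_right_converse(2)[OF thc] by (simp add: th ht')
    show "(case p of (t, h) \<Rightarrow> (h, cnv h \<otimes> t \<otimes> h)) \<in> ?Q"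
      using c2 loop' ht' thu by (simp add: th)
    show "(case case p of (t, h) \<Rightarrow> (h, cnv h \<otimes> t \<otimes> h) of (h, t) \<Rightarrow> g h * f t) =
        (case p of (t, h) \<Rightarrow> f t * g h)"
      using f tl loop' conj unfolding th by (auto simp: class_functions_def)
  next
    fix p assume p: "p \<in> ?Q"
    obtain t h where th: "p = (h, t)"
      by force
    have tG: "t \<in> carrier G" and hG: "h \<in> carrier G" and htc: "(h, t) \<in> composable"
      and tl: "t \<in> loops" and htu: "h \<otimes> t = u"
      using p th by (auto simp: composable_def)
    have dom: "Range (rel h) = Domain (rel t)" "Range (rel h) = Range (rel t)"
      using htc tl by (auto simp: composable_def loops_def)
    let ?t = "h \<otimes> t \<otimes> cnv h"
    have c1: "(h \<otimes> t, cnv h) \<in> composable"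
      using tG hG dom by (auto simp: composable_def cnv rel_mult) blast+
    have t'G: "?t \<in> carrier G"
      using tG hG by (simp add: cnv)
    have ht': "?t \<otimes> h = h \<otimes> t"
      using composable_right_converse(2)[OF c1] hG by (simp add: cnv_cnv)
    have c2: "(?t, h) \<in> composable"
      using composable_right_converse(1)[OF c1] hG by (simp add: cnv_cnv)
    have rel_t': "rel ?t = rel h O rel t O (rel h)\<inverse>"
      using hG tG by (simp add: rel_mult cnv O_assoc)
    have loop': "?t \<in> loops"
    proof -
      have "Range (rel ?t) = Domain (rel h)"
        using c2 by (simp add: composable_def)
      moreover have "Domain (rel ?t) = Domain (rel h)"
        unfolding rel_t' using dom by blast
      ultimately show ?thesis
        using t'G by (simp add: loops_def)
    qed
    have "cnv h \<otimes> ?t \<otimes> h = t"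
      using composable_left_converse(2)[OF htc] hG tG t'G ht' by (simp add: m_assoc cnv)
    then show "(case case p of (h, t) \<Rightarrow> (h \<otimes> t \<otimes> cnv h, h) of
        (t, h) \<Rightarrow> (h, cnv h \<otimes> t \<otimes> h)) = p"
      by (simp add: th)
    show "(case p of (h, t) \<Rightarrow> (h \<otimes> t \<otimes> cnv h, h)) \<in> ?P"
      using c2 loop' ht' htu by (simp add: th)
  qed
  also have "\<dots> = conv g f u"
    unfolding conv_def using finite_composable
    by (intro sum.mono_neutral_cong_left) (auto intro: f0 split: if_splits)
  finally show ?thesis .
qed

lemma groupoid_coeffs_surj:
  assumes "\<And>t. t \<notin> carrier G \<Longrightarrow> f t = 0"
  shows "\<exists>a\<in>carrier \<A>. \<Phi> a = f"
proof -
  have "\<forall>h\<in>carrier G. \<exists>a. a \<in> carrier \<A> \<and>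
      \<Phi> a = (\<lambda>t. if t = h then 1 else 0)"
    using groupoid_coeffs_delta by blast
  from bchoice[OF this] obtain d where d: "\<And>h. h \<in> carrier G \<Longrightarrow> d h \<in> carrier \<A>"
    "\<And>h. h \<in> carrier G \<Longrightarrow> \<Phi> (d h) = (\<lambda>t. if t = h then 1 else 0)"
    by auto
  let ?a = "\<Sum>h\<in>carrier G. scale (f h) (d h)"
  have "\<Phi> (\<Sum>h\<in>T. scale (f h) (d h)) = (\<Sum>h\<in>T. scale (f h) (\<Phi> (d h)))" for T
    by (induction T rule: infinite_finite_induct)
      (simp_all add: groupoid_coeffs_add groupoid_coeffs_scale groupoid_coeffs_zero
        del: plus_fun_apply zero_fun_apply scale_apply)
  then have "\<Phi> ?a = (\<Sum>h\<in>carrier G. scale (f h) (\<Phi> (d h)))" .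
  also have "\<dots> = f"
  proof
    fix t
    have "(\<Sum>h\<in>carrier G. scale (f h) (\<Phi> (d h))) t =
      (\<Sum>h\<in>carrier G. if t = h then f h else 0)"
      unfolding sum_fun_apply using d(2) by (intro sum.cong refl) auto
    then show "(\<Sum>h\<in>carrier G. scale (f h) (\<Phi> (d h))) t = f t"
      using finite_carrier assms by simp
  qed
  finally have "\<Phi> ?a = f" .
  moreover have "?a \<in> carrier \<A>"
    using d(1) by (intro alg.sum_in alg.scale_in)
  ultimately show ?thesis
    by blast
qed

lemma inj_on_groupoid_coeffs: "inj_on \<Phi> (carrier \<A>)"
proof (rule inj_onI)
  fix f g assume fg: "f \<in> carrier \<A>" "g \<in> carrier \<A>"
    "\<Phi> f = \<Phi> g"
  have "\<Phi> (f + scale (- 1) g) = 0"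
    unfolding groupoid_coeffs_add groupoid_coeffs_scale fg(3) by (rule ext) simp
  moreover have "f + scale (- 1) g \<in> carrier \<A>"
    using fg by (intro alg.add_in alg.scale_in)
  ultimately have "f + scale (- 1) g = 0"
    using groupoid_coeffs_kernel by blast
  then have "f - g = 0"
    by (simp only: alg.scale_minus_one diff_conv_add_uminus)
  then show "f = g"
    by (simp only: right_minus_eq)
qed

lemma groupoid_coeffs_image_centre: "\<Phi> ` alg.centre = class_functions"
proof
  show "\<Phi> ` alg.centre \<subseteq> class_functions"
    using groupoid_coeffs_centre by blast
next
  show "class_functions \<subseteq> \<Phi> ` alg.centre"
  proof
    fix f assume f: "f \<in> class_functions"
    then have "f t = 0" if "t \<notin> carrier G" for t
      using that by (auto simp: class_functions_def loops_def)
    then obtain a where a: "a \<in> carrier \<A>" "\<Phi> a = f"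
      using groupoid_coeffs_surj by blast
    have "a \<star> b = b \<star> a" if b: "b \<in> carrier \<A>" for b
    proof (rule inj_onD[OF inj_on_groupoid_coeffs])
      show "\<Phi> (a \<star> b) = \<Phi> (b \<star> a)"
      proof
        fix u
        show "\<Phi> (a \<star> b) u = \<Phi> (b \<star> a) u"
          by (cases "u \<in> carrier G")
            (simp_all add: groupoid_coeffs_mult a(2) class_function_commutes[OF f] groupoid_coeffs_outside)
      qed
    qed (use a b in auto)
    then show "f \<in> \<Phi> ` alg.centre"
      using a by (auto simp: alg.centre_def)
  qed
qed

text \<open>Both the central idempotents and the indicator functions of the conjugacy classes of loops are
  bases of the centre.\<close>

lemma bij_betw_class_types_block_idems:
  assumes type: "type ` loops = T"
    and conj: "\<And>t t'. t \<in> loops \<Longrightarrow> t' \<in> loops \<Longrightarrow> conjugate t t' \<longleftrightarrow> type t = type t'"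
  shows "\<exists>F. bij_betw F T alg.block_idems"
proof -
  define ind :: "'c \<Rightarrow> 'a \<Rightarrow> complex" where
    "ind p = (\<lambda>t. if t \<in> loops \<and> type t = p then 1 else 0)" for p
  have inj: "inj_on ind T"
  proof (rule inj_onI)
    fix p q assume "p \<in> T" "q \<in> T" and eq: "ind p = ind q"
    then obtain t where "t \<in> loops" "type t = p"
      using type by blast
    then show "p = q"
      using fun_cong[OF eq, of t] by (auto simp: ind_def split: if_splits)
  qed
  have "finite loops"
    using finite_carrier by (simp add: loops_def)
  then have finT: "finite T"
    using type by blast
  have indep: "cvs.independent (ind ` T)"
  proof (rule cvs.independent_if_scalars_zero)
    fix c f assume sum0: "(\<Sum>x\<in>ind ` T. scale (c x) x) = 0" and "f \<in> ind ` T"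
    then obtain t where t: "t \<in> loops" "f = ind (type t)" "type t \<in> T"
      using type by blast
    have "0 = (\<Sum>x\<in>ind ` T. scale (c x) x) t"
      by (simp only: sum0 zero_fun_apply)
    also have "\<dots> = (\<Sum>p\<in>T. scale (c (ind p)) (ind p) t)"
      unfolding sum_fun_apply by (simp only: sum.reindex[OF inj] o_def)
    also have "\<dots> = (\<Sum>p\<in>T. if p = type t then c f else 0)"
      using t by (intro sum.cong refl) (auto simp: ind_def)
    also have "\<dots> = c f"
      using t finT by simp
    finally show "c f = 0"
      by simp
  qed (use finT in simp)
  have span: "cvs.span (ind ` T) = class_functions"
  proof
    have "cvs.subspace class_functions"
      by (auto simp: cvs.subspace_def class_functions_def)
    then show "cvs.span (ind ` T) \<subseteq> class_functions"
      by (rule cvs.span_minimal[rotated]) (auto simp: class_functions_def ind_def conj)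
  next
    show "class_functions \<subseteq> cvs.span (ind ` T)"
    proof
      fix f assume f: "f \<in> class_functions"
      have "\<forall>p\<in>T. \<exists>t. t \<in> loops \<and> type t = p"
        using type by blast
      from bchoice[OF this] obtain r where r: "\<And>p. p \<in> T \<Longrightarrow> r p \<in> loops \<and> type (r p) = p"
        by blast
      have "f = (\<Sum>p\<in>T. scale (f (r p)) (ind p))"
      proof
        fix t
        have sum: "(\<Sum>p\<in>T. scale (f (r p)) (ind p)) t =
          (\<Sum>p\<in>T. if t \<in> loops \<and> type t = p then f (r p) else 0)"
          unfolding sum_fun_apply by (intro sum.cong refl) (auto simp: ind_def)
        show "f t = (\<Sum>p\<in>T. scale (f (r p)) (ind p)) t"
        proof (cases "t \<in> loops")
          case True
          then have "type t \<in> T"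
            using type by blast
          then have "f t = f (r (type t))"
            using f r[of "type t"] conj[OF True, of "r (type t)"] True by (auto simp: class_functions_def)
          then show ?thesis
            unfolding sum using True finT \<open>type t \<in> T\<close> by simp
        next
          case False
          then show ?thesis
            unfolding sum using f by (simp add: class_functions_def)
        qed
      qed
      also have "\<dots> \<in> cvs.span (ind ` T)"
        by (intro cvs.span_sum cvs.span_scale cvs.span_base imageI)
      finally show "f \<in> cvs.span (ind ` T)" .
    qed
  qed
  interpret lin: Vector_Spaces.linear scale scale \<Phi>
    by (simp add: Vector_Spaces.linear_iff cvs.vector_space_axioms groupoid_coeffs_add
        groupoid_coeffs_scale del: plus_fun_apply scale_apply)
  let ?E = alg.block_idems
  have "alg.centre \<subseteq> carrier \<A>"
    by (auto simp: alg.centre_def)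
  then have inj_span: "inj_on \<Phi> (cvs.span ?E)"
    using inj_on_subset[OF inj_on_groupoid_coeffs] by (simp add: alg.span_block_idems)
  have indep': "cvs.independent (\<Phi> ` ?E)"
    by (rule lin.independent_injective_image[OF alg.independent_block_idems inj_span])
  \<comment> \<open>Under \<open>\<Phi>\<close> the idempotents become a second basis of the space
    of class functions, and any two bases are in bijection.\<close>
  have "cvs.span (\<Phi> ` ?E) = cvs.span (ind ` T)"
    by (simp add: lin.span_image alg.span_block_idems groupoid_coeffs_image_centre span)
  then obtain g where g: "bij_betw g (ind ` T) (\<Phi> ` ?E)"
    using cvs.bij_if_span_eq_span_bases[OF indep indep'] by auto
  have ind: "bij_betw ind T (ind ` T)"
    using inj by (rule inj_on_imp_bij_betw)
  have "inj_on \<Phi> ?E"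
    using inj_on_subset[OF inj_span cvs.span_superset] .
  then have "bij_betw (inv_into ?E \<Phi>) (\<Phi> ` ?E) ?E"
    by (intro bij_betw_inv_into inj_on_imp_bij_betw)
  then show ?thesis
    using bij_betw_trans[OF bij_betw_trans[OF ind g]] by blast
qed

end

section \<open>Diagrams as relations\<close>

abbreviation (input) ubps :: "nat \<Rightarrow> diagram set" (\<open>\<U>\<close>) where
  "\<U> \<equiv> uniform_block_perms"

text \<open>Being a union of blocks, expressed block by block so that the notion also applies to a
  stack, whose blocks overlap in the middle row.\<close>

definition saturated :: "'a set set \<Rightarrow> 'a set \<Rightarrow> bool" where
  "saturated P W \<longleftrightarrow> (\<forall>B\<in>P. B \<subseteq> W \<or> B \<inter> W = {})"

lemma saturated_block: "partition_on V P \<Longrightarrow> B \<in> P \<Longrightarrow> saturated P B"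
  unfolding saturated_def partition_on_def disjoint_def by blast

lemma saturated_Diff: "saturated P W \<Longrightarrow> saturated P W' \<Longrightarrow> saturated P (W - W')"
  unfolding saturated_def by blast

lemma saturated_eq_Union:
  assumes "partition_on V P" "W \<subseteq> V" "saturated P W"
  shows "W = \<Union>{B \<in> P. B \<subseteq> W}"
proof
  show "W \<subseteq> \<Union>{B \<in> P. B \<subseteq> W}"
  proof
    fix x assume x: "x \<in> W"
    then obtain B where "B \<in> P" "x \<in> B"
      using assms(1,2) by (auto simp: partition_on_def)
    then show "x \<in> \<Union>{B \<in> P. B \<subseteq> W}"
      using assms(3) x unfolding saturated_def by blast
  qed
qed blast

text \<open>Blocks are the minimal nonempty saturated sets: if both partitions have the same
  saturated sets, blocks with a common point contain each other.\<close>

lemma partition_subset_if_saturated: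
  assumes P: "partition_on V P" and Q: "partition_on V Q"
    and sat: "\<And>W. W \<subseteq> V \<Longrightarrow> saturated P W \<longleftrightarrow> saturated Q W"
  shows "P \<subseteq> Q"
proof
  fix B assume B: "B \<in> P"
  have BV: "B \<subseteq> V" "B \<noteq> {}"
    using P B by (auto simp: partition_on_def)
  then obtain x where x: "x \<in> B"
    by blast
  then obtain C where C: "C \<in> Q" "x \<in> C"
    using BV Q by (auto simp: partition_on_def)
  have "saturated Q B"
    using saturated_block[OF P B] sat BV by blast
  then have CB: "C \<subseteq> B"
    using C x by (auto simp: saturated_def)
  have "saturated P C"
    using saturated_block[OF Q C(1)] sat CB BV by blast
  then have "B \<subseteq> C"
    using B C x by (auto simp: saturated_def)
  then show "B \<in> Q"
    using CB C by auto
qed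

lemma partition_eqI_saturated:
  assumes "partition_on V P" "partition_on V Q"
    and "\<And>W. W \<subseteq> V \<Longrightarrow> saturated P W \<longleftrightarrow> saturated Q W"
  shows "P = Q"
  using partition_subset_if_saturated[of V P Q] partition_subset_if_saturated[of V Q P] assms
  by blast

definition rows :: "nat set \<Rightarrow> nat set \<Rightarrow> vertex set" where
  "rows A B = Up ` A \<union> Down ` B"

lemma in_rows [simp]: "Up i \<in> rows A B \<longleftrightarrow> i \<in> A" "Down i \<in> rows A B \<longleftrightarrow> i \<in> B"
  by (auto simp: rows_def)

lemma rows_vimage: "rows (Up -` W) (Down -` W) = W"
proof (rule Set.set_eqI)
  fix v show "v \<in> rows (Up -` W) (Down -` W) \<longleftrightarrow> v \<in> W"
    by (cases v) simp_all
qed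

lemma vimage_rows [simp]: "Up -` rows A B = A" "Down -` rows A B = B"
  by (auto simp: rows_def)

lemma rows_subset_iff: "rows A B \<subseteq> rows A' B' \<longleftrightarrow> A \<subseteq> A' \<and> B \<subseteq> B'"
  by (auto simp: rows_def)

lemma rows_Diff: "rows A B - rows A' B' = rows (A - A') (B - B')"
  by (auto simp: rows_def)

lemma rows_Int: "rows A B \<inter> rows A' B' = rows (A \<inter> A') (B \<inter> B')"
  by (auto simp: rows_def)

lemma rows_Union: "(\<Union>i\<in>I. rows (f i) (g i)) = rows (\<Union>(f ` I)) (\<Union>(g ` I))"
  by (auto simp: rows_def)

lemma vertices_eq_rows: "vertices k = rows {1..k} {1..k}"
  by (simp add: vertices_def rows_def)

lemma finite_vertices [simp]: "finite (vertices k)"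
  by (simp add: vertices_def)

text \<open>Composition of diagrams becomes composition of these relations: a subset of the stack that is
  a union of components is the same as a pair of compatible unions of blocks in the two layers.\<close>

definition diagram_rel :: "nat \<Rightarrow> diagram \<Rightarrow> (nat set \<times> nat set) set" (\<open>\<R>\<close>) where
  "\<R> k d = {(A, B). A \<subseteq> {1..k} \<and> B \<subseteq> {1..k} \<and> saturated d (rows A B)}"

lemma diagram_rel_inj:
  assumes "partition_on (vertices k) d" "partition_on (vertices k) d'"
    and eq: "\<R> k d = \<R> k d'"
  shows "d = d'"
proof (rule partition_eqI_saturated[OF assms(1,2)])
  fix W assume W: "W \<subseteq> vertices k"
  define A B where "A = Up -` W" and "B = Down -` W"
  have W_eq: "W = rows A B"
    by (simp add: A_def B_def rows_vimage)
  have "A \<subseteq> {1..k}" "B \<subseteq> {1..k}"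
    using W unfolding vertices_eq_rows W_eq rows_subset_iff by auto
  then show "saturated d W \<longleftrightarrow> saturated d' W"
    using eq unfolding W_eq diagram_rel_def set_eq_iff by blast
qed

section \<open>Stacking as composition of relations\<close>

definition layers :: "nat set \<Rightarrow> nat set \<Rightarrow> nat set \<Rightarrow> stack_vertex set" where
  "layers A B C = Top ` A \<union> Mid ` B \<union> Bot ` C"

lemma in_layers [simp]:
  "Top i \<in> layers A B C \<longleftrightarrow> i \<in> A" "Mid i \<in> layers A B C \<longleftrightarrow> i \<in> B" "Bot i \<in> layers A B C \<longleftrightarrow> i \<in> C"
  by (auto simp: layers_def)

lemma upper_in_layers: "upper v \<in> layers A B C \<longleftrightarrow> v \<in> rows A B"
  by (cases v) auto

lemma lower_in_layers: "lower v \<in> layers A B C \<longleftrightarrow> v \<in> rows B C"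
  by (cases v) auto

lemma outer_in_layers: "outer v \<in> layers A B C \<longleftrightarrow> v \<in> rows A C"
  by (cases v) auto

lemma layers_vimage: "layers (Top -` X) (Mid -` X) (Bot -` X) = X"
proof (rule Set.set_eqI)
  fix x show "x \<in> layers (Top -` X) (Mid -` X) (Bot -` X) \<longleftrightarrow> x \<in> X"
    by (cases x) auto
qed

lemma saturated_stack_iff:
  "saturated (stack d d') (layers A B C) \<longleftrightarrow> saturated d (rows A B) \<and> saturated d' (rows B C)"
proof -
  have "upper ` D \<subseteq> layers A B C \<longleftrightarrow> D \<subseteq> rows A B"
    "upper ` D \<inter> layers A B C = {} \<longleftrightarrow> D \<inter> rows A B = {}"
    "lower ` D \<subseteq> layers A B C \<longleftrightarrow> D \<subseteq> rows B C"
    "lower ` D \<inter> layers A B C = {} \<longleftrightarrow> D \<inter> rows B C = {}" for D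
    by (auto simp: upper_in_layers lower_in_layers disjoint_iff)
  then show ?thesis
    unfolding saturated_def stack_def by (simp only: ball_Un ball_simps(9))
qed

lemma Union_stack:
  assumes "partition_on (vertices k) d" "partition_on (vertices k) d'"
  shows "\<Union>(stack d d') = layers {1..k} {1..k} {1..k}"
proof -
  have "\<Union>(stack d d') = upper ` \<Union>d \<union> lower ` \<Union>d'"
    unfolding stack_def by auto
  also have "\<dots> = upper ` vertices k \<union> lower ` vertices k"
    by (simp only: partition_onD1[OF assms(1), symmetric] partition_onD1[OF assms(2), symmetric])
  also have "\<dots> = layers {1..k} {1..k} {1..k}"
    by (force simp: vertices_def layers_def image_Un image_image)
  finally show ?thesis .
qed

lemma equiv_connected_in_stack: "equiv (\<Union>(stack d d')) (connected_in_stack d d')"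
proof (rule equivI)
  let ?r = "\<Union>B\<in>stack d d'. B \<times> B"
  show "connected_in_stack d d' \<subseteq> \<Union>(stack d d') \<times> \<Union>(stack d d')"
    unfolding connected_in_stack_def by (rule trancl_subset_Sigma) blast
  show "refl_on (\<Union>(stack d d')) (connected_in_stack d d')"
    unfolding connected_in_stack_def refl_on_def by blast
  have "sym ?r"
    by (auto simp: sym_def)
  then show "sym (connected_in_stack d d')"
    unfolding connected_in_stack_def by (rule sym_trancl)
  show "trans (connected_in_stack d d')"
    unfolding connected_in_stack_def by (rule trans_trancl)
qed

text \<open>A set closed under adjacency is closed under the transitive closure, so unions of
  components can be handled without any description of the single components.\<close>

lemma saturated_components_iff:
  "saturated (\<Union>(stack d d') // connected_in_stack d d') X \<longleftrightarrow> saturated (stack d d') X"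
    (is "saturated ?Q X \<longleftrightarrow> _")
proof
  assume sat: "saturated ?Q X"
  show "saturated (stack d d') X"
    unfolding saturated_def
  proof
    fix B assume B: "B \<in> stack d d'"
    show "B \<subseteq> X \<or> B \<inter> X = {}"
    proof (cases "B \<inter> X = {}")
      case False
      then obtain x where x: "x \<in> B" "x \<in> X"
        by blast
      let ?C = "connected_in_stack d d' `` {x}"
      have "?C \<in> ?Q"
        using x B by (intro quotientI) blast
      moreover have "B \<subseteq> ?C"
        using x B by (auto simp: connected_in_stack_def)
      ultimately show ?thesis
        using sat x by (auto simp: saturated_def)
    qed simp
  qed
next
  assume sat: "saturated (stack d d') X"
  have closed: "y \<in> X" if "(x, y) \<in> connected_in_stack d d'" "x \<in> X" for x y
    using that unfolding connected_in_stack_def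
    by (induction rule: trancl.induct) (use sat in \<open>auto simp: saturated_def\<close>)
  show "saturated ?Q X"
    unfolding saturated_def
  proof
    fix C assume "C \<in> ?Q"
    then obtain x where C: "C = connected_in_stack d d' `` {x}"
      by (auto simp: quotient_def)
    have "(z, y) \<in> connected_in_stack d d'" if "y \<in> C" "z \<in> C" for y z
      using that equiv_connected_in_stack[of d d'] unfolding C
      by (meson Image_singleton_iff equiv_def symD transD)
    then show "C \<subseteq> X \<or> C \<inter> X = {}"
      using closed by blast
  qed
qed

lemma partition_on_components:
  "partition_on (\<Union>(stack d d')) (\<Union>(stack d d') // connected_in_stack d d')"
  by (rule partition_on_quotient[OF equiv_connected_in_stack])

lemma partition_on_compose_diagrams:
  assumes "partition_on (vertices k) d" "partition_on (vertices k) d'"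
  shows "partition_on (vertices k) (compose_diagrams d d')"
proof -
  have "outer -` layers {1..k} {1..k} {1..k} = vertices k"
    by (auto simp: outer_in_layers vertices_eq_rows)
  then show ?thesis
    using partition_on_vimage[OF partition_on_components, of outer d d']
    unfolding compose_diagrams_def Union_stack[OF assms] by simp
qed

lemma diagram_rel_compose:
  assumes "partition_on (vertices k) d" "partition_on (vertices k) d'"
  shows "\<R> k (compose_diagrams d d') = \<R> k d O \<R> k d'"
proof (rule Set.set_eqI, rule iffI; clarify)
  fix A C assume AC: "(A, C) \<in> \<R> k (compose_diagrams d d')"
  define Q where "Q = \<Union>(stack d d') // connected_in_stack d d'"
  \<comment> \<open>The components that reach the outer rows inside \<open>rows A C\<close>; the
    middle layer of their union is the witness for the intermediate set. Components made of middle
    vertices only are left out.\<close>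
  define X where "X = \<Union>{D \<in> Q. outer -` D \<inter> rows A C \<noteq> {}}"
  have Q: "partition_on (layers {1..k} {1..k} {1..k}) Q"
    using partition_on_components[of d d'] Union_stack[OF assms] by (simp add: Q_def)
  have sat: "saturated (compose_diagrams d d') (rows A C)"
    and sub: "A \<subseteq> {1..k}" "C \<subseteq> {1..k}"
    using AC by (auto simp: diagram_rel_def)
  have meets: "outer -` D \<subseteq> rows A C" if "D \<in> Q" "outer -` D \<inter> rows A C \<noteq> {}" for D
  proof -
    have "outer -` D \<in> compose_diagrams d d'"
      using that by (auto simp: compose_diagrams_def Q_def)
    then show ?thesis
      using sat that(2) unfolding saturated_def by meson
  qed
  have X_iff: "outer v \<in> X \<longleftrightarrow> v \<in> rows A C" for v
  proof
    show "outer v \<in> X \<Longrightarrow> v \<in> rows A C"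
      using meets by (auto simp: X_def)
  next
    assume v: "v \<in> rows A C"
    then have "outer v \<in> layers {1..k} {1..k} {1..k}"
      unfolding outer_in_layers using sub rows_subset_iff[of A C "{1..k}" "{1..k}"] by auto
    then obtain D where "D \<in> Q" "outer v \<in> D"
      using partition_onD1[OF Q] by auto
    then show "outer v \<in> X"
      using v unfolding X_def by blast
  qed
  define B where "B = Mid -` X"
  have X_eq: "X = layers A B C"
  proof -
    have "Top -` X = A" "Bot -` X = C"
      using X_iff[of "Up _"] X_iff[of "Down _"] by auto
    then show ?thesis
      using layers_vimage[of X] by (simp add: B_def)
  qed
  have "X \<subseteq> layers {1..k} {1..k} {1..k}"
    using partition_onD1[OF Q] by (auto simp: X_def)
  then have B_sub: "B \<subseteq> {1..k}"
    by (auto simp: B_def)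
  have "saturated Q X"
    unfolding saturated_def
  proof
    fix D assume D: "D \<in> Q"
    show "D \<subseteq> X \<or> D \<inter> X = {}"
    proof (cases "D \<inter> X = {}")
      case False
      then obtain x D' where "x \<in> D" "x \<in> D'" "D' \<in> Q" "outer -` D' \<inter> rows A C \<noteq> {}"
        by (auto simp: X_def)
      then show ?thesis
        using D partition_onD2[OF Q] unfolding X_def disjoint_def by (metis (mono_tags, lifting) Sup_upper IntI empty_iff mem_Collect_eq)
    qed simp
  qed
  then have "saturated d (rows A B) \<and> saturated d' (rows B C)"
    using saturated_components_iff saturated_stack_iff X_eq unfolding Q_def by metis
  then show "(A, C) \<in> \<R> k d O \<R> k d'"
    using B_sub sub by (auto simp: diagram_rel_def)
next
  fix A B C assume AB: "(A, B) \<in> \<R> k d" and BC: "(B, C) \<in> \<R> k d'"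
  have "saturated (stack d d') (layers A B C)"
    using AB BC by (auto simp: saturated_stack_iff diagram_rel_def)
  then have sat: "saturated (\<Union>(stack d d') // connected_in_stack d d') (layers A B C)"
    by (simp only: saturated_components_iff)
  have "saturated (compose_diagrams d d') (rows A C)"
    unfolding saturated_def compose_diagrams_def
  proof (intro ballI, elim DiffE imageE)
    fix E D assume E: "E = outer -` D" and "D \<in> \<Union>(stack d d') // connected_in_stack d d'"
    then have "D \<subseteq> layers A B C \<or> D \<inter> layers A B C = {}"
      using sat unfolding saturated_def by blast
    then show "E \<subseteq> rows A C \<or> E \<inter> rows A C = {}"
      unfolding E using outer_in_layers by blast
  qed
  then show "(A, C) \<in> \<R> k (compose_diagrams d d')"
    using AB BC by (auto simp: diagram_rel_def)
qed

section \<open>Uniformity read off from the relation\<close>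

lemma card_eq_sum_blocks:
  assumes P: "partition_on V P" and fin: "finite V" and W: "W \<subseteq> V" "saturated P W"
  shows "card (W \<inter> X) = (\<Sum>B\<in>{B \<in> P. B \<subseteq> W}. card (B \<inter> X))"
proof -
  let ?S = "{B \<in> P. B \<subseteq> W}"
  have finP: "finite P"
    using finite_elements[OF fin P] .
  have fB: "finite B" if "B \<in> P" for B
    using P fin that by (metis Union_upper finite_subset partition_onD1)
  have "W \<inter> X = (\<Union>B\<in>?S. B \<inter> X)"
    using saturated_eq_Union[OF P W] by blast
  also have "card \<dots> = (\<Sum>B\<in>?S. card (B \<inter> X))"
  proof (rule card_UN_disjoint)
    show "\<forall>B\<in>?S. \<forall>C\<in>?S. B \<noteq> C \<longrightarrow> B \<inter> X \<inter> (C \<inter> X) = {}"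
      using P unfolding partition_on_def disjoint_def by blast
  qed (use finP fB in auto)
  finally show ?thesis .
qed

lemma rows_Int_Up: "A \<subseteq> {1..k} \<Longrightarrow> card (rows A B \<inter> Up ` {1..k}) = card A"
proof -
  assume "A \<subseteq> {1..k}"
  then have "rows A B \<inter> Up ` {1..k} = Up ` A"
    by (auto simp: rows_def)
  then show ?thesis
    by (simp add: card_image inj_on_def)
qed

lemma rows_Int_Down: "B \<subseteq> {1..k} \<Longrightarrow> card (rows A B \<inter> Down ` {1..k}) = card B"
proof -
  assume "B \<subseteq> {1..k}"
  then have "rows A B \<inter> Down ` {1..k} = Down ` B"
    by (auto simp: rows_def)
  then show ?thesis
    by (simp add: card_image inj_on_def)
qed

text \<open>Cardinalities add over the blocks of a saturated set, so the equality for blocks extends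
  to all unions of blocks. In this form uniformity is visibly stable under composition and
  converse.\<close>

lemma uniform_iff:
  "d \<in> \<U> k \<longleftrightarrow>
     partition_on (vertices k) d \<and> (\<forall>(A, B)\<in>\<R> k d. card A = card B)"
proof (cases "partition_on (vertices k) d")
  case P: True
  have "(\<forall>B\<in>d. card (B \<inter> Up ` {1..k}) = card (B \<inter> Down ` {1..k})) \<longleftrightarrow>
    (\<forall>(A, B)\<in>\<R> k d. card A = card B)"
  proof (intro iffI; clarify)
    fix A B assume unif: "\<forall>B\<in>d. card (B \<inter> Up ` {1..k}) = card (B \<inter> Down ` {1..k})"
      and AB: "(A, B) \<in> \<R> k d"
    have W: "rows A B \<subseteq> vertices k" "saturated d (rows A B)"
      using AB by (auto simp: diagram_rel_def vertices_eq_rows rows_subset_iff)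
    have "card (rows A B \<inter> Up ` {1..k}) = card (rows A B \<inter> Down ` {1..k})"
      unfolding card_eq_sum_blocks[OF P finite_vertices W] using unif by (intro sum.cong) auto
    moreover have "A \<subseteq> {1..k}" "B \<subseteq> {1..k}"
      using AB by (auto simp: diagram_rel_def)
    ultimately show "card A = card B"
      by (simp only: rows_Int_Up rows_Int_Down)
  next
    fix D assume *: "\<forall>(A, B)\<in>\<R> k d. card A = card B" and D: "D \<in> d"
    define A B where "A = Up -` D" and "B = Down -` D"
    have D_eq: "D = rows A B"
      by (simp add: A_def B_def rows_vimage)
    have "D \<subseteq> vertices k"
      using P D by (metis Union_upper partition_onD1)
    then have sub: "A \<subseteq> {1..k}" "B \<subseteq> {1..k}"
      unfolding vertices_eq_rows D_eq rows_subset_iff by auto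
    then have "(A, B) \<in> \<R> k d"
      using saturated_block[OF P D] by (auto simp: diagram_rel_def D_eq)
    then have "card A = card B"
      using * by blast
    then show "card (D \<inter> Up ` {1..k}) = card (D \<inter> Down ` {1..k})"
      unfolding D_eq rows_Int_Up[OF sub(1)] rows_Int_Down[OF sub(2)] .
  qed
  then show ?thesis
    using P by (simp add: uniform_block_perms_def)
qed (simp add: uniform_block_perms_def)

lemma finite_uniform_block_perms: "finite (\<U> k)"
  using finitely_many_partition_on[OF finite_vertices[of k]]
  by (rule finite_subset[rotated]) (auto simp: uniform_block_perms_def)

text \<open>The difference of the two saturated sets is saturated and has no vertex in the top row,
  so uniformity leaves it none in the bottom row.\<close>

lemma diagram_rel_single_valued:
  assumes d: "d \<in> \<U> k"
    and AB: "(A, B) \<in> \<R> k d" and AC: "(A, C) \<in> \<R> k d"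
  shows "B = C"
proof -
  have sub: "X \<subseteq> Y" if "(A, X) \<in> \<R> k d" "(A, Y) \<in> \<R> k d" for X Y
  proof -
    have "saturated d (rows A X - rows A Y)"
      using that by (intro saturated_Diff) (auto simp: diagram_rel_def)
    then have "({}, X - Y) \<in> \<R> k d"
      using that by (auto simp: diagram_rel_def rows_Diff)
    then have "card ({} :: nat set) = card (X - Y)"
      using d unfolding uniform_iff by blast
    moreover have "finite (X - Y)"
      by (rule finite_subset[of _ "{1..k}"]) (use that in \<open>auto simp: diagram_rel_def\<close>)
    ultimately show ?thesis
      by simp
  qed
  show ?thesis
    using sub[OF AB AC] sub[OF AC AB] by blast
qed

fun flip_vertex :: "vertex \<Rightarrow> vertex" where
  "flip_vertex (Up i) = Down i"
| "flip_vertex (Down i) = Up i"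

lemma flip_vertex_flip [simp]: "flip_vertex (flip_vertex v) = v"
  by (cases v) auto

lemma inj_flip_vertex: "inj flip_vertex"
  by (metis flip_vertex_flip injI)

text \<open>Reflection of the diagram, which realises the converse relation.\<close>

definition flip :: "diagram \<Rightarrow> diagram" where
  "flip d = (`) flip_vertex ` d"

lemma flip_rows: "flip_vertex ` rows A B = rows B A"
  by (force simp: rows_def image_Un image_image)

lemma diagram_rel_flip: "\<R> k (flip d) = (\<R> k d)\<inverse>"
proof -
  have "saturated (flip d) (rows B A) \<longleftrightarrow> saturated d (rows A B)" for A B
  proof -
    have "flip_vertex ` D \<subseteq> rows B A \<longleftrightarrow> D \<subseteq> rows A B"
      "flip_vertex ` D \<inter> rows B A = {} \<longleftrightarrow> D \<inter> rows A B = {}" for D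
      unfolding flip_rows[of A B, symmetric]
      by (auto simp: inj_image_subset_iff[OF inj_flip_vertex] image_Int[OF inj_flip_vertex, symmetric])
    then show ?thesis
      by (simp add: saturated_def flip_def)
  qed
  then show ?thesis
    unfolding diagram_rel_def by blast
qed

lemma flip_uniform:
  assumes "d \<in> \<U> k"
  shows "flip d \<in> \<U> k"
proof -
  have P: "partition_on (vertices k) d"
    using assms by (simp add: uniform_block_perms_def)
  have "flip d - {{}} = flip d"
    using partition_onD3[OF P] by (auto simp: flip_def)
  then have "partition_on (flip_vertex ` vertices k) (flip d)"
    using partition_on_inj_image[OF P inj_on_subset[OF inj_flip_vertex subset_UNIV]]
    by (simp add: flip_def)
  then have "partition_on (vertices k) (flip d)"
    by (simp add: vertices_eq_rows flip_rows)
  then show ?thesis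
    using assms unfolding uniform_iff diagram_rel_flip by fastforce
qed

lemma compose_uniform:
  assumes "d \<in> \<U> k" "d' \<in> \<U> k"
  shows "compose_diagrams d d' \<in> \<U> k"
  using assms unfolding uniform_iff
  by (fastforce simp: partition_on_compose_diagrams diagram_rel_compose)

lemma diagram_rel_one: "\<R> k (one (ubp_monoid k)) = Id_on (Pow {1..k})"
proof -
  have "saturated ((\<lambda>i. {Up i, Down i}) ` {1..k}) (rows A B) \<longleftrightarrow> A = B"
    if "A \<subseteq> {1..k}" "B \<subseteq> {1..k}" for A B
    using that unfolding saturated_def by auto
  then show ?thesis
    by (auto simp: diagram_rel_def ubp_monoid_def)
qed

lemma one_uniform: "one (ubp_monoid k) \<in> \<U> k"
proof -
  have "partition_on (vertices k) ((\<lambda>i. {Up i, Down i}) ` {1..k})"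
    by (auto simp: partition_on_def vertices_def disjoint_def)
  then show ?thesis
    unfolding uniform_iff diagram_rel_one by (auto simp: ubp_monoid_def)
qed

text \<open>Since the relation determines the diagram, the monoid laws are inherited from
  composition of relations.\<close>

lemma monoid_ubp_monoid: "monoid (ubp_monoid k)"
proof -
  have P: "partition_on (vertices k) d" if "d \<in> \<U> k" for d
    using that by (simp add: uniform_block_perms_def)
  have sub: "\<R> k d \<subseteq> Pow {1..k} \<times> Pow {1..k}" for d
    by (auto simp: diagram_rel_def)
  have eqI: "d = d'" if "d \<in> \<U> k" "d' \<in> \<U> k"
    "\<R> k d = \<R> k d'" for d d'
    using that by (intro diagram_rel_inj) (auto simp: P)
  have sub_O: "Id_on (Pow {1..k}) O \<R> k d = \<R> k d"
    "\<R> k d O Id_on (Pow {1..k}) = \<R> k d" for d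
    using sub[of d] by fast+
  have one: "\<R> k ((\<lambda>i. {Up i, Down i}) ` {1..k}) = Id_on (Pow {1..k})"
    "(\<lambda>i. {Up i, Down i}) ` {1..k} \<in> \<U> k"
    using diagram_rel_one[of k] one_uniform[of k] by (simp_all add: ubp_monoid_def)
  note facts = compose_uniform diagram_rel_compose[OF P P] one sub_O
  show ?thesis
    by (rule monoidI; unfold ubp_monoid_def monoid.simps partial_object.simps; (rule eqI)?;
      simp only: facts O_assoc)
qed

section \<open>Cycle types of coloured permutations\<close>

text \<open>The right-hand side mentions the cycle only through its length; this is what allows
  cycles of equal length to be matched.\<close>

lemma funpow_eq_iff_mod_card_orbit:
  assumes "permutation f"
  shows "(f ^^ m) x = (f ^^ n) x \<longleftrightarrow> m mod card (orbit f x) = n mod card (orbit f x)"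
proof -
  have self: "x \<in> orbit f x"
    by (rule permutation_self_in_orbit[OF assms])
  let ?c = "funpow_dist1 f x x"
  have inj: "inj_on (\<lambda>n. (f ^^ n) x) {0..<?c}"
    using inj_on_funpow_dist1[OF self] .
  have c: "card (orbit f x) = ?c"
    unfolding orbit_conv_funpow_dist1[OF self] card_image[OF inj] by simp
  have mod: "(f ^^ (m mod ?c)) x = (f ^^ m) x" for m
    by (rule funpow_mod_eq[OF funpow_dist1_prop[OF self]])
  have "(f ^^ m) x = (f ^^ n) x \<longleftrightarrow> (f ^^ (m mod ?c)) x = (f ^^ (n mod ?c)) x"
    by (simp only: mod)
  also have "\<dots> \<longleftrightarrow> m mod ?c = n mod ?c"
    using inj_on_eq_iff[OF inj, of "m mod ?c" "n mod ?c"] by simp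
  finally show ?thesis
    by (simp only: c)
qed

text \<open>One pair of colour and length for every cycle. The use of \<open>the_elem\<close> is
  meaningful when c is invariant under f, hence constant on cycles.\<close>

definition cycle_type :: "('a \<Rightarrow> 'a) \<Rightarrow> ('a \<Rightarrow> nat) \<Rightarrow> 'a set \<Rightarrow> (nat \<times> nat) multiset" where
  "cycle_type f c X = image_mset (\<lambda>Q. (the_elem (c ` Q), card Q)) (mset_set (orbit f ` X))"

lemma image_colour_orbit:
  assumes "f permutes X" "\<And>x. x \<in> X \<Longrightarrow> c (f x) = c x" "x \<in> X"
  shows "c ` orbit f x = {c x}"
proof -
  have "c y = c x \<and> y \<in> X" if "y \<in> orbit f x" for y
    using that by induction (use assms in \<open>auto simp: permutes_in_image\<close>)
  then show ?thesis
    using orbit_nonempty[of f x] by auto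
qed

lemma set_cycle_type_subset:
  assumes "f permutes X" "\<And>x. x \<in> X \<Longrightarrow> c (f x) = c x"
  shows "set_mset (cycle_type f c X) \<subseteq> (\<lambda>x. (c x, card (orbit f x))) ` X"
  using image_colour_orbit[where c = c, OF assms] by (cases "finite (orbit f ` X)") (auto simp: cycle_type_def)

lemma bij_betw_of_image_mset_eq:
  assumes "finite A" "finite B" "image_mset p (mset_set A) = image_mset q (mset_set B)"
  shows "\<exists>\<phi>. bij_betw \<phi> A B \<and> (\<forall>a\<in>A. q (\<phi> a) = p a)"
  using assms
proof (induction A arbitrary: B rule: finite_induct)
  case empty
  then have "B = {}"
    by (simp add: mset_set_empty_iff)
  then show ?case
    by (auto simp: bij_betw_def)
next
  case (insert a A)
  then have "p a \<in># image_mset q (mset_set B)"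
    by (metis image_mset_add_mset mset_set.insert union_single_eq_member)
  then obtain b where b: "b \<in> B" "q b = p a"
    using insert.prems(1) by auto
  have "mset_set B = add_mset b (mset_set (B - {b}))"
    using insert.prems(1) b(1) by (simp add: mset_set.remove)
  then have "image_mset p (mset_set A) = image_mset q (mset_set (B - {b}))"
    using insert b by simp
  then obtain \<phi> where \<phi>: "bij_betw \<phi> A (B - {b})" "\<forall>a\<in>A. q (\<phi> a) = p a"
    using insert.IH[of "B - {b}"] insert.prems(1) by auto
  have "bij_betw (\<phi>(a := b)) A (B - {b})"
    using \<phi>(1) insert.hyps(2) by (subst bij_betw_cong[of A _ \<phi>]) auto
  moreover have "bij_betw (\<phi>(a := b)) {a} {b}"
    by (simp add: bij_betw_def)
  ultimately have "bij_betw (\<phi>(a := b)) ({a} \<union> A) ({b} \<union> (B - {b}))"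
    by (intro bij_betw_combine) auto
  then have "bij_betw (\<phi>(a := b)) (insert a A) B"
    using b(1) by (simp add: insert_absorb del: fun_upd_apply)
  moreover have "\<forall>x\<in>insert a A. q ((\<phi>(a := b)) x) = p x"
    using \<phi>(2) b(2) insert.hyps(2) by simp
  ultimately show ?case
    by blast
qed

text \<open>An equivariant bijection carries orbits onto orbits, and here it keeps their colour and
  size.\<close>

lemma cycle_type_eqI:
  assumes X: "f permutes X" "finite X" and Y: "g permutes Y" "finite Y"
    and c: "\<And>x. x \<in> X \<Longrightarrow> c (f x) = c x"
    and h: "bij_betw h X Y" "\<And>x. x \<in> X \<Longrightarrow> c' (h x) = c x" "\<And>x. x \<in> X \<Longrightarrow> h (f x) = g (h x)"
  shows "cycle_type f c X = cycle_type g c' Y"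
proof -
  have pf: "permutation f"
    using X by (auto simp: permutation_permutes)
  have sub: "orbit f x \<subseteq> X" if "x \<in> X" for x
    using permutes_orbit_subset[OF X(1) that] .
  have img: "h ` orbit f x = orbit g (h x)" if "x \<in> X" for x
    using sub[OF that] h(3) by (intro orbit_inverse permutation_self_in_orbit[OF pf]) auto
  have inj: "inj_on h X" and hX: "h ` X = Y"
    using h(1) by (auto simp: bij_betw_def)
  have inj': "inj_on ((`) h) (orbit f ` X)"
    by (rule inj_on_subset[OF inj_on_image_Pow[OF inj]]) (use sub in auto)
  have "orbit g ` Y = (`) h ` orbit f ` X"
    unfolding hX[symmetric] using img by (auto simp: image_image)
  then have ms: "mset_set (orbit g ` Y) = image_mset ((`) h) (mset_set (orbit f ` X))"
    using image_mset_mset_set[OF inj'] by simp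
  have lab: "(the_elem (c' ` h ` Q), card (h ` Q)) = (the_elem (c ` Q), card Q)"
    if Q: "Q \<in> orbit f ` X" for Q
  proof -
    obtain x where x: "x \<in> X" "Q = orbit f x"
      using Q by auto
    have "c' ` h ` Q = c ` Q"
      unfolding image_image using sub[OF x(1)] h(2) x(2) by (intro image_cong) auto
    moreover have "card (h ` Q) = card Q"
      using sub[OF x(1)] x(2) by (intro card_image inj_on_subset[OF inj]) auto
    ultimately show ?thesis
      by simp
  qed
  have "cycle_type g c' Y =
    image_mset (\<lambda>Q. (the_elem (c' ` h ` Q), card (h ` Q))) (mset_set (orbit f ` X))"
    by (simp add: cycle_type_def ms image_mset.compositionality o_def)
  also have "\<dots> = cycle_type f c X"
    unfolding cycle_type_def using X(2) lab by (intro image_mset_cong) auto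
  finally show ?thesis ..
qed

text \<open>Cycles of equal colour and length are matched, base points are chosen on them, and h
  sends the n-th iterate of one base point to the n-th iterate of the other.\<close>

lemma cycle_type_eqD:
  assumes X: "f permutes X" "finite X" and Y: "g permutes Y" "finite Y"
    and c: "\<And>x. x \<in> X \<Longrightarrow> c (f x) = c x" and c': "\<And>y. y \<in> Y \<Longrightarrow> c' (g y) = c' y"
    and eq: "cycle_type f c X = cycle_type g c' Y"
  shows "\<exists>h. bij_betw h X Y \<and> (\<forall>x\<in>X. c' (h x) = c x \<and> h (f x) = g (h x))"
proof -
  have pf: "permutation f" and pg: "permutation g"
    using X Y by (auto simp: permutation_permutes)
  obtain \<phi> where \<phi>: "bij_betw \<phi> (orbit f ` X) (orbit g ` Y)"
    and lab: "\<forall>Q\<in>orbit f ` X. (the_elem (c' ` \<phi> Q), card (\<phi> Q)) = (the_elem (c ` Q), card Q)"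
    using bij_betw_of_image_mset_eq[OF _ _ eq[unfolded cycle_type_def]] X(2) Y(2) by auto
  define r where "r Q = (SOME x. x \<in> X \<and> orbit f x = Q)" for Q
  define s where "s Q = (SOME y. y \<in> Y \<and> orbit g y = Q)" for Q
  have r: "r Q \<in> X" "orbit f (r Q) = Q" if "Q \<in> orbit f ` X" for Q
    using someI_ex[of "\<lambda>x. x \<in> X \<and> orbit f x = Q"] that unfolding r_def by auto
  have s: "s Q \<in> Y" "orbit g (s Q) = Q" if "Q \<in> orbit g ` Y" for Q
    using someI_ex[of "\<lambda>x. x \<in> Y \<and> orbit g x = Q"] that unfolding s_def by auto
  have \<phi>_in: "\<phi> Q \<in> orbit g ` Y" if "Q \<in> orbit f ` X" for Q
    using bij_betwE[OF \<phi>] that by blast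
  \<comment> \<open>Matched cycles have the same length, so iterates of the two base points coincide
    for the same exponents. One direction makes h well defined, the other makes it
    injective.\<close>
  have pow: "(f ^^ m) (r Q) = (f ^^ n) (r Q) \<longleftrightarrow> (g ^^ m) (s (\<phi> Q)) = (g ^^ n) (s (\<phi> Q))"
    if Q: "Q \<in> orbit f ` X" for Q m n
    unfolding funpow_eq_iff_mod_card_orbit[OF pf] funpow_eq_iff_mod_card_orbit[OF pg]
      r(2)[OF Q] s(2)[OF \<phi>_in[OF Q]] using lab Q by auto
  define e where "e x = (SOME n. (f ^^ n) (r (orbit f x)) = x)" for x
  have e: "(f ^^ e x) (r (orbit f x)) = x" if x: "x \<in> X" for x
  proof -
    have "x \<in> orbit f (r (orbit f x))"
      using r(2)[of "orbit f x"] permutation_self_in_orbit[OF pf, of x] x by simp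
    then have "\<exists>n. (f ^^ n) (r (orbit f x)) = x"
      unfolding orbit_altdef_permutation[OF pf, of "r _"] by (auto dest: sym)
    then show ?thesis
      unfolding e_def by (rule someI_ex)
  qed
  define h where "h x = (g ^^ e x) (s (\<phi> (orbit f x)))" for x
  \<comment> \<open>The value of h does not depend on the exponent chosen by \<open>e\<close>;
    equivariance then follows from the exponent \<open>Suc (e x)\<close>.\<close>
  have h_eq: "h x = (g ^^ n) (s (\<phi> Q))" if "Q \<in> orbit f ` X" "x = (f ^^ n) (r Q)" for x n Q
  proof -
    have "x \<in> orbit f (r Q)"
      unfolding that(2) orbit_altdef_permutation[OF pf] by auto
    then have "x \<in> Q"
      using r(2)[OF that(1)] by simp
    then have Q: "orbit f x = Q"
      using that(1) orbit_cyclic_eq3[OF cyclic_on_orbit[OF X]] by auto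
    have xX: "x \<in> X"
      using \<open>x \<in> Q\<close> that(1) permutes_orbit_subset[OF X(1)] by blast
    have "(f ^^ e x) (r Q) = (f ^^ n) (r Q)"
      using e[OF xX] that(2) Q by simp
    then show ?thesis
      using pow[OF that(1)] by (simp add: h_def Q)
  qed
  have h_orbit: "h x \<in> \<phi> (orbit f x)" if "x \<in> X" for x
    using s(2)[OF \<phi>_in, of "orbit f x"] that unfolding h_def
    by (metis funpow_in_orbit imageI permutation_self_in_orbit[OF pg])
  have \<phi>_sub: "\<phi> Q \<subseteq> Y" if "Q \<in> orbit f ` X" for Q
    using \<phi>_in[OF that] permutes_orbit_subset[OF Y(1)] by auto
  have hY: "h x \<in> Y" if "x \<in> X" for x
    using h_orbit[OF that] \<phi>_sub[of "orbit f x"] that by blast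
  have comm: "h (f x) = g (h x)" if "x \<in> X" for x
  proof -
    have "f x = (f ^^ Suc (e x)) (r (orbit f x))"
      using e[OF that] by simp
    then have "h (f x) = (g ^^ Suc (e x)) (s (\<phi> (orbit f x)))"
      using that by (intro h_eq) auto
    then show ?thesis
      by (simp add: h_def)
  qed
  have col: "c' (h x) = c x" if "x \<in> X" for x
  proof -
    have Q: "orbit f x \<in> orbit f ` X"
      using that by simp
    obtain y where y: "y \<in> Y" "\<phi> (orbit f x) = orbit g y"
      using \<phi>_in[OF Q] by auto
    have "c' ` \<phi> (orbit f x) = {c' y}"
      unfolding y(2) by (rule image_colour_orbit[where c = c', OF Y(1) c' y(1)])
    then have "c' (h x) = the_elem (c' ` \<phi> (orbit f x))"
      using h_orbit[OF that] by (metis imageI singletonD the_elem_eq)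
    also have "\<dots> = the_elem (c ` orbit f x)"
      using lab that by simp
    also have "\<dots> = c x"
      using image_colour_orbit[where c = c, OF X(1) c that] by simp
    finally show ?thesis .
  qed
  have inj: "inj_on h X"
  proof (rule inj_onI)
    fix x y assume xy: "x \<in> X" "y \<in> X" "h x = h y"
    have Q: "orbit f x \<in> orbit f ` X" "orbit f y \<in> orbit f ` X"
      using xy by auto
    have "h x \<in> \<phi> (orbit f x)" "h x \<in> \<phi> (orbit f y)"
      using h_orbit[OF xy(1)] h_orbit[OF xy(2)] xy(3) by auto
    then have "\<phi> (orbit f x) = \<phi> (orbit f y)"
      using \<phi>_in[OF Q(1)] \<phi>_in[OF Q(2)] orbit_cyclic_eq3[OF cyclic_on_orbit[OF Y]] by (metis imageE)
    then have eq: "orbit f x = orbit f y"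
      using \<phi> Q by (auto simp: bij_betw_def dest: inj_onD)
    have "x = (f ^^ e x) (r (orbit f x))"
      by (rule e[OF xy(1), symmetric])
    also have "\<dots> = (f ^^ e y) (r (orbit f x))"
      using pow[OF Q(1), of "e x" "e y"] xy(3) eq by (simp add: h_def)
    also have "\<dots> = y"
      unfolding eq by (rule e[OF xy(2)])
    finally show "x = y" .
  qed
  have "Y \<subseteq> h ` X"
  proof
    fix y assume y: "y \<in> Y"
    then have "orbit g y \<in> \<phi> ` orbit f ` X"
      using \<phi> by (simp add: bij_betw_def)
    then obtain Q where Q: "Q \<in> orbit f ` X" "\<phi> Q = orbit g y"
      by auto
    have "y \<in> orbit g (s (\<phi> Q))"
      using s(2)[OF \<phi>_in[OF Q(1)]] Q(2) permutation_self_in_orbit[OF pg, of y] by simp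
    then obtain n where n: "y = (g ^^ n) (s (\<phi> Q))"
      unfolding orbit_altdef_permutation[OF pg] by auto
    have "h ((f ^^ n) (r Q)) = y"
      unfolding n by (rule h_eq[OF Q(1) refl])
    moreover have "(f ^^ n) (r Q) \<in> X"
      using permutes_orbit_subset[OF X(1) r(1)[OF Q(1)]]
        funpow_in_orbit[OF permutation_self_in_orbit[OF pf]] by blast
    ultimately show "y \<in> h ` X"
      by blast
  qed
  then have "bij_betw h X Y"
    using inj hY by (auto simp: bij_betw_def)
  then show ?thesis
    using comm col by blast
qed

text \<open>A cycle of colour i and length l consists of l points of weight i; the sum over X is
  grouped by orbits.\<close>

lemma sum_cycle_type:
  assumes f: "f permutes X" and fin: "finite X" and c: "\<And>x. x \<in> X \<Longrightarrow> c (f x) = c x"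
  shows "(\<Sum>(i, l)\<in>#cycle_type f c X. i * l) = (\<Sum>x\<in>X. c x)"
proof -
  have pf: "permutation f"
    using f fin by (auto simp: permutation_permutes)
  have "(\<Sum>(i, l)\<in>#cycle_type f c X. i * l) = (\<Sum>Q\<in>orbit f ` X. the_elem (c ` Q) * card Q)"
    by (simp add: cycle_type_def image_mset.compositionality o_def sum_unfold_sum_mset)
  also have "\<dots> = (\<Sum>Q\<in>orbit f ` X. \<Sum>x\<in>{x \<in> X. orbit f x = Q}. c x)"
  proof (intro sum.cong refl)
    fix Q assume "Q \<in> orbit f ` X"
    then obtain x where x: "x \<in> X" "Q = orbit f x"
      by auto
    have eq: "{y \<in> X. orbit f y = Q} = Q"
      using permutes_orbit_subset[OF f x(1)] orbit_cyclic_eq3[OF cyclic_on_orbit[OF f fin]]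
        permutation_self_in_orbit[OF pf] unfolding x(2) by blast
    have "c y = c x" if "y \<in> Q" for y
      using image_colour_orbit[where c = c, OF f c x(1)] that unfolding x(2) by blast
    then have "(\<Sum>y\<in>Q. c y) = c x * card Q"
      by simp
    then show "the_elem (c ` Q) * card Q = (\<Sum>x\<in>{x \<in> X. orbit f x = Q}. c x)"
      unfolding eq using image_colour_orbit[where c = c, OF f c x(1)] by (simp add: x(2))
  qed
  also have "\<dots> = (\<Sum>x\<in>X. c x)"
    by (rule sum.group) (use fin in auto)
  finally show ?thesis .
qed

section \<open>Realising a prescribed cycle type\<close>

lemma cycle_type_Un:
  assumes X: "f permutes X" "finite X" and Y: "g permutes Y" "finite Y" and disj: "X \<inter> Y = {}"
    and eq: "\<And>x. x \<in> X \<Longrightarrow> h x = f x" "\<And>y. y \<in> Y \<Longrightarrow> h y = g y"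
  shows "cycle_type h c (X \<union> Y) = cycle_type f c X + cycle_type g c Y"
proof -
  have orb: "orbit h x = orbit f x"
    if "f permutes X" "\<And>x. x \<in> X \<Longrightarrow> h x = f x" "x \<in> X" for f X x
    by (rule orbit_cong0[of x X]) (use that in \<open>auto simp: permutes_in_image\<close>)
  have "orbit h ` (X \<union> Y) = orbit f ` X \<union> orbit g ` Y"
    using orb[OF X(1) eq(1)] orb[OF Y(1) eq(2)] by (auto simp: image_Un)
  moreover have "orbit f ` X \<inter> orbit g ` Y = {}"
    using permutes_orbit_subset[OF X(1)] permutes_orbit_subset[OF Y(1)] disj orbit_nonempty
    by fastforce
  ultimately show ?thesis
    using X(2) Y(2) by (simp add: cycle_type_def mset_set_Union)
qed

lemma cycle_type_cycle:
  fixes B :: "nat \<Rightarrow> 'a"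
  assumes inj: "inj_on B {..<l}" and l: "l > 0" and c: "\<And>j. j < l \<Longrightarrow> c (B j) = i"
  obtains g where "g permutes B ` {..<l}" "cycle_type g c (B ` {..<l}) = {#(i, l)#}"
    "\<And>j. j < l \<Longrightarrow> c (g (B j)) = i"
proof -
  define g where "g x = (if x \<in> B ` {..<l} then B (Suc (inv_into {..<l} B x) mod l) else x)" for x
  have g_B: "g (B j) = B (Suc j mod l)" if "j < l" for j
    using that inj by (simp add: g_def inv_into_f_f)
  have g_in: "g x \<in> B ` {..<l}" if "x \<in> B ` {..<l}" for x
    using that l by (auto simp: g_B)
  have "B ` {..<l} \<subseteq> g ` B ` {..<l}"
  proof
    fix x assume "x \<in> B ` {..<l}"
    then obtain j where j: "j < l" "x = B j"
      by auto
    \<comment> \<open>The preimage of \<open>B j\<close> has index j - 1 modulo l; adding l first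
      avoids truncated subtraction at j = 0.\<close>
    have "Suc ((j + l - 1) mod l) mod l = j"
      using j(1) l by (simp add: mod_Suc_eq)
    then have "g (B ((j + l - 1) mod l)) = x"
      using g_B[of "(j + l - 1) mod l"] l j by simp
    moreover have "B ((j + l - 1) mod l) \<in> B ` {..<l}"
      using l by simp
    ultimately show "x \<in> g ` B ` {..<l}"
      by blast
  qed
  then have "g ` B ` {..<l} = B ` {..<l}"
    using g_in by blast
  then have "bij_betw g (B ` {..<l}) (B ` {..<l})"
    by (simp add: bij_betw_def finite_surj_inj)
  then have perm: "g permutes B ` {..<l}"
    by (rule bij_imp_permutes) (simp add: g_def)
  have pow: "(g ^^ n) (B 0) = B (n mod l)" for n
    using l by (induction n) (simp_all add: g_B mod_Suc_eq)
  have pg: "permutation g"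
    using perm by (auto simp: permutation_permutes)
  have "orbit g (B 0) = B ` {..<l}"
  proof
    show "orbit g (B 0) \<subseteq> B ` {..<l}"
      using permutes_orbit_subset[OF perm] l by blast
    show "B ` {..<l} \<subseteq> orbit g (B 0)"
    proof
      fix x assume "x \<in> B ` {..<l}"
      then obtain j where "j < l" "x = B j"
        by auto
      then have "x = (g ^^ j) (B 0)"
        by (simp add: pow)
      then show "x \<in> orbit g (B 0)"
        unfolding orbit_altdef_permutation[OF pg] by auto
    qed
  qed
  then have "orbit g x = B ` {..<l}" if "x \<in> B ` {..<l}" for x
    using that orbit_cyclic_eq3[OF cyclic_on_orbit[OF perm], of x "B 0"] by simp
  then have "orbit g ` B ` {..<l} = {B ` {..<l}}"
    using l by auto
  moreover have "c ` B ` {..<l} = {i}"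
    using c l by (force simp: image_image)
  ultimately have "cycle_type g c (B ` {..<l}) = {#(i, l)#}"
    using inj by (simp add: cycle_type_def card_image)
  then show ?thesis
    using that perm c g_B l by (metis mod_less_divisor)
qed

text \<open>By induction on P, a pair (i, l) is realised by l consecutive intervals of length i,
  placed behind the points already used and permuted cyclically.\<close>

lemma block_permutation_exists:
  assumes "\<And>i l. (i, l) \<in># P \<Longrightarrow> i > 0 \<and> l > 0"
  shows "\<exists>\<pi> f. partition_on {1..(\<Sum>(i, l)\<in>#P. i * l)} \<pi> \<and> f permutes \<pi> \<and>
    (\<forall>A\<in>\<pi>. card (f A) = card A) \<and> cycle_type f card \<pi> = P"
  using assms
proof (induction P)
  case empty
  show ?case
    by (intro exI[of _ "{}"] exI[of _ id]) (auto simp: partition_on_def permutes_id cycle_type_def)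
next
  case (add q P)
  obtain i l where q: "q = (i, l)"
    by force
  have il: "i > 0" "l > 0"
    using add.prems[of i l] by (auto simp: q)
  let ?n = "\<Sum>(i, l)\<in>#P. i * l"
  obtain \<pi> f where IH: "partition_on {1..?n} \<pi>" "f permutes \<pi>" "\<forall>A\<in>\<pi>. card (f A) = card A"
    "cycle_type f card \<pi> = P"
    using add.IH add.prems by auto
  define B where "B j = {?n + j * i<..?n + Suc j * i}" for j
  have card_B: "card (B j) = i" for j
    by (simp add: B_def)
  have B_disj: "B j \<inter> B j' = {}" if "j < j'" for j j'
  proof -
    have "Suc j * i \<le> j' * i"
      using that by (intro mult_le_mono1) simp
    then show ?thesis
      by (auto simp: B_def)
  qed
  have B_ne: "B j \<noteq> {}" for j
    using card_B[of j] il by auto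
  have B_inj: "inj_on B {..<l}"
    using B_disj B_ne by (intro inj_onI) (metis Int_absorb linorder_neqE_nat)
  have B_Union: "\<Union>(B ` {..<m}) = {?n<..?n + m * i}" for m
  proof (induction m)
    case (Suc m)
    have "\<Union>(B ` {..<Suc m}) = {?n<..?n + m * i} \<union> B m"
      using Suc by (auto simp: lessThan_Suc)
    also have "\<dots> = {?n<..?n + Suc m * i}"
      by (auto simp: B_def)
    finally show ?case .
  qed simp
  obtain g where g: "g permutes B ` {..<l}" "cycle_type g card (B ` {..<l}) = {#(i, l)#}"
    "\<And>j. j < l \<Longrightarrow> card (g (B j)) = i"
    using cycle_type_cycle[OF B_inj il(2), of card i] card_B by blast
  have fin: "finite \<pi>"
    using finite_elements[OF _ IH(1)] by simp
  have disj: "\<pi> \<inter> B ` {..<l} = {}"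
  proof -
    have "A \<noteq> B j" if "A \<in> \<pi>" for A j
    proof
      assume "A = B j"
      then have "?n + Suc j * i \<in> A"
        using il by (simp add: B_def)
      moreover have "A \<subseteq> {1..?n}"
        using partition_onD1[OF IH(1)] that by blast
      ultimately show False
        using il by auto
    qed
    then show ?thesis
      by blast
  qed
  define h where "h A = (if A \<in> \<pi> then f A else g A)" for A
  have h_g: "h A = g A" if "A \<in> B ` {..<l}" for A
    using that disj by (auto simp: h_def)
  have bij1: "bij_betw h \<pi> \<pi>"
    using permutes_imp_bij[OF IH(2)] by (subst bij_betw_cong[of \<pi> h f]) (auto simp: h_def)
  have bij2: "bij_betw h (B ` {..<l}) (B ` {..<l})"
    using permutes_imp_bij[OF g(1)] bij_betw_cong[of "B ` {..<l}" h g] h_g by blast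
  have "h permutes (\<pi> \<union> B ` {..<l})"
    using bij_betw_combine[OF bij1 bij2 disj]
    by (rule bij_imp_permutes) (use permutes_not_in[OF g(1)] in \<open>auto simp: h_def\<close>)
  moreover have "partition_on {1..?n + i * l} (\<pi> \<union> B ` {..<l})"
  proof (rule partition_onI)
    have "\<Union>\<pi> = {1..?n}"
      using partition_onD1[OF IH(1)] by simp
    then have "\<Union>(\<pi> \<union> B ` {..<l}) = {1..?n} \<union> {?n<..?n + l * i}"
      using B_Union[of l] by (simp only: Union_Un_distrib)
    also have "\<dots> = {1..?n + i * l}"
      by (auto simp: mult.commute)
    finally show "\<Union>(\<pi> \<union> B ` {..<l}) = {1..?n + i * l}" .
    show "{} \<notin> \<pi> \<union> B ` {..<l}"
      using B_ne partition_onD3[OF IH(1)] by auto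
    show "disjnt A A'" if A: "A \<in> \<pi> \<union> B ` {..<l}" "A' \<in> \<pi> \<union> B ` {..<l}" "A \<noteq> A'" for A A'
    proof -
      have 1: "C \<inter> C' = {}" if "C \<in> \<pi>" "C' \<in> B ` {..<l}" for C C'
      proof -
        have "C \<subseteq> {1..?n}"
          using partition_onD1[OF IH(1)] that by blast
        then show ?thesis
          using that(2) by (auto simp: B_def)
      qed
      have 2: "C \<inter> C' = {}" if "C \<in> \<pi>" "C' \<in> \<pi>" "C \<noteq> C'" for C C'
        using disjointD[OF partition_onD2[OF IH(1)] that] .
      have 3: "B j \<inter> B j' = {}" if "B j \<noteq> B j'" for j j'
        using that B_disj[of j j'] B_disj[of j' j] by (metis Int_commute linorder_neqE_nat)
      show ?thesis
        using A 1[of A A'] 1[of A' A] 2[of A A'] 3 unfolding disjnt_def by auto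
    qed
  qed
  moreover have "\<forall>A\<in>\<pi> \<union> B ` {..<l}. card (h A) = card A"
    using IH(3) g(3) card_B h_g by (auto simp: h_def)
  moreover have "cycle_type h card (\<pi> \<union> B ` {..<l}) = add_mset (i, l) P"
    using cycle_type_Un[OF IH(2) fin g(1) _ disj, of h card] IH(4) g(2) h_g by (simp add: h_def)
  ultimately show ?case
    by (intro exI[of _ "\<pi> \<union> B ` {..<l}"] exI[of _ h]) (simp add: q add.commute)
qed

text \<open>A tuple of partitions is the same as a multiset of pairs (position in the tuple, part).\<close>

definition partition_tuple :: "nat \<Rightarrow> (nat \<times> nat) multiset \<Rightarrow> nat \<Rightarrow> nat multiset" where
  "partition_tuple k P = (\<lambda>i\<in>{1..k}. image_mset snd (filter_mset (\<lambda>q. fst q = i) P))"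

definition tuple_pairs :: "nat \<Rightarrow> (nat \<Rightarrow> nat multiset) \<Rightarrow> (nat \<times> nat) multiset" where
  "tuple_pairs k p = (\<Sum>i=1..k. image_mset (Pair i) (p i))"

lemma tuple_pairs_partition_tuple:
  assumes "\<And>i l. (i, l) \<in># P \<Longrightarrow> i \<in> {1..k}"
  shows "tuple_pairs k (partition_tuple k P) = P"
proof -
  have eq: "image_mset (Pair i) (image_mset snd (filter_mset (\<lambda>q. fst q = i) P)) =
    filter_mset (\<lambda>q. fst q = i) P" for i
  proof -
    have "image_mset (\<lambda>q. (i, snd q)) (filter_mset (\<lambda>q. fst q = i) P) =
      image_mset id (filter_mset (\<lambda>q. fst q = i) P)"
      by (intro image_mset_cong) auto
    then show ?thesis
      by (simp add: image_mset.compositionality o_def)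
  qed
  have "tuple_pairs k (partition_tuple k P) = (\<Sum>i=1..k. filter_mset (\<lambda>q. fst q = i) P)"
    unfolding tuple_pairs_def partition_tuple_def by (intro sum.cong refl) (simp add: eq)
  also have "\<dots> = P"
  proof (rule multiset_eqI)
    fix q
    have "count (\<Sum>i=1..k. filter_mset (\<lambda>q. fst q = i) P) q =
      (\<Sum>i=1..k. if i = fst q then count P q else 0)"
      unfolding count_sum by (intro sum.cong refl) auto
    also have "\<dots> = count P q"
    proof (cases "q \<in># P")
      case True
      then have "fst q \<in> {1..k}"
        using assms[of "fst q" "snd q"] by simp
      then show ?thesis
        by simp
    qed (auto simp: not_in_iff)
    finally show "count (\<Sum>i=1..k. filter_mset (\<lambda>q. fst q = i) P) q = count P q" .
  qed
  finally show ?thesis .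
qed

lemma partition_tuple_tuple_pairs:
  assumes "p \<in> extensional {1..k}"
  shows "partition_tuple k (tuple_pairs k p) = p"
proof
  fix i
  have filter: "filter_mset (\<lambda>q. fst q = i) (\<Sum>j\<in>J. image_mset (Pair j) (p j)) =
    (if i \<in> J then image_mset (Pair i) (p i) else {#})" if "finite J" for J
    using that by (induction J rule: finite_induct) (auto simp: filter_mset_image_mset)
  show "partition_tuple k (tuple_pairs k p) i = p i"
    using assms by (auto simp: partition_tuple_def tuple_pairs_def filter image_mset.compositionality
        o_def extensional_def)
qed

lemma sum_tuple_pairs:
  "(\<Sum>(i, l)\<in>#tuple_pairs k p. i * l) = (\<Sum>i=1..k. i * \<Sum>\<^sub># (p i))"
proof -
  have mult: "\<Sum>\<^sub># (image_mset ((*) i) M) = i * \<Sum>\<^sub># M" for i :: nat and M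
    by (induction M) (auto simp: distrib_left)
  have "(\<Sum>(i, l)\<in>#(\<Sum>j\<in>J. image_mset (Pair j) (p j)). i * l) = (\<Sum>i\<in>J. i * \<Sum>\<^sub># (p i))"
    if "finite J" for J :: "nat set"
    using that by (induction J rule: finite_induct)
      (auto simp: image_mset.compositionality o_def mult)
  then show ?thesis
    by (simp add: tuple_pairs_def)
qed

lemma set_tuple_pairs: "(i, l) \<in># tuple_pairs k p \<longleftrightarrow> i \<in> {1..k} \<and> l \<in># p i"
  by (auto simp: tuple_pairs_def set_mset_sum)

section \<open>Uniform block permutations as bijections between blocks\<close>

definition tops :: "diagram \<Rightarrow> nat set set" where
  "tops d = (-`) Up ` d"

text \<open>The bijection from the top parts to the bottom parts of the blocks. Off
  \<open>tops d\<close> it is the identity, as \<open>permutes\<close> demands; the description is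
  proper because the relation is single-valued.\<close>

definition block_map :: "nat \<Rightarrow> diagram \<Rightarrow> nat set \<Rightarrow> nat set" where
  "block_map k d A = (if A \<in> tops d then THE B. (A, B) \<in> \<R> k d else A)"

definition diagram_of :: "nat set set \<Rightarrow> (nat set \<Rightarrow> nat set) \<Rightarrow> diagram" where
  "diagram_of \<pi> f = (\<lambda>A. rows A (f A)) ` \<pi>"

context
  fixes k :: nat and d :: diagram
  assumes d: "d \<in> \<U> k"
begin

lemma partition_d: "partition_on (vertices k) d"
  using d by (simp add: uniform_iff)

lemma card_diagram_rel: "(A, B) \<in> \<R> k d \<Longrightarrow> card A = card B"
  using d by (auto simp: uniform_iff)

lemma diagram_rel_subset: "(A, B) \<in> \<R> k d \<Longrightarrow> A \<subseteq> {1..k} \<and> B \<subseteq> {1..k}"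
  by (simp add: diagram_rel_def)

lemma block_in_rel:
  assumes "D \<in> d"
  shows "(Up -` D, Down -` D) \<in> \<R> k d"
proof -
  have "rows (Up -` D) (Down -` D) \<subseteq> rows {1..k} {1..k}"
    using assms partition_onD1[OF partition_d] unfolding rows_vimage vertices_eq_rows by blast
  then show ?thesis
    unfolding diagram_rel_def rows_subset_iff using saturated_block[OF partition_d assms]
    by (simp add: rows_vimage)
qed

lemma block_map_eqI:
  assumes "A \<in> tops d" "(A, B) \<in> \<R> k d"
  shows "block_map k d A = B"
  using assms diagram_rel_single_valued[OF d] by (simp add: block_map_def the_equality)

lemma block_map_block: "D \<in> d \<Longrightarrow> block_map k d (Up -` D) = Down -` D"
  by (intro block_map_eqI block_in_rel) (simp add: tops_def)

lemma block_map_rel: "A \<in> tops d \<Longrightarrow> (A, block_map k d A) \<in> \<R> k d"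
  using block_in_rel block_map_block by (auto simp: tops_def)

lemma diagram_of_block_map: "diagram_of (tops d) (block_map k d) = d"
  by (simp add: diagram_of_def tops_def image_image block_map_block rows_vimage cong: image_cong_simp)

lemma card_block_map: "A \<in> tops d \<Longrightarrow> card (block_map k d A) = card A"
  using card_diagram_rel block_map_rel by metis

text \<open>A block without top vertices would by uniformity have no bottom vertices either, so no
  block disappears on restriction to the top row.\<close>

lemma partition_tops: "partition_on {1..k} (tops d)"
proof -
  have "Up -` D \<noteq> {}" if D: "D \<in> d" for D
  proof
    assume "Up -` D = {}"
    then have *: "({}, Down -` D) \<in> \<R> k d"
      using block_in_rel[OF D] by simp
    have "finite (Down -` D)"
      using diagram_rel_subset[OF *] by (meson finite_atLeastAtMost finite_subset)
    then have "Down -` D = {}"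
      using card_diagram_rel[OF *] by simp
    then have "D = {}"
      using \<open>Up -` D = {}\<close> rows_vimage[of D] by (simp add: rows_def)
    then show False
      using D partition_onD3[OF partition_d] by simp
  qed
  then have "(-`) Up ` d - {{}} = tops d"
    by (auto simp: tops_def)
  then show ?thesis
    using partition_on_vimage[OF partition_d, of Up] by (simp add: vertices_eq_rows)
qed

text \<open>A union of top parts is completed to a union of blocks by adding the bottom parts of the
  same blocks.\<close>

lemma Domain_diagram_rel: "Domain (\<R> k d) = {A. A \<subseteq> {1..k} \<and> saturated (tops d) A}"
proof (intro equalityI subsetI)
  fix A assume "A \<in> Domain (\<R> k d)"
  then obtain B where AB: "(A, B) \<in> \<R> k d"
    by blast
  have "Up -` D \<subseteq> A \<or> Up -` D \<inter> A = {}" if D: "D \<in> d" for D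
  proof -
    have "D \<subseteq> rows A B \<or> D \<inter> rows A B = {}"
      using AB D by (simp add: diagram_rel_def saturated_def)
    then have "Up -` D \<subseteq> Up -` rows A B \<or> Up -` D \<inter> Up -` rows A B = {}"
      by blast
    then show ?thesis
      by simp
  qed
  then show "A \<in> {A. A \<subseteq> {1..k} \<and> saturated (tops d) A}"
    using diagram_rel_subset[OF AB] by (auto simp: saturated_def tops_def)
next
  fix A assume "A \<in> {A. A \<subseteq> {1..k} \<and> saturated (tops d) A}"
  then have A: "A \<subseteq> {1..k}" "saturated (tops d) A"
    by auto
  define W where "W = \<Union>{D \<in> d. Up -` D \<subseteq> A}"
  have "W \<subseteq> vertices k"
    using partition_onD1[OF partition_d] by (auto simp: W_def)
  have sat: "saturated d W"
    unfolding saturated_def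
  proof
    fix D assume D: "D \<in> d"
    show "D \<subseteq> W \<or> D \<inter> W = {}"
    proof (cases "D \<inter> W = {}")
      case False
      then obtain D' where D': "D' \<in> d" "Up -` D' \<subseteq> A" "D \<inter> D' \<noteq> {}"
        by (auto simp: W_def)
      then have "D' = D"
        using disjointD[OF partition_onD2[OF partition_d] D D'(1)] by auto
      then show ?thesis
        using D' by (auto simp: W_def)
    qed simp
  qed
  have "Up -` W = A"
  proof
    show "Up -` W \<subseteq> A"
      by (auto simp: W_def)
    show "A \<subseteq> Up -` W"
    proof
      fix i assume i: "i \<in> A"
      then have "Up i \<in> vertices k"
        using A(1) by (auto simp: vertices_eq_rows)
      then obtain D where D: "D \<in> d" "Up i \<in> D"
        using partition_onD1[OF partition_d] by auto
      then have "Up -` D \<in> tops d" "Up -` D \<inter> A \<noteq> {}"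
        using i by (auto simp: tops_def)
      then have "Up -` D \<subseteq> A"
        using A(2) unfolding saturated_def by metis
      then show "i \<in> Up -` W"
        using D by (auto simp: W_def)
    qed
  qed
  then have W: "W = rows A (Down -` W)"
    using rows_vimage[of W] by simp
  then have "rows A (Down -` W) \<subseteq> rows {1..k} {1..k}"
    using \<open>W \<subseteq> vertices k\<close> by (simp add: vertices_eq_rows)
  then have "(A, Down -` W) \<in> \<R> k d"
    using sat W unfolding diagram_rel_def rows_subset_iff by simp
  then show "A \<in> Domain (\<R> k d)"
    by blast
qed

end

text \<open>The objects of the groupoid, which are domains of relations, are thereby identified with
  set partitions of \<open>[k]\<close>.\<close>

lemma tops_eq_iff:
  assumes "d \<in> \<U> k" "d' \<in> \<U> k"
  shows "tops d = tops d' \<longleftrightarrow> Domain (\<R> k d) = Domain (\<R> k d')"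
proof
  assume "Domain (\<R> k d) = Domain (\<R> k d')"
  then have "saturated (tops d) A \<longleftrightarrow> saturated (tops d') A" if "A \<subseteq> {1..k}" for A
    using that unfolding Domain_diagram_rel[OF assms(1)] Domain_diagram_rel[OF assms(2)] by blast
  then show "tops d = tops d'"
    by (rule partition_eqI_saturated[OF partition_tops[OF assms(1)] partition_tops[OF assms(2)]])
qed (simp add: Domain_diagram_rel assms)

lemma diagram_eqI:
  assumes "d \<in> \<U> k" "d' \<in> \<U> k" "tops d = tops d'"
    and "\<And>A. A \<in> tops d \<Longrightarrow> block_map k d A = block_map k d' A"
  shows "d = d'"
proof -
  have "diagram_of (tops d) (block_map k d) = diagram_of (tops d') (block_map k d')"
    using assms(3,4) by (simp add: diagram_of_def)
  then show ?thesis
    by (simp only: diagram_of_block_map[OF assms(1)] diagram_of_block_map[OF assms(2)])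
qed

text \<open>The top partition of the reflected diagram is the bottom partition of d; this gives
  access to ranges of relations.\<close>

lemma block_map_flip:
  assumes d: "d \<in> \<U> k"
  shows "tops (flip d) = block_map k d ` tops d"
proof -
  have "Up -` (flip_vertex ` D) = Down -` D" for D
  proof (rule Set.set_eqI)
    fix i
    have "Up i \<in> flip_vertex ` D \<longleftrightarrow> Down i \<in> D"
      by (metis flip_vertex.simps(2) flip_vertex_flip image_iff)
    then show "i \<in> Up -` (flip_vertex ` D) \<longleftrightarrow> i \<in> Down -` D"
      by simp
  qed
  then show ?thesis
    by (simp add: tops_def flip_def image_image block_map_block[OF d] cong: image_cong_simp)
qed

lemma inj_on_block_map:
  assumes d: "d \<in> \<U> k"
  shows "inj_on (block_map k d) (tops d)"
proof (rule inj_onI)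
  fix A B assume AB: "A \<in> tops d" "B \<in> tops d" "block_map k d A = block_map k d B"
  have "(block_map k d A, A) \<in> \<R> k (flip d)" "(block_map k d A, B) \<in> \<R> k (flip d)"
    using block_map_rel[OF d AB(1)] block_map_rel[OF d AB(2)] AB(3) by (auto simp: diagram_rel_flip)
  then show "A = B"
    by (rule diagram_rel_single_valued[OF flip_uniform[OF d]])
qed

text \<open>Every size-preserving bijection between two set partitions is a block map. This supplies
  both the conjugating arrows and the loops of prescribed type.\<close>

lemma diagram_of_uniform:
  assumes \<pi>: "partition_on {1..k} \<pi>" and \<pi>': "partition_on {1..k} \<pi>'"
    and f: "bij_betw f \<pi> \<pi>'" and card: "\<And>A. A \<in> \<pi> \<Longrightarrow> card (f A) = card A"
  shows "diagram_of \<pi> f \<in> \<U> k" "tops (diagram_of \<pi> f) = \<pi>"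
    "\<And>A. A \<in> \<pi> \<Longrightarrow> block_map k (diagram_of \<pi> f) A = f A"
proof -
  have f\<pi>: "f ` \<pi> = \<pi>'" and inj: "inj_on f \<pi>"
    using f by (auto simp: bij_betw_def)
  have sub: "A \<subseteq> {1..k}" if "A \<in> \<pi>" for A
    using partition_onD1[OF \<pi>] that by blast
  have sub': "f A \<subseteq> {1..k}" if "A \<in> \<pi>" for A
    using partition_onD1[OF \<pi>'] that f\<pi> by blast
  have "\<Union>(diagram_of \<pi> f) = rows (\<Union>\<pi>) (\<Union>(f ` \<pi>))"
    unfolding diagram_of_def using rows_Union[of "\<lambda>A. A" f \<pi>] by simp
  then have "\<Union>(diagram_of \<pi> f) = vertices k"
    unfolding f\<pi> vertices_eq_rows using partition_onD1[OF \<pi>] partition_onD1[OF \<pi>'] by simp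
  moreover have "disjnt (rows A (f A)) (rows B (f B))" if AB: "A \<in> \<pi>" "B \<in> \<pi>" "A \<noteq> B" for A B
  proof -
    have "A \<inter> B = {}"
      using disjointD[OF partition_onD2[OF \<pi>] AB] .
    moreover have "f A \<inter> f B = {}"
      using AB inj f\<pi> by (intro disjointD[OF partition_onD2[OF \<pi>']]) (auto dest: inj_onD)
    ultimately show ?thesis
      by (simp add: disjnt_def rows_Int) (simp add: rows_def)
  qed
  moreover have "{} \<notin> diagram_of \<pi> f"
    using partition_onD3[OF \<pi>] by (auto simp: diagram_of_def rows_def)
  ultimately have P: "partition_on (vertices k) (diagram_of \<pi> f)"
    by (intro partition_onI) (auto simp: diagram_of_def)
  then show unif: "diagram_of \<pi> f \<in> \<U> k"
    using card by (auto simp: uniform_block_perms_def diagram_of_def rows_Int_Up[OF sub]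
        rows_Int_Down[OF sub'] simp del: One_nat_def)
  show top: "tops (diagram_of \<pi> f) = \<pi>"
    by (simp add: tops_def diagram_of_def image_image)
  show "block_map k (diagram_of \<pi> f) A = f A" if "A \<in> \<pi>" for A
    using block_map_block[OF unif, of "rows A (f A)"] that by (simp add: diagram_of_def)
qed

lemma carrier_ubp_monoid [simp]: "carrier (ubp_monoid k) = \<U> k"
  by (simp add: ubp_monoid_def)

interpretation ubp: partial_injection_monoid "ubp_monoid k" "\<R> k" for k
proof (intro partial_injection_monoid.intro partial_injection_monoid_axioms.intro finite_monoid.intro
    finite_monoid_axioms.intro)
  show "Group.monoid (ubp_monoid k)"
    by (rule monoid_ubp_monoid)
  show "finite (carrier (ubp_monoid k))"
    by (simp add: ubp_monoid_def finite_uniform_block_perms)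
  show "inj_on (\<R> k) (carrier (ubp_monoid k))"
    by (rule inj_onI, rule diagram_rel_inj) (auto simp: ubp_monoid_def uniform_iff)
  fix d assume "d \<in> carrier (ubp_monoid k)"
  then have d: "d \<in> \<U> k"
    by (simp add: ubp_monoid_def)
  show "\<R> k (d \<otimes>\<^bsub>ubp_monoid k\<^esub> d') = \<R> k d O \<R> k d'"
    if "d' \<in> carrier (ubp_monoid k)" for d'
    using d that by (auto simp: ubp_monoid_def uniform_iff intro!: diagram_rel_compose)
  show "\<exists>d'\<in>carrier (ubp_monoid k). \<R> k d' = (\<R> k d)\<inverse>"
    using flip_uniform[OF d] diagram_rel_flip by (auto simp: ubp_monoid_def)
  show "single_valued (\<R> k d)"
    using diagram_rel_single_valued[OF d] by (rule single_valuedI)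
qed

section \<open>Loops, conjugacy and cycle types\<close>

lemma loops_iff:
  "d \<in> ubp.loops k \<longleftrightarrow> d \<in> \<U> k \<and> block_map k d permutes tops d"
proof (cases "d \<in> \<U> k")
  case d: True
  have "d \<in> ubp.loops k \<longleftrightarrow> Domain (\<R> k d) = Domain (\<R> k (flip d))"
    using d by (simp add: ubp.loops_def diagram_rel_flip)
  also have "\<dots> \<longleftrightarrow> block_map k d ` tops d = tops d"
    using tops_eq_iff[OF d flip_uniform[OF d]] block_map_flip[OF d] by auto
  also have "\<dots> \<longleftrightarrow> block_map k d permutes tops d"
  proof
    assume "block_map k d ` tops d = tops d"
    then have "bij_betw (block_map k d) (tops d) (tops d)"
      using inj_on_block_map[OF d] by (simp add: bij_betw_def)
    then show "block_map k d permutes tops d"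
      by (rule bij_imp_permutes) (simp add: block_map_def)
  qed (rule permutes_image)
  finally show ?thesis
    using d by simp
qed (simp add: ubp.loops_def)

lemma finite_tops: "d \<in> \<U> k \<Longrightarrow> finite (tops d)"
  using partition_tops finite_elements by blast

text \<open>When the bottom partition of d is the top partition of d', no blocks merge in the stack,
  and composition of diagrams is composition of block maps.\<close>

lemma block_map_compose:
  assumes d: "d \<in> \<U> k" and d': "d' \<in> \<U> k"
    and top: "tops d' = block_map k d ` tops d"
  shows "tops (compose_diagrams d d') = tops d"
    "A \<in> tops d \<Longrightarrow> block_map k (compose_diagrams d d') A = block_map k d' (block_map k d A)"
proof -
  have rel: "\<R> k (compose_diagrams d d') = \<R> k d O \<R> k d'"
    using d d' by (intro diagram_rel_compose) (auto simp: uniform_iff)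
  have "Domain (\<R> k d') = Domain (\<R> k (flip d))"
    using tops_eq_iff[OF d' flip_uniform[OF d]] top block_map_flip[OF d] by simp
  then have "Domain (\<R> k d') = Range (\<R> k d)"
    by (simp add: diagram_rel_flip)
  then have "Domain (\<R> k (compose_diagrams d d')) = Domain (\<R> k d)"
    unfolding rel by blast
  then show top': "tops (compose_diagrams d d') = tops d"
    using tops_eq_iff[OF compose_uniform[OF d d'] d] by simp
  show "block_map k (compose_diagrams d d') A = block_map k d' (block_map k d A)"
    if A: "A \<in> tops d"
  proof (rule block_map_eqI[OF compose_uniform[OF d d']])
    show "A \<in> tops (compose_diagrams d d')"
      using top' A by simp
    have "block_map k d A \<in> tops d'"
      using top A by simp
    then show "(A, block_map k d' (block_map k d A)) \<in> \<R> k (compose_diagrams d d')"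
      unfolding rel using block_map_rel[OF d A] block_map_rel[OF d'] by blast
  qed
qed

text \<open>The bijection g is the block map of the conjugating arrow, and \<open>diagram_of\<close>
  turns g back into an arrow.\<close>

lemma conjugate_iff:
  assumes t: "t \<in> ubp.loops k" and t': "t' \<in> ubp.loops k"
  shows "ubp.conjugate k t t' \<longleftrightarrow>
    (\<exists>g. bij_betw g (tops t) (tops t') \<and>
      (\<forall>A\<in>tops t. card (g A) = card A \<and> g (block_map k t A) = block_map k t' (g A)))"
proof
  have tU: "t \<in> \<U> k" and t'U: "t' \<in> \<U> k"
    and perm: "block_map k t permutes tops t" and perm': "block_map k t' permutes tops t'"
    using t t' by (auto simp: loops_iff)
  {
    assume "ubp.conjugate k t t'"
    then obtain h where h: "h \<in> \<U> k"
      "Domain (\<R> k h) = Domain (\<R> k t)"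
      "Range (\<R> k h) = Domain (\<R> k t')"
      "\<R> k h O \<R> k t' = \<R> k t O \<R> k h"
      by (auto simp: ubp.conjugate_def)
    have top: "tops h = tops t"
      using tops_eq_iff[OF h(1) tU] h(2) by simp
    have top': "block_map k h ` tops t = tops t'"
      using tops_eq_iff[OF flip_uniform[OF h(1)] t'U] h(3) block_map_flip[OF h(1)] top
      by (simp add: diagram_rel_flip)
    have "block_map k h (block_map k t A) = block_map k t' (block_map k h A)"
      if A: "A \<in> tops t" for A
    proof -
      have "(A, block_map k t' (block_map k h A)) \<in> \<R> k h O \<R> k t'"
        using block_map_rel[OF h(1), of A] block_map_rel[OF t'U, of "block_map k h A"] A top top'
        by blast
      then obtain B where B: "(A, B) \<in> \<R> k t"
        "(B, block_map k t' (block_map k h A)) \<in> \<R> k h"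
        unfolding h(4) by blast
      have "B = block_map k t A"
        using block_map_eqI[OF tU A B(1)] by simp
      moreover have "block_map k t A \<in> tops h"
        using permutes_in_image[OF perm] A top by simp
      ultimately show ?thesis
        using block_map_eqI[OF h(1)] B(2) by simp
    qed
    then show "\<exists>g. bij_betw g (tops t) (tops t') \<and>
      (\<forall>A\<in>tops t. card (g A) = card A \<and> g (block_map k t A) = block_map k t' (g A))"
      using inj_on_block_map[OF h(1)] card_block_map[OF h(1)] top top'
      by (intro exI[of _ "block_map k h"]) (auto simp: bij_betw_def)
  next
    assume "\<exists>g. bij_betw g (tops t) (tops t') \<and>
      (\<forall>A\<in>tops t. card (g A) = card A \<and> g (block_map k t A) = block_map k t' (g A))"
    then obtain g where g: "bij_betw g (tops t) (tops t')"
      "\<And>A. A \<in> tops t \<Longrightarrow> card (g A) = card A"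
      "\<And>A. A \<in> tops t \<Longrightarrow> g (block_map k t A) = block_map k t' (g A)"
      by blast
    define h where "h = diagram_of (tops t) g"
    have h: "h \<in> \<U> k" "tops h = tops t"
      "\<And>A. A \<in> tops t \<Longrightarrow> block_map k h A = g A"
      unfolding h_def
      using diagram_of_uniform[OF partition_tops[OF tU] partition_tops[OF t'U] g(1) g(2)]
      by auto
    have img: "block_map k h ` tops h = tops t'"
      using h(2,3) g(1) by (auto simp: bij_betw_def)
    have img': "block_map k t ` tops t = tops h"
      using permutes_image[OF perm] h(2) by simp
    have eq: "compose_diagrams h t' = compose_diagrams t h"
    proof (rule diagram_eqI[OF compose_uniform[OF h(1) t'U] compose_uniform[OF tU h(1)]])
      show "tops (compose_diagrams h t') = tops (compose_diagrams t h)"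
        using block_map_compose(1)[OF h(1) t'U img[symmetric]]
          block_map_compose(1)[OF tU h(1) img'[symmetric]] h(2) by simp
      fix A assume "A \<in> tops (compose_diagrams h t')"
      then have A: "A \<in> tops h" "A \<in> tops t"
        using block_map_compose(1)[OF h(1) t'U img[symmetric]] h(2) by auto
      then show "block_map k (compose_diagrams h t') A = block_map k (compose_diagrams t h) A"
        using block_map_compose(2)[OF h(1) t'U img[symmetric] A(1)] permutes_in_image[OF perm, of A]
          block_map_compose(2)[OF tU h(1) img'[symmetric] A(2)] h(3) g(3) by simp
    qed
    have "\<R> k h O \<R> k t' = \<R> k t O \<R> k h"
      using h(1) tU t'U diagram_rel_compose[of k h t'] diagram_rel_compose[of k t h] eq
      by (simp add: uniform_iff)
    moreover have "Domain (\<R> k h) = Domain (\<R> k t)"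
      using tops_eq_iff[OF h(1) tU] h(2) by simp
    moreover have "Range (\<R> k h) = Domain (\<R> k t')"
      using tops_eq_iff[OF flip_uniform[OF h(1)] t'U] img block_map_flip[OF h(1)]
      by (simp add: diagram_rel_flip)
    ultimately show "ubp.conjugate k t t'"
      unfolding ubp.conjugate_def using h(1) by auto
  }
qed

definition loop_type :: "nat \<Rightarrow> diagram \<Rightarrow> (nat \<times> nat) multiset" where
  "loop_type k d = cycle_type (block_map k d) card (tops d)"

lemma conjugate_iff_loop_type:
  assumes t: "t \<in> ubp.loops k" and t': "t' \<in> ubp.loops k"
  shows "ubp.conjugate k t t' \<longleftrightarrow> loop_type k t = loop_type k t'"
proof -
  have tU: "t \<in> \<U> k" and t'U: "t' \<in> \<U> k"
    and perm: "block_map k t permutes tops t" and perm': "block_map k t' permutes tops t'"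
    using t t' by (auto simp: loops_iff)
  note fin = finite_tops[OF tU] finite_tops[OF t'U]
  show ?thesis
    unfolding conjugate_iff[OF t t'] loop_type_def
    using cycle_type_eqI[where c = card and c' = card, OF perm fin(1) perm' fin(2) card_block_map[OF tU]]
      cycle_type_eqD[where c = card and c' = card, OF perm fin(1) perm' fin(2) card_block_map[OF tU]
        card_block_map[OF t'U]]
    by blast
qed

lemma loop_type_pairs:
  assumes t: "t \<in> ubp.loops k" and il: "(i, l) \<in># loop_type k t"
  shows "i \<in> {1..k}" "l > 0"
proof -
  have tU: "t \<in> \<U> k" and perm: "block_map k t permutes tops t"
    using t by (auto simp: loops_iff)
  obtain A where A: "A \<in> tops t" "i = card A" "l = card (orbit (block_map k t) A)"
    using set_cycle_type_subset[where c = card, OF perm card_block_map[OF tU]] il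
    unfolding loop_type_def by auto
  have P: "partition_on {1..k} (tops t)"
    by (rule partition_tops[OF tU])
  have "A \<subseteq> {1..k}" "A \<noteq> {}"
    using A(1) partition_onD1[OF P] partition_onD3[OF P] by auto
  moreover from this have "finite A"
    by (meson finite_atLeastAtMost finite_subset)
  ultimately have "card A \<le> k" "card A > 0"
    using card_mono[of "{1..k}" A] by (auto simp: card_gt_0_iff)
  then show "i \<in> {1..k}"
    using A(2) by simp
  have "finite (orbit (block_map k t) A)"
    using permutes_orbit_subset[OF perm A(1)] finite_tops[OF tU] finite_subset by blast
  then show "l > 0"
    using A(3) orbit_nonempty by (simp add: card_gt_0_iff)
qed

text \<open>Block sizes are the colours, so the weighted sum is the total size of the
  blocks.\<close>

lemma sum_loop_type:
  assumes t: "t \<in> ubp.loops k"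
  shows "(\<Sum>(i, l)\<in>#loop_type k t. i * l) = k"
proof -
  have tU: "t \<in> \<U> k" and perm: "block_map k t permutes tops t"
    using t by (auto simp: loops_iff)
  have P: "partition_on {1..k} (tops t)"
    by (rule partition_tops[OF tU])
  have fin: "finite A" if "A \<in> tops t" for A
    using partition_onD1[OF P] that by (metis Union_upper finite_atLeastAtMost finite_subset)
  have "(\<Sum>(i, l)\<in>#loop_type k t. i * l) = (\<Sum>A\<in>tops t. card A)"
    unfolding loop_type_def
    by (rule sum_cycle_type[where c = card, OF perm finite_tops[OF tU] card_block_map[OF tU]])
  also have "\<dots> = card (\<Union>(tops t))"
    using fin partition_onD2[OF P]
    by (subst card_Union_disjoint) (auto simp: disjoint_def pairwise_def disjnt_def)
  also have "\<dots> = k"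
    by (simp add: partition_onD1[OF P, symmetric])
  finally show ?thesis .
qed

lemma loop_with_type:
  assumes "\<And>i l. (i, l) \<in># P \<Longrightarrow> i > 0 \<and> l > 0" and sum: "(\<Sum>(i, l)\<in>#P. i * l) = k"
  shows "\<exists>t\<in>ubp.loops k. loop_type k t = P"
proof -
  obtain \<pi> f where f: "partition_on {1..k} \<pi>" "f permutes \<pi>" "\<forall>A\<in>\<pi>. card (f A) = card A"
    "cycle_type f card \<pi> = P"
    using block_permutation_exists[of P] assms by auto
  define t where "t = diagram_of \<pi> f"
  have t: "t \<in> \<U> k" "tops t = \<pi>" "\<And>A. A \<in> \<pi> \<Longrightarrow> block_map k t A = f A"
    unfolding t_def using diagram_of_uniform[OF f(1) f(1) permutes_imp_bij[OF f(2)]] f(3) by auto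
  have "block_map k t = f"
  proof
    fix A show "block_map k t A = f A"
      using t permutes_not_in[OF f(2)] by (cases "A \<in> \<pi>") (auto simp: block_map_def)
  qed
  then show ?thesis
    using t f by (intro bexI[of _ t]) (auto simp: loop_type_def loops_iff)
qed

lemma tuple_pairs_loop_type:
  assumes "t \<in> ubp.loops k"
  shows "tuple_pairs k (partition_tuple k (loop_type k t)) = loop_type k t"
  using loop_type_pairs(1)[OF assms] by (rule tuple_pairs_partition_tuple)

text \<open>Cycles have positive length, so no part is zero, and the total size of the blocks gives
  the weight condition. Conversely, the pairs of a given tuple are the cycle type of some
  loop.\<close>

lemma image_partition_tuple_loop_type:
  "(\<lambda>t. partition_tuple k (loop_type k t)) ` ubp.loops k = index_set k"
proof (intro equalityI subsetI)
  fix p assume "p \<in> (\<lambda>t. partition_tuple k (loop_type k t)) ` ubp.loops k"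
  then obtain t where t: "t \<in> ubp.loops k" "p = partition_tuple k (loop_type k t)"
    by auto
  have "tuple_pairs k p = loop_type k t"
    unfolding t(2) by (rule tuple_pairs_loop_type[OF t(1)])
  then have "(\<Sum>i=1..k. i * \<Sum>\<^sub># (p i)) = k"
    using sum_tuple_pairs[of k p] sum_loop_type[OF t(1)] by simp
  moreover have "p \<in> {1..k} \<rightarrow>\<^sub>E int_partitions"
    unfolding t(2) partition_tuple_def int_partitions_def using loop_type_pairs(2)[OF t(1)] by fastforce
  ultimately show "p \<in> index_set k"
    by (simp add: index_set_def)
next
  fix p assume p: "p \<in> index_set k"
  then have ext: "p \<in> extensional {1..k}" and pos: "\<And>i. i \<in> {1..k} \<Longrightarrow> 0 \<notin># p i"
    and sum: "(\<Sum>i=1..k. i * \<Sum>\<^sub># (p i)) = k"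
    by (auto simp: index_set_def PiE_def int_partitions_def)
  have "i > 0 \<and> l > 0" if "(i, l) \<in># tuple_pairs k p" for i l
    using that pos[of i] unfolding set_tuple_pairs by (auto intro!: gr0I)
  then obtain t where t: "t \<in> ubp.loops k" "loop_type k t = tuple_pairs k p"
    using loop_with_type[of "tuple_pairs k p" k] sum by (auto simp: sum_tuple_pairs)
  then show "p \<in> (\<lambda>t. partition_tuple k (loop_type k t)) ` ubp.loops k"
    using partition_tuple_tuple_pairs[OF ext] by (intro image_eqI[of _ _ t]) auto
qed

theorem proposition3p17:
  fixes k :: nat
  assumes "k \<ge> 1"
  shows "(\<exists>F. bij_betw F (index_set k) (irrep_classes k)) \<and>
         (\<forall>M :: (diagram \<Rightarrow> complex, 'v) module.
            simple_module (monoid_algebra (ubp_monoid k)) M \<longrightarrow>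
            (\<exists>N \<in> irreps k. module_iso (monoid_algebra (ubp_monoid k)) M N))"
proof (intro conjI allI impI)
  \<comment> \<open>Passing from multisets of pairs to tuples loses nothing on loop types, because
    \<open>tuple_pairs\<close> recovers the multiset.\<close>
  have "ubp.conjugate k t t' \<longleftrightarrow>
      partition_tuple k (loop_type k t) = partition_tuple k (loop_type k t')"
    if "t \<in> ubp.loops k" "t' \<in> ubp.loops k" for t t'
    unfolding conjugate_iff_loop_type[OF that]
    using tuple_pairs_loop_type[OF that(1)] tuple_pairs_loop_type[OF that(2)] by metis
  then obtain F where F: "bij_betw F (index_set k) (ubp.alg.block_idems k)"
    using ubp.bij_betw_class_types_block_idems[OF image_partition_tuple_loop_type] by blast
  obtain F' where F': "bij_betw F' (ubp.alg.block_idems k) (irrep_classes k)"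
    using ubp.alg.bij_betw_block_idems_classes[of k] unfolding irrep_classes_def irreps_def by blast
  show "\<exists>F. bij_betw F (index_set k) (irrep_classes k)"
    using bij_betw_trans[OF F F'] by blast
next
  fix M :: "(diagram \<Rightarrow> complex, 'v) module"
  assume "simple_module (monoid_algebra (ubp_monoid k)) M"
  then show "\<exists>N\<in>irreps k. module_iso (monoid_algebra (ubp_monoid k)) M N"
    using ubp.alg.simple_module_nat_functions[of k M] by (auto simp: irreps_def)
qed

end
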